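(* Let $(X,\perp)$ be an orthoset of rank $\geq 4$. Assume that $(X,\perp)$ is divisibly transitive and quasiprimitive. Then there is a positive-definite quadratic space $H$ over a subfield of $\mathbb R$, possessing a unit vector in each one-dimensional subspace, such that $(X,\perp)$ is isomorphic to $(P(H),\perp)$.
   Context: An orthoset is a non-empty set $X$ with a symmetric, irreflexive binary relation $\perp$. An automorphism of $(X,\perp)$ is a bijection $\varphi$ of $X$ with $p \perp q \Leftrightarrow \varphi(p)\perp\varphi(q)$; the group of automorphisms is denoted $\mathbf O(X)$. The rank of $X$ is the smallest cardinal $\lambda$ such that every subset of mutually orthogonal elements has cardinality $\leq \lambda$. For distinct $e,f\in X$, let $G_{ef} = \{\varphi\in\mathbf O(X) : \varphi(x)=x \text{ for all } x \text{ with } x \perp e \text{ and } x\perp f\}$ and $R_{ef} = \{\varphi\in G_{ef} : \text{for any } k\geq 1 \text{ there is } \psi\in G_{ef} \text{ with } \varphi=\psi^k\}$. $(X,\perp)$ is divisibly transitive if for any distinct $e,f\in X$: (DT0) $R_{ef}$ is an abelian subgroup of $\mathbf O(X)$; (DT1) there is $\varphi\in R_{ef}$ with $\varphi(e)=f$; (DT2) for any further distinct elements $e',f' \in X$ there is $\tau\in\mathbf O(X)$ with $\tau(e)=e'$ and $R_{ef}=\tau^{-1}R_{e'f'}\tau$. For a divisibly transitive orthoset, a simple rotation is an automorphism contained in some $R_{ef}$, $e\neq f$; the identity is the trivial rotation. The rotation group $\mathbf R(X)$ is the subgroup of $\mathbf O(X)$ generated by all simple rotations. $(X,\perp)$ is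 quasiprimitive if, for any non-trivial simple rotation $\rho$, the normal subgroup of $\mathbf R(X)$ generated by $\rho$ acts transitively on $X$. A quadratic space over a (commutative) field $K$ of characteristic $\neq 2$ is a linear space $H$ over $K$ (possibly infinite-dimensional) with an anisotropic symmetric bilinear form $(\cdot,\cdot)$. Subfields of $\mathbb R$ carry the inherited order, and positive definite means $(u,u)>0$ for all $u\neq0$. A unit vector is a vector $u$ with $(u,u)=1$. $P(H)$ is the set of one-dimensional subspaces $[u]$, and $[u]\perp[v]$ if $(u,v)=0$. An isomorphism of orthosets is a bijection preserving and reflecting $\perp$. *)

theory Defs
  imports Complex_Main "HOL-Algebra.Algebra" "HOL-Algebra.Algebraic_Closure_Type"
begin

unbundle cardinal_syntax

section \<open>Orthosets\<close>

definition orthoset :: "'a set \<Rightarrow> ('a \<Rightarrow> 'a \<Rightarrow> bool) \<Rightarrow> bool" where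
  "orthoset S perp \<longleftrightarrow> S \<noteq> {} \<and> symp_on S perp \<and> irreflp_on S perp"

definition orthoset_iso ::
  "'a set \<Rightarrow> ('a \<Rightarrow> 'a \<Rightarrow> bool) \<Rightarrow> 'b set \<Rightarrow> ('b \<Rightarrow> 'b \<Rightarrow> bool) \<Rightarrow> ('a \<Rightarrow> 'b) \<Rightarrow> bool" where
  "orthoset_iso S perp Y perp' f \<longleftrightarrow>
     bij_betw f S Y \<and> (\<forall>p\<in>S. \<forall>q\<in>S. perp p q \<longleftrightarrow> perp' (f p) (f q))"

definition mutually_orthogonal :: "'a set \<Rightarrow> ('a \<Rightarrow> 'a \<Rightarrow> bool) \<Rightarrow> 'a set \<Rightarrow> bool" where
  "mutually_orthogonal S perp D \<longleftrightarrow> D \<subseteq> S \<and> pairwise perp D"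

text \<open>Cardinals are represented by cardinal orders, hence determined only up to \<open>=o\<close>.
  Since \<open>|S|\<close> is an upper bound, the cardinals that live on the type \<^typ>\<open>'a\<close> suffice;
  the lemma \<open>orthoset_rank_least\<close> below gives minimality among the cardinals
  on an arbitrary type.\<close>

definition is_orthoset_rank :: "'a set \<Rightarrow> ('a \<Rightarrow> 'a \<Rightarrow> bool) \<Rightarrow> 'a rel \<Rightarrow> bool" where
  "is_orthoset_rank S perp r \<longleftrightarrow>
     Card_order r \<and> (\<forall>D. mutually_orthogonal S perp D \<longrightarrow> |D| \<le>o r) \<and>
     (\<forall>r'::'a rel. Card_order r' \<and> (\<forall>D. mutually_orthogonal S perp D \<longrightarrow> |D| \<le>o r') \<longrightarrow> r \<le>o r')"

definition orthoset_rank :: "'a set \<Rightarrow> ('a \<Rightarrow> 'a \<Rightarrow> bool) \<Rightarrow> 'a rel" where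
  "orthoset_rank S perp = (SOME r. is_orthoset_rank S perp r)"

lemma is_orthoset_rank_orthoset_rank: "is_orthoset_rank S perp (orthoset_rank S perp)"
proof -
  let ?R = "{r::'a rel. Card_order r \<and> (\<forall>D. mutually_orthogonal S perp D \<longrightarrow> |D| \<le>o r)}"
  have "|S| \<in> ?R"
    by (auto simp: mutually_orthogonal_def card_of_Card_order card_of_mono1)
  then have "?R \<noteq> {}" by blast
  then obtain r where "r \<in> ?R" "\<forall>r'\<in>?R. r \<le>o r'"
    using exists_minim_Card_order[of ?R] by blast
  then have "is_orthoset_rank S perp r"
    by (simp add: is_orthoset_rank_def)
  then show ?thesis
    unfolding orthoset_rank_def by (rule someI)
qed

lemma orthoset_rank_least:
  fixes r :: "'b rel"
  assumes r: "Card_order r" and bound: "\<And>D. mutually_orthogonal S perp D \<Longrightarrow> |D| \<le>o r"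
  shows "orthoset_rank S perp \<le>o r"
proof (rule ccontr)
  let ?q = "orthoset_rank S perp"
  have q: "Card_order ?q"
    using is_orthoset_rank_orthoset_rank[of S perp] by (simp add: is_orthoset_rank_def)
  assume not_le: "\<not> ?q \<le>o r"
  then have "r <o ?q"
    using q r by (simp add: not_ordLeq_iff_ordLess)
  then have "|Field r| <o ?q"
    using r by (meson card_of_Field_ordIso ordIso_ordLess_trans)
  then obtain B :: "'a set" where B: "|B| =o |Field r|"
    using internalize_card_of_ordLess[of "Field r" ?q] q by (metis ordIso_symmetric)
  then have Br: "|B| =o r"
    using r by (meson card_of_Field_ordIso ordIso_transitive)
  have "\<forall>D. mutually_orthogonal S perp D \<longrightarrow> |D| \<le>o |B|"
    using bound Br by (meson ordIso_symmetric ordLeq_ordIso_trans)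
  then have "?q \<le>o |B|"
    using is_orthoset_rank_orthoset_rank[of S perp]
    unfolding is_orthoset_rank_def by (meson card_of_Card_order)
  then show False
    using Br not_le ordLeq_ordIso_trans by blast
qed


section \<open>Automorphisms, divisible transitivity, quasiprimitivity\<close>

text \<open>Elements of \<^term>\<open>BijGroup S\<close> are extensional; its product is \<open>(\<phi> \<otimes> \<psi>) x = \<phi> (\<psi> x)\<close>.\<close>

definition orthogroup :: "'a set \<Rightarrow> ('a \<Rightarrow> 'a \<Rightarrow> bool) \<Rightarrow> ('a \<Rightarrow> 'a) monoid" where
  "orthogroup S perp =
     BijGroup S \<lparr>carrier := {\<phi> \<in> carrier (BijGroup S). orthoset_iso S perp S perp \<phi>}\<rparr>"

definition pair_group :: "'a set \<Rightarrow> ('a \<Rightarrow> 'a \<Rightarrow> bool) \<Rightarrow> 'a \<Rightarrow> 'a \<Rightarrow> ('a \<Rightarrow> 'a) set" where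
  "pair_group S perp e f =
     {\<phi> \<in> carrier (orthogroup S perp). \<forall>x\<in>S. perp x e \<and> perp x f \<longrightarrow> \<phi> x = x}"

definition rotations :: "'a set \<Rightarrow> ('a \<Rightarrow> 'a \<Rightarrow> bool) \<Rightarrow> 'a \<Rightarrow> 'a \<Rightarrow> ('a \<Rightarrow> 'a) set" where
  "rotations S perp e f =
     {\<phi> \<in> pair_group S perp e f.
        \<forall>k::nat. k \<ge> 1 \<longrightarrow> (\<exists>\<psi>\<in>pair_group S perp e f. \<phi> = \<psi> [^]\<^bsub>orthogroup S perp\<^esub> k)}"

definition divisibly_transitive :: "'a set \<Rightarrow> ('a \<Rightarrow> 'a \<Rightarrow> bool) \<Rightarrow> bool" where
  "divisibly_transitive S perp \<longleftrightarrow>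
     (\<forall>e\<in>S. \<forall>f\<in>S. e \<noteq> f \<longrightarrow>
        subgroup (rotations S perp e f) (orthogroup S perp) \<and>
        comm_group ((orthogroup S perp) \<lparr>carrier := rotations S perp e f\<rparr>) \<and>
        (\<exists>\<phi>\<in>rotations S perp e f. \<phi> e = f) \<and>
        (\<forall>e'\<in>S. \<forall>f'\<in>S. e' \<noteq> f' \<longrightarrow>
           (\<exists>\<tau>\<in>carrier (orthogroup S perp). \<tau> e = e' \<and>
              rotations S perp e f =
                (\<lambda>\<rho>. inv\<^bsub>orthogroup S perp\<^esub> \<tau> \<otimes>\<^bsub>orthogroup S perp\<^esub> \<rho> \<otimes>\<^bsub>orthogroup S perp\<^esub> \<tau>)
                  ` rotations S perp e' f')))"

definition simple_rotations :: "'a set \<Rightarrow> ('a \<Rightarrow> 'a \<Rightarrow> bool) \<Rightarrow> ('a \<Rightarrow> 'a) set" where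
  "simple_rotations S perp = {\<rho>. \<exists>e\<in>S. \<exists>f\<in>S. e \<noteq> f \<and> \<rho> \<in> rotations S perp e f}"

definition rotation_group :: "'a set \<Rightarrow> ('a \<Rightarrow> 'a \<Rightarrow> bool) \<Rightarrow> ('a \<Rightarrow> 'a) monoid" where
  "rotation_group S perp =
     (orthogroup S perp) \<lparr>carrier := generate (orthogroup S perp) (simple_rotations S perp)\<rparr>"

definition normal_closure :: "('g, 'm) monoid_scheme \<Rightarrow> 'g set \<Rightarrow> 'g set" where
  "normal_closure G A = \<Inter>{N. N \<lhd> G \<and> A \<subseteq> N}"

definition quasiprimitive :: "'a set \<Rightarrow> ('a \<Rightarrow> 'a \<Rightarrow> bool) \<Rightarrow> bool" where
  "quasiprimitive S perp \<longleftrightarrow>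
     (\<forall>\<rho>\<in>simple_rotations S perp. \<rho> \<noteq> \<one>\<^bsub>orthogroup S perp\<^esub> \<longrightarrow>
        (\<forall>x\<in>S. \<forall>y\<in>S. \<exists>\<phi>\<in>normal_closure (rotation_group S perp) {\<rho>}. \<phi> x = y))"


section \<open>Quadratic spaces\<close>

locale quadratic_space = K?: field K + H?: module K H
  for K :: "('k, 'm) ring_scheme" (structure) and H :: "('k, 'v, 'n) module_scheme" (structure) +
  fixes form :: "'v \<Rightarrow> 'v \<Rightarrow> 'k"
  assumes char_neq_2: "\<one>\<^bsub>K\<^esub> \<oplus>\<^bsub>K\<^esub> \<one>\<^bsub>K\<^esub> \<noteq> \<zero>\<^bsub>K\<^esub>"
    and form_closed: "\<lbrakk>u \<in> carrier H; v \<in> carrier H\<rbrakk> \<Longrightarrow> form u v \<in> carrier K"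
    and form_sym: "\<lbrakk>u \<in> carrier H; v \<in> carrier H\<rbrakk> \<Longrightarrow> form u v = form v u"
    and form_add_left: "\<lbrakk>u \<in> carrier H; v \<in> carrier H; w \<in> carrier H\<rbrakk> \<Longrightarrow>
      form (u \<oplus>\<^bsub>H\<^esub> v) w = form u w \<oplus>\<^bsub>K\<^esub> form v w"
    and form_smult_left: "\<lbrakk>a \<in> carrier K; u \<in> carrier H; v \<in> carrier H\<rbrakk> \<Longrightarrow>
      form (a \<odot>\<^bsub>H\<^esub> u) v = a \<otimes>\<^bsub>K\<^esub> form u v"
    and form_anisotropic: "\<lbrakk>u \<in> carrier H; form u u = \<zero>\<^bsub>K\<^esub>\<rbrakk> \<Longrightarrow> u = \<zero>\<^bsub>H\<^esub>"

definition line :: "('k, 'm) ring_scheme \<Rightarrow> ('k, 'v, 'n) module_scheme \<Rightarrow> 'v \<Rightarrow> 'v set" where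
  "line K H u = {a \<odot>\<^bsub>H\<^esub> u | a. a \<in> carrier K}"

definition lines :: "('k, 'm) ring_scheme \<Rightarrow> ('k, 'v, 'n) module_scheme \<Rightarrow> 'v set set" where
  "lines K H = {line K H u | u. u \<in> carrier H - {\<zero>\<^bsub>H\<^esub>}}"

definition lines_perp ::
  "('k, 'm) ring_scheme \<Rightarrow> ('k, 'v, 'n) module_scheme \<Rightarrow> ('v \<Rightarrow> 'v \<Rightarrow> 'k) \<Rightarrow> 'v set \<Rightarrow> 'v set \<Rightarrow> bool" where
  "lines_perp K H form L M \<longleftrightarrow>
     (\<exists>u\<in>carrier H - {\<zero>\<^bsub>H\<^esub>}. \<exists>v\<in>carrier H - {\<zero>\<^bsub>H\<^esub>}.
        L = line K H u \<and> M = line K H v \<and> form u v = \<zero>\<^bsub>K\<^esub>)"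

definition positive_definite :: "(real, 'v, 'n) module_scheme \<Rightarrow> ('v \<Rightarrow> 'v \<Rightarrow> real) \<Rightarrow> bool" where
  "positive_definite H form \<longleftrightarrow> (\<forall>u\<in>carrier H. u \<noteq> \<zero>\<^bsub>H\<^esub> \<longrightarrow> form u u > 0)"

abbreviation real_ring :: "real ring" where
  "real_ring \<equiv> ring_of_type_algebra"

end

theory Submission
  imports Defs
begin

text \<open>
  Divisible transitivity makes the orthoset a projective geometry with a polarity: by (DT2), any two
  points can be replaced, without changing their common orthocomplement, by an orthogonal as well as by a
  non-orthogonal pair. Fix a point \<open>org\<close>. In dimension at least three the theorem of Desargues yields all
  translations and homotheties of the affine space complementary to the hyperplane \<open>org\<^sup>\<bottom>\<close>, hence a
  left vector space over a division ring, and \<open>\<bottom>\<close> becomes a sesquilinear form. A quarter turn \<open>J\<close>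
  commutes with all rotations of its plane, so \<open>u + k J u\<close> is orthogonal to \<open>J u + k J\<^sup>2 u\<close> for every
  scalar \<open>k\<close>; this makes the antiautomorphism of the scalars inner, so that the scalars commute and the
  form is symmetric.

  Rotations are then induced by isometries. As they act transitively, each line contains a unit vector,
  so the scalar field is Pythagorean and formally real and can be ordered. If the order were not
  archimedean, a rotation by an infinitesimal angle and all its conjugates would move every point by an
  infinitesimal amount only, contradicting quasiprimitivity. Hence the scalars embed into the reals.
\<close>

section \<open>Lines and planes\<close>

text \<open>No geometry is given at the start: a line can only be defined as a double
  orthocomplement, and the incidence axioms have to be extracted from the two partner axioms below,
  which are what (DT1) and (DT2) leave once the rotations are forgotten. The dimension may be
  infinite, so nothing can rest on bases; orthogonal projection to a point or to a plane takes their
  place. Commutativity is not known when the form is built, so orthogonality is first turned into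
  left linear functionals, one for each vector, and only then is their dependence on the vector
  studied. A rotation fixes the complement of its plane pointwise, and by the rank assumption this
  complement contains two orthogonal vectors; from this alone the rotation is found to be an
  isometry. The infinitesimal rotation takes \<open>p\<close> to a positive multiple of
  \<open>p + e q\<close> with \<open>e\<close> infinitesimal. Distance is measured by its square,
  which stays inside the field; being infinitesimally close is then an equivalence relation by the
  parallelogram law.\<close>

locale projective_orthoset =
  fixes S :: "'a set" and orth :: "'a \<Rightarrow> 'a \<Rightarrow> bool" (infix \<open>\<perp>\<close> 50)
  assumes orth_sym: "x \<perp> y \<Longrightarrow> y \<perp> x"
    and orth_irrefl: "\<not> x \<perp> x"
    and orth_in: "x \<perp> y \<Longrightarrow> x \<in> S"
    and orth_partner: "\<lbrakk>e \<in> S; f \<in> S; e \<noteq> f\<rbrakk> \<Longrightarrow>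
      \<exists>g. g \<perp> e \<and> (\<forall>z. z \<perp> e \<and> z \<perp> f \<longleftrightarrow> z \<perp> e \<and> z \<perp> g)"
    and nonorth_partner: "\<lbrakk>e \<in> S; f \<in> S; e \<noteq> f\<rbrakk> \<Longrightarrow>
      \<exists>g\<in>S. g \<noteq> e \<and> \<not> g \<perp> e \<and> (\<forall>z. z \<perp> e \<and> z \<perp> f \<longleftrightarrow> z \<perp> e \<and> z \<perp> g)"
    and frame_at: "a \<in> S \<Longrightarrow> \<exists>b c d. b \<perp> a \<and> c \<perp> a \<and> d \<perp> a \<and> b \<perp> c \<and> b \<perp> d \<and> c \<perp> d"
begin

lemma orth_in2: "x \<perp> y \<Longrightarrow> y \<in> S"
  using orth_in orth_sym by blast

lemma orth_commute: "x \<perp> y \<longleftrightarrow> y \<perp> x"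
  using orth_sym by blast

lemma orth_neq: "x \<perp> y \<Longrightarrow> x \<noteq> y"
  using orth_irrefl by blast

text \<open>The double orthocomplement of \<open>e\<close> and \<open>f\<close>. By
  \<open>orth_in\<close> only elements of \<open>S\<close> are ever orthogonal to anything, so the
  bound variable needs no membership condition.\<close>

definition pline :: "'a \<Rightarrow> 'a \<Rightarrow> 'a set" where
  "pline e f = {x \<in> S. \<forall>z. z \<perp> e \<and> z \<perp> f \<longrightarrow> z \<perp> x}"

definition pplane :: "'a \<Rightarrow> 'a \<Rightarrow> 'a \<Rightarrow> 'a set" where
  "pplane a b c = {x \<in> S. \<forall>z. z \<perp> a \<and> z \<perp> b \<and> z \<perp> c \<longrightarrow> z \<perp> x}"

lemma pline_in: "x \<in> pline e f \<Longrightarrow> x \<in> S"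
  by (simp add: pline_def)

lemma plineI: "\<lbrakk>x \<in> S; \<And>z. \<lbrakk>z \<perp> e; z \<perp> f\<rbrakk> \<Longrightarrow> z \<perp> x\<rbrakk> \<Longrightarrow> x \<in> pline e f"
  by (simp add: pline_def)

lemma plineD: "\<lbrakk>x \<in> pline e f; z \<perp> e; z \<perp> f\<rbrakk> \<Longrightarrow> z \<perp> x"
  by (simp add: pline_def)

lemma plineD': "\<lbrakk>x \<in> pline e f; e \<perp> z; f \<perp> z\<rbrakk> \<Longrightarrow> x \<perp> z"
  using plineD orth_sym by blast

lemma pline_left [simp]: "e \<in> S \<Longrightarrow> e \<in> pline e f"
  by (simp add: pline_def)

lemma pline_right [simp]: "f \<in> S \<Longrightarrow> f \<in> pline e f"
  by (simp add: pline_def)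

lemma pline_commute: "pline e f = pline f e"
  by (auto simp: pline_def)

lemma pline_subset: "\<lbrakk>x \<in> pline e f; y \<in> pline e f\<rbrakk> \<Longrightarrow> pline x y \<subseteq> pline e f"
  unfolding pline_def by blast

lemma pplane_in: "x \<in> pplane a b c \<Longrightarrow> x \<in> S"
  by (simp add: pplane_def)

lemma pline_subset_pl: "\<lbrakk>x \<in> pplane a b c; y \<in> pplane a b c\<rbrakk> \<Longrightarrow> pline x y \<subseteq> pplane a b c"
  unfolding pplane_def pline_def by blast

lemma pplane_gen: "a \<in> S \<Longrightarrow> a \<in> pplane a b c" "b \<in> S \<Longrightarrow> b \<in> pplane a b c" "c \<in> S \<Longrightarrow> c \<in> pplane a b c"
  by (auto simp: pplane_def)

text \<open>Otherwise \<open>orth_partner\<close> gives a \<open>k\<close> orthogonal to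
  \<open>g\<close> such that \<open>g\<close>, \<open>k\<close> and \<open>g\<close>,
  \<open>y\<close> have the same orthocomplement. Then \<open>e\<close>, being orthogonal to
  \<open>g\<close> and \<open>y\<close>, is orthogonal to \<open>k\<close>; and everything
  orthogonal to \<open>e\<close> and \<open>g\<close> is orthogonal to \<open>k\<close>. So
  \<open>k\<close> would be orthogonal to itself.\<close>

lemma orth_partner_unique:
  assumes "e \<perp> g" "y \<in> pline e g" "y \<perp> e"
  shows "y = g"
proof (rule ccontr)
  assume "y \<noteq> g"
  then obtain k where k: "k \<perp> g" "\<And>z. z \<perp> g \<and> z \<perp> y \<longleftrightarrow> z \<perp> g \<and> z \<perp> k"
    using orth_partner[of g y] assms orth_in orth_in2 by metis
  have "e \<perp> k" using k(2)[of e] assms orth_sym by blast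
  moreover have "z \<perp> k" if "z \<perp> e" "z \<perp> g" for z
    using k(2)[of z] that plineD[OF assms(2)] by blast
  ultimately show False using k(1) orth_sym orth_irrefl by blast
qed

text \<open>Replace \<open>f\<close> and \<open>x\<close> by partners \<open>g\<close> and
  \<open>y\<close> orthogonal to \<open>e\<close>. Then \<open>y\<close> lies on the line of
  \<open>e\<close> and \<open>g\<close>, so \<open>y = g\<close> by uniqueness, and the two pairs
  have the same orthocomplement. Exchange is what makes any two points of a line determine
  it.\<close>

lemma pline_exchange:
  assumes "e \<in> S" "f \<in> S" "e \<noteq> f" "x \<in> pline e f" "x \<noteq> e"
  shows "f \<in> pline e x"
proof -
  have x: "x \<in> S" using assms pline_in by blast
  obtain g where g: "g \<perp> e" "\<And>z. z \<perp> e \<and> z \<perp> f \<longleftrightarrow> z \<perp> e \<and> z \<perp> g"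
    using orth_partner[of e f] assms by blast
  obtain y where y: "y \<perp> e" "\<And>z. z \<perp> e \<and> z \<perp> x \<longleftrightarrow> z \<perp> e \<and> z \<perp> y"
    using orth_partner[of e x] assms x by metis
  have "y \<in> pline e g"
  proof (rule plineI)
    show "y \<in> S" using y orth_in by blast
    show "z \<perp> y" if "z \<perp> e" "z \<perp> g" for z
      using that g(2)[of z] y(2)[of z] plineD[OF assms(4), of z] by blast
  qed
  then have "y = g" using orth_partner_unique[of e g y] g(1) y(1) orth_sym by blast
  then show ?thesis using g(2) y(2) assms(2) by (intro plineI) blast+
qed

lemma pline_eq1:
  assumes "e \<in> S" "f \<in> S" "e \<noteq> f" "x \<in> pline e f" "x \<noteq> e"
  shows "pline e x = pline e f"
proof
  show "pline e x \<subseteq> pline e f" using assms by (simp add: pline_subset)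
  show "pline e f \<subseteq> pline e x" using pline_exchange[OF assms] assms by (simp add: pline_subset)
qed

lemma pline_eq:
  assumes "e \<in> S" "f \<in> S" "e \<noteq> f" "x \<in> pline e f" "y \<in> pline e f" "x \<noteq> y"
  shows "pline x y = pline e f"
proof (cases "x = e")
  case True
  then show ?thesis using pline_eq1 assms by blast
next
  case False
  then have 1: "pline e x = pline e f" using pline_eq1 assms by blast
  have "pline x y = pline x e"
    using pline_eq1[of x e y] assms False 1 pline_in by (metis pline_commute)
  then show ?thesis using 1 pline_commute by metis
qed

section \<open>Lines meet hyperplanes\<close>

lemma meet_hyperplane:
  assumes e: "e \<in> S" and f: "f \<in> S" and ef: "e \<noteq> f" and a: "a \<in> S"
  shows "\<exists>x\<in>pline e f. x \<perp> a"
proof (cases "a \<in> pline e f")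
  case True
  show ?thesis
  proof (cases "a = e")
    case True
    obtain g where "g \<perp> e" "\<And>z. z \<perp> e \<and> z \<perp> f \<longleftrightarrow> z \<perp> e \<and> z \<perp> g"
      using orth_partner[OF e f ef] by blast
    then have "g \<in> pline e f" using orth_in by (intro plineI) blast+
    then show ?thesis using \<open>g \<perp> e\<close> True by blast
  next
    case False
    then obtain g where "g \<perp> a" "\<And>z. z \<perp> a \<and> z \<perp> e \<longleftrightarrow> z \<perp> a \<and> z \<perp> g"
      using orth_partner[of a e] a e by metis
    then have "g \<in> pline e f" using plineD[OF True] orth_in by (intro plineI) blast+
    then show ?thesis using \<open>g \<perp> a\<close> by blast
  qed
next
  case anot: False
  obtain g where g: "g \<perp> e" "\<And>z. z \<perp> e \<and> z \<perp> f \<longleftrightarrow> z \<perp> e \<and> z \<perp> g"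
    using orth_partner[OF e f ef] by blast
  have lneq: "pline e f = pline e g" using g unfolding pline_def by auto
  have gS: "g \<in> S" using g orth_in by blast
  show ?thesis
  \<comment> \<open>A Gram-Schmidt construction follows, with \<open>e\<close>, \<open>g\<close> an
    orthogonal pair on the line: \<open>a1\<close> and \<open>a2\<close> remove from
    \<open>a\<close> its components along \<open>e\<close> and \<open>g\<close>, and
    \<open>a3\<close> spans the projection of \<open>a\<close> to the line. The negated goal keeps
    \<open>a2\<close> distinct from \<open>a\<close>.\<close>
  proof (rule ccontr)
    assume "\<not> ?thesis"
    then have no: "\<not> x \<perp> a" if "x \<in> pline e g" for x using that lneq by blast
    have nea: "\<not> e \<perp> a" "\<not> g \<perp> a" using no e gS by auto
    have "a \<noteq> e" using anot e by auto
    then obtain a1 where a1: "a1 \<perp> e" "\<And>z. z \<perp> e \<and> z \<perp> a \<longleftrightarrow> z \<perp> e \<and> z \<perp> a1"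
      using orth_partner[of e a] e a by metis
    have "a1 \<noteq> g"
    proof
      assume "a1 = g"
      then have "a \<in> pline e g" using a1(2) a by (intro plineI) blast+
      then show False using anot lneq by blast
    qed
    then obtain a2 where a2: "a2 \<perp> g" "\<And>z. z \<perp> g \<and> z \<perp> a1 \<longleftrightarrow> z \<perp> g \<and> z \<perp> a2"
      using orth_partner[of g a1] gS a1 orth_in by metis
    have a2e: "a2 \<perp> e" using a2(2)[of e] a1 g orth_sym by blast
    have "a2 \<noteq> a" using a2e nea orth_sym by blast
    then obtain a3 where a3: "a3 \<perp> a2" "\<And>z. z \<perp> a2 \<and> z \<perp> a \<longleftrightarrow> z \<perp> a2 \<and> z \<perp> a3"
      using orth_partner[of a2 a] a a2e orth_in by metis
    have "\<exists>b\<in>{e,g}. b \<notin> pline a2 a3"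
    proof (rule ccontr)
      assume "\<not> ?thesis"
      then have "e \<in> pline a2 a3" "g \<in> pline a2 a3" by auto
      then have "e = a3" "g = a3"
        using orth_partner_unique[of a2 a3] a3 a2 a2e orth_sym by blast+
      then show False using g orth_irrefl by blast
    qed
    then obtain b where b: "b = e \<or> b = g" "b \<notin> pline a2 a3" by blast
    have bS: "b \<in> S" "b \<perp> a2" using b e gS a2 a2e orth_sym by auto
    have "b \<noteq> a3" using b a3 orth_in by auto
    \<comment> \<open>The wanted point: on the line of \<open>a3\<close> and \<open>b\<close>, and
      orthogonal to \<open>a3\<close>. It is orthogonal to \<open>a2\<close> as well, hence to
      \<open>a\<close>.\<close>
    then obtain x where x: "x \<perp> a3" "\<And>z. z \<perp> a3 \<and> z \<perp> b \<longleftrightarrow> z \<perp> a3 \<and> z \<perp> x"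
      using orth_partner[of a3 b] a3 bS orth_in by metis
    have "x \<perp> a2" using x(2)[of a2] a3 bS orth_sym by blast
    then have xa: "x \<perp> a" using a3(2)[of x] x by blast
    have "x \<in> pline e g"
      unfolding pline_def
    proof (safe)
      show "x \<in> S" using x orth_in by blast
      fix z assume z: "z \<perp> e" "z \<perp> g"
      show "z \<perp> x"
      proof (cases "z = a2")
        case True
        then show ?thesis using \<open>x \<perp> a2\<close> orth_sym by blast
      next
        case False
        \<comment> \<open>\<open>z'\<close> is \<open>z\<close> with its component along
          \<open>a2\<close> removed. Being orthogonal to \<open>e\<close>, \<open>g\<close> and
          \<open>a2\<close>, it is orthogonal to \<open>a\<close> and therefore to
          \<open>a3\<close>.\<close>
        then obtain z' where z': "z' \<perp> a2" "\<And>y. y \<perp> a2 \<and> y \<perp> z \<longleftrightarrow> y \<perp> a2 \<and> y \<perp> z'"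
          using orth_partner[of a2 z] z a2 orth_in by metis
        have 1: "z' \<perp> e" "z' \<perp> g" using z'(2)[of e] z'(2)[of g] z a2 a2e orth_sym by blast+
        then have "z' \<perp> a" using a2(2)[of z'] a1(2)[of z'] z' by blast
        then have "z' \<perp> a3" using a3(2)[of z'] z' by blast
        then have "z' \<perp> x" using x(2)[of z'] 1 b by blast
        then show ?thesis using z'(2)[of x] \<open>x \<perp> a2\<close> orth_sym by blast
      qed
    qed
    then show False using no xa by blast
  qed
qed

lemma meet_hyperplane_unique:
  assumes "e \<in> S" "f \<in> S" "e \<noteq> f" "x \<in> pline e f" "y \<in> pline e f" "x \<noteq> y" "x \<perp> a" "y \<perp> a" "u \<in> pline e f"
  shows "u \<perp> a"
  using pline_eq[OF assms(1-6)] assms plineD' by blast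

text \<open>The axiom of Veblen and Young. Some \<open>z\<close> is orthogonal to \<open>c\<close>
  and \<open>x\<close> but not to \<open>p\<close>; let \<open>y\<close> be the point of the line
  \<open>q i\<close> orthogonal to \<open>z\<close>. For another \<open>w\<close> orthogonal to
  \<open>c\<close> and \<open>x\<close>, the line \<open>z w\<close> has a point \<open>v\<close>
  orthogonal also to \<open>p\<close>, hence to \<open>q\<close>, \<open>i\<close> and
  \<open>y\<close>. So \<open>y\<close> is orthogonal to \<open>z\<close> and \<open>v\<close>, and
  thus to \<open>w\<close>.\<close>

lemma pasch:
  assumes S: "c \<in> S" "p \<in> S" "x \<in> S" and ncol: "p \<notin> pline c x"
    and q: "q \<in> pline c p" and i: "i \<in> pline p x" and "q \<noteq> i"
  shows "\<exists>y. y \<in> pline q i \<and> y \<in> pline c x"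
proof -
  obtain z where z: "z \<perp> c" "z \<perp> x" "\<not> z \<perp> p" using ncol S unfolding pline_def by blast
  obtain y where y: "y \<in> pline q i" "y \<perp> z"
    using meet_hyperplane[of q i z] q i \<open>q \<noteq> i\<close> pline_in z orth_in by metis
  have "w \<perp> y" if w: "w \<perp> c" "w \<perp> x" for w
  proof (cases "w = z")
    case True
    then show ?thesis using y orth_sym by blast
  next
    case False
    obtain v where v: "v \<in> pline z w" "v \<perp> p"
      using meet_hyperplane[of z w p] z w orth_in False S by metis
    have "v \<perp> c" "v \<perp> x" using v z w plineD' by blast+
    then have "v \<perp> q" "v \<perp> i" using plineD[OF q] plineD[OF i] v by blast+
    then have "v \<perp> y" using plineD[OF y(1)] by blast
    moreover have "v \<noteq> z" using v z by blast
    then have "w \<in> pline z v" using pline_exchange[of z w v] v z w False orth_in by metis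
    ultimately show ?thesis using plineD'[of w z v y] y orth_sym by blast
  qed
  then show ?thesis using y pline_in by (blast intro: plineI)
qed

text \<open>The idea of \<open>pasch\<close> again: a point \<open>y\<close> of the line
  \<open>z w\<close> orthogonal to \<open>c\<close> is orthogonal to \<open>x\<close>, and so is
  \<open>w\<close>; this would make \<open>z\<close> orthogonal to \<open>x\<close>.\<close>

lemma pplane_exchange:
  assumes S: "a \<in> S" "b \<in> S" "c \<in> S" and x: "x \<in> pplane a b c" "x \<notin> pline a b"
  shows "c \<in> pplane a b x"
proof (rule ccontr)
  assume "c \<notin> pplane a b x"
  then obtain w where w: "w \<perp> a" "w \<perp> b" "w \<perp> x" "\<not> w \<perp> c" using S unfolding pplane_def by blast
  obtain z where z: "z \<perp> a" "z \<perp> b" "\<not> z \<perp> x" using x pplane_in unfolding pline_def by blast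
  have "z \<noteq> w" using z w by blast
  then obtain y where y: "y \<in> pline z w" "y \<perp> c" using meet_hyperplane[of z w c] z w S orth_in by metis
  have "y \<perp> a" "y \<perp> b" using plineD'[OF y(1)] z w by blast+
  then have yx: "y \<perp> x" using x y unfolding pplane_def by blast
  have "y \<noteq> w" using y w by blast
  then have "z \<in> pline w y" using pline_exchange[of w z y] y z w orth_in \<open>z \<noteq> w\<close> pline_commute by metis
  then show False using plineD'[of z w y x] yx w z by blast
qed

text \<open>An orthogonal and a non-orthogonal partner of \<open>a\<close> are two different points
  of the line other than \<open>a\<close>, and at most one of them is \<open>b\<close>.\<close>

lemma third_point:
  assumes "a \<in> S" "b \<in> S" "a \<noteq> b"
  shows "\<exists>t\<in>pline a b. t \<noteq> a \<and> t \<noteq> b"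
proof -
  obtain g where g: "g \<perp> a" "\<And>z. z \<perp> a \<and> z \<perp> b \<longleftrightarrow> z \<perp> a \<and> z \<perp> g"
    using orth_partner[OF assms] by blast
  obtain h where h: "h \<in> S" "h \<noteq> a" "\<not> h \<perp> a" "\<And>z. z \<perp> a \<and> z \<perp> b \<longleftrightarrow> z \<perp> a \<and> z \<perp> h"
    using nonorth_partner[OF assms] by metis
  have "g \<in> pline a b" "h \<in> pline a b" "g \<noteq> h" "g \<noteq> a"
    using g h orth_in orth_irrefl by (auto intro!: plineI)
  then show ?thesis using h by blast
qed

text \<open>The sides of an orthogonal triangle in the complement of \<open>a\<close> meet the
  complement of \<open>b\<close> in points that cannot all coincide. Two distinct ones span a line,
  which meets the complement of \<open>c\<close>. Through this lemma the rank enters: no plane is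
  the whole space, as the spatial proof of Desargues requires.\<close>

lemma orth_to_three:
  assumes S: "a \<in> S" "b \<in> S" "c \<in> S"
  shows "\<exists>z. z \<perp> a \<and> z \<perp> b \<and> z \<perp> c"
proof -
  obtain f1 f2 f3 where f: "f1 \<perp> a" "f2 \<perp> a" "f3 \<perp> a" "f1 \<perp> f2" "f1 \<perp> f3" "f2 \<perp> f3"
    using frame_at[OF S(1)] by blast
  note fS = f[THEN orth_in] and fn = f[THEN orth_neq]
  obtain u where u: "u \<in> pline f1 f2" "u \<perp> b" using meet_hyperplane[of f1 f2 b] fS fn S by blast
  obtain v where v: "v \<in> pline f2 f3" "v \<perp> b" using meet_hyperplane[of f2 f3 b] fS fn S by blast
  obtain t where t: "t \<in> pline f1 f3" "t \<perp> b" using meet_hyperplane[of f1 f3 b] fS fn S by blast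
  have orths: "u \<perp> a" "v \<perp> a" "t \<perp> a" using u v t f plineD' by blast+
  have "\<exists>p q. p \<noteq> q \<and> p \<perp> a \<and> p \<perp> b \<and> q \<perp> a \<and> q \<perp> b"
  proof (cases "u = v")
    case True
    have "t \<perp> f2" using plineD' t f orth_sym by blast
    moreover have "u \<perp> f1" if "u = t" using that True plineD'[OF v(1)] f orth_sym by blast
    moreover have "u \<perp> f3" if "u = t" using that plineD'[OF u(1)] f by blast
    ultimately have "u \<noteq> t" using plineD[OF t(1), of u] orth_irrefl by blast
    then show ?thesis using u t orths by blast
  next
    case False
    then show ?thesis using u v orths by blast
  qed
  then obtain p q where p: "p \<noteq> q" "p \<perp> a" "p \<perp> b" "q \<perp> a" "q \<perp> b" by blast
  then obtain z where "z \<in> pline p q" "z \<perp> c" using meet_hyperplane[of p q c] orth_in S by metis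
  then show ?thesis using p plineD' by blast
qed

lemma pplane_proper:
  assumes "a \<in> S" "b \<in> S" "c \<in> S"
  shows "\<exists>z\<in>S. z \<notin> pplane a b c"
  using orth_to_three[OF assms] orth_in orth_irrefl unfolding pplane_def by blast

lemma orth_third: "\<lbrakk>e \<in> S; f \<in> S\<rbrakk> \<Longrightarrow> \<exists>g. g \<perp> e \<and> g \<perp> f"
  using orth_to_three by blast

end

section \<open>Perspectivities and dilatations\<close>

context projective_orthoset
begin

lemma pline_meet_unique:
  assumes "a \<in> S" "b \<in> S" "a \<noteq> b" "c \<in> S" "d \<in> S" "c \<noteq> d"
    "x \<in> pline a b" "x \<in> pline c d" "y \<in> pline a b" "y \<in> pline c d" "x \<noteq> y"
  shows "pline a b = pline c d"
  using pline_eq[of a b x y] pline_eq[of c d x y] assms by simp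

lemma pline_pl: "pline a b \<subseteq> pplane a b c" "pline a c \<subseteq> pplane a b c" "pline b c \<subseteq> pplane a b c"
  unfolding pplane_def pline_def by blast+

end

locale pointed_orthoset = projective_orthoset +
  fixes org :: 'a
  assumes org_in: "org \<in> S"
begin

text \<open>\<open>A\<close> is the affine space with the orthocomplement of \<open>org\<close> as its hyperplane at infinity.\<close>

definition A :: "'a set" where "A = {x \<in> S. \<not> x \<perp> org}"

definition dir :: "'a \<Rightarrow> 'a \<Rightarrow> 'a" where "dir x y = (THE i. i \<in> pline x y \<and> i \<perp> org)"

lemma A_in: "x \<in> A \<Longrightarrow> x \<in> S"
  by (simp add: A_def)

lemma org_A [simp]: "org \<in> A"
  by (simp add: A_def org_in orth_irrefl)

lemma A_orth: "x \<in> A \<Longrightarrow> \<not> x \<perp> org"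
  by (simp add: A_def)

lemma A_neq_inf: "\<lbrakk>x \<in> A; i \<perp> org\<rbrakk> \<Longrightarrow> x \<noteq> i"
  by (auto simp: A_def)

lemma dir_ex1: "\<lbrakk>x \<in> A; y \<in> A; x \<noteq> y\<rbrakk> \<Longrightarrow> \<exists>!i. i \<in> pline x y \<and> i \<perp> org"
proof (rule ex_ex1I)
  assume a: "x \<in> A" "y \<in> A" "x \<noteq> y"
  then show "\<exists>i. i \<in> pline x y \<and> i \<perp> org"
    using meet_hyperplane[of x y org] A_in org_in by blast
  fix i j assume "i \<in> pline x y \<and> i \<perp> org" "j \<in> pline x y \<and> j \<perp> org"
  then show "i = j"
    using meet_hyperplane_unique[of x y i j org x] a A_in A_orth by auto
qed

lemma
  assumes "x \<in> A" "y \<in> A" "x \<noteq> y"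
  shows dir_pline: "dir x y \<in> pline x y" and dir_orth: "dir x y \<perp> org"
  using theI'[OF dir_ex1[OF assms]] unfolding dir_def by auto

lemma dirI: "\<lbrakk>x \<in> A; y \<in> A; x \<noteq> y; i \<in> pline x y; i \<perp> org\<rbrakk> \<Longrightarrow> dir x y = i"
  using dir_ex1 dir_pline dir_orth by blast

lemma dir_in: "\<lbrakk>x \<in> A; y \<in> A; x \<noteq> y\<rbrakk> \<Longrightarrow> dir x y \<in> S"
  using dir_orth orth_in by blast

lemma dir_commute: "dir x y = dir y x"
  by (simp add: dir_def pline_commute)

lemma pline_dir: 
  assumes "x \<in> A" "y \<in> A" "x \<noteq> y"
  shows "pline x (dir x y) = pline x y"
  using pline_eq1[of x y "dir x y"] assms dir_pline dir_orth A_in A_neq_inf by metis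

lemma mem_pline_dir:
  assumes "x \<in> A" "y \<in> A" "x \<noteq> y" "i \<perp> org"
  shows "y \<in> pline x i \<longleftrightarrow> dir x y = i"
proof
  assume "y \<in> pline x i"
  then have "i \<in> pline x y" using pline_exchange[of x i y] assms A_in A_neq_inf orth_in by metis
  then show "dir x y = i" using dirI assms by blast
next
  assume "dir x y = i"
  then show "y \<in> pline x i" using pline_dir assms A_in pline_right by metis
qed

lemma inf_unique:
  assumes "x \<in> A" "i \<perp> org" "u \<in> pline x i" "u \<perp> org"
  shows "u = i"
  using meet_hyperplane_unique[of x i u i org x] assms A_in orth_in A_neq_inf A_orth pline_left pline_right by metis

text \<open>A point off the plane may happen to lie at infinity; a third point of the line joining
  it to \<open>p\<close> is then affine and still off the plane.\<close>

lemma off_plane: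
  assumes S: "a \<in> S" "b \<in> S" "c \<in> S" and p: "p \<in> A" "p \<in> pplane a b c"
  shows "\<exists>r\<in>A. r \<notin> pplane a b c"
proof -
  obtain z where z: "z \<in> S" "z \<notin> pplane a b c" using pplane_proper[OF S] by blast
  show ?thesis
  proof (cases "z \<in> A")
    case True then show ?thesis using z by blast
  next
    case False
    then have zo: "z \<perp> org" using z by (simp add: A_def)
    have pz: "p \<noteq> z" using p z by blast
    obtain t where t: "t \<in> pline p z" "t \<noteq> p" "t \<noteq> z" using third_point[of p z] pz p z A_in by blast
    have "z \<in> pline p t" using pline_exchange[of p z t] t pz p z A_in by blast
    then have "t \<notin> pplane a b c" using pline_subset_pl p z by blast
    moreover have "t \<in> A" using inf_unique[of p z t] t zo p pline_in unfolding A_def by blast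
    ultimately show ?thesis by blast
  qed
qed

lemma pplane_same: "pplane a b b = pline a b"
  by (auto simp: pplane_def pline_def)

lemma off_line:
  assumes "a \<in> S" "b \<in> S" "p \<in> A" "p \<in> pline a b"
  shows "\<exists>r\<in>A. r \<notin> pline a b"
  using off_plane[of a b b p] assms by (simp add: pplane_same)

section \<open>Perspectivities and the theorem of Desargues\<close>

text \<open>\<open>p \<mapsto> q\<close> and \<open>x \<mapsto> y\<close> are induced by one central collineation with centre \<open>c\<close>
  and the hyperplane at infinity as its axis.\<close>

definition persp :: "'a \<Rightarrow> 'a \<Rightarrow> 'a \<Rightarrow> 'a \<Rightarrow> 'a \<Rightarrow> bool" where
  "persp c p q x y \<longleftrightarrow> c \<in> S \<and> p \<in> A - {c} \<and> q \<in> A - {c} \<and> x \<in> A - {c} \<and> y \<in> A - {c} \<and>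
     q \<in> pline c p \<and> y \<in> pline c x \<and> x \<notin> pline c p \<and> dir p x = dir q y"

lemma pline_through:
  assumes "c \<in> S" "p \<in> S" "p \<noteq> c" "q \<in> pline c p" "q \<noteq> c"
  shows "pline c q = pline c p" "p \<in> pline c q"
  using pline_eq1[of c p q] pline_exchange[of c p q] assms by auto

lemma pline_sep:
  assumes "c \<in> S" "p \<in> S" "p \<noteq> c" "x \<in> S" "x \<noteq> c" "x \<notin> pline c p"
    "y \<in> pline c x" "y \<in> pline c p"
  shows "y = c"
proof (rule ccontr)
  assume "y \<noteq> c"
  then have "pline c x = pline c p" using pline_through(1) assms by metis
  then show False using assms by auto
qed

lemma persp_neq:
  assumes "persp c p q x y"
  shows "p \<noteq> x" "q \<noteq> y" "y \<notin> pline c p"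
proof -
  show "p \<noteq> x" using assms A_in unfolding persp_def by auto
  show 1: "y \<notin> pline c p" using assms A_in pline_sep[of c p x y] unfolding persp_def by blast
  show "q \<noteq> y" using 1 assms unfolding persp_def by blast
qed

lemma persp_sym: "persp c p q x y \<Longrightarrow> persp c x y p q"
  using pline_through[of c x p] A_in dir_commute unfolding persp_def by (metis DiffE insertI1)

lemma persp_rev: 
  assumes "persp c p q x y" shows "persp c q p y x"
proof -
  have 1: "pline c q = pline c p" "pline c y = pline c x" using assms pline_through(1) A_in unfolding persp_def by blast+
  then show ?thesis using assms persp_neq[OF assms] A_in pline_right unfolding persp_def by auto
qed

text \<open>\<open>y\<close> is the intersection of the line \<open>c x\<close> with the parallel to
  \<open>p x\<close> through \<open>q\<close>, supplied by \<open>pasch\<close>. The remaining work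
  is to see that it is affine and different from \<open>c\<close>.\<close>

lemma persp_ex:
  assumes c: "c \<in> S" and p: "p \<in> A - {c}" and q: "q \<in> A - {c}" "q \<in> pline c p" and x: "x \<in> A - {c}" "x \<notin> pline c p"
  shows "\<exists>y. persp c p q x y"
proof (cases "q = p")
  case True
  then show ?thesis using assms A_in unfolding persp_def by (intro exI[of _ x]) auto
next
  case False
  have S: "p \<in> S" "q \<in> S" "x \<in> S" using p q x A_in by auto
  have px: "p \<noteq> x" using x S by auto
  let ?i = "dir p x"
  have i: "?i \<in> pline p x" "?i \<perp> org" "?i \<in> S" using dir_pline dir_orth dir_in p x px by auto
  have pcx: "p \<notin> pline c x" using pline_through[of c x p] p x c S by auto
  have "?i \<noteq> p" "?i \<noteq> x" using A_neq_inf[of p ?i] A_neq_inf[of x ?i] i(2) p x by auto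
  have lnpi: "pline p ?i = pline p x" using pline_dir p x px by blast
  have lncq: "pline c q = pline c p" using pline_through q c S p by blast
  have inc: "?i \<notin> pline c p"
  proof
    assume "?i \<in> pline c p"
    then have "pline p ?i = pline c p" using pline_eq[of c p p ?i] c S p \<open>?i \<noteq> p\<close> by auto
    then show False using lnpi x S by auto
  qed
  have "q \<noteq> ?i" using q i A_neq_inf by blast
  then obtain y where y: "y \<in> pline q ?i" "y \<in> pline c x"
    using pasch[OF c S(1) S(3) pcx q(2) i(1)] by blast
  have "y \<noteq> c"
  proof
    assume "y = c"
    then have "?i \<in> pline q c" using pline_exchange[of q ?i c] y S i q \<open>q \<noteq> ?i\<close> by auto
    then show False using inc lncq pline_commute by metis
  qed
  moreover have "\<not> y \<perp> org"
  proof
    assume "y \<perp> org"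
    then have "y = ?i" using inf_unique[of q ?i y] q i y by blast
    then have "pline c x = pline x ?i" using pline_eq[of c x x ?i] y c S x \<open>?i \<noteq> x\<close> by auto
    moreover have "p \<in> pline x ?i" using pline_dir[of x p] p x px dir_commute S pline_right by (metis Diff_iff)
    ultimately show False using pcx by blast
  qed
  ultimately have yA: "y \<in> A - {c}" using y pline_in unfolding A_def by blast
  have qy: "q \<noteq> y"
    using pline_sep[of c p x y] y q c p S x by auto
  have "dir q y = ?i" using mem_pline_dir[of q y ?i] y q yA qy i by blast
  then show ?thesis using c p q x yA y unfolding persp_def by (intro exI[of _ y]) auto
qed

lemma persp_unique:
  assumes "persp c p q x y" "persp c p q x y'"
  shows "y = y'"
proof (rule ccontr)
  assume ne: "y \<noteq> y'"
  let ?i = "dir p x"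
  have S: "c \<in> S" "q \<in> S" "x \<in> S" "p \<in> S" using assms A_in unfolding persp_def by auto
  have i: "?i \<perp> org" using dir_orth persp_neq[OF assms(1)] assms unfolding persp_def by auto
  have "y \<in> pline q ?i" "y' \<in> pline q ?i"
    using mem_pline_dir[of q y ?i] mem_pline_dir[of q y' ?i] i assms persp_neq[OF assms(1)] persp_neq[OF assms(2)]
    unfolding persp_def by auto
  moreover have "q \<noteq> ?i" using i A_neq_inf assms unfolding persp_def by blast
  ultimately have "pline q ?i = pline c x"
    using pline_meet_unique[of q ?i c x y y'] ne S i orth_in assms unfolding persp_def by blast
  then have "q \<in> pline c x" using S by (metis pline_left)
  then have "q = c" using pline_sep[of c p x q] assms S unfolding persp_def by blast
  then show False using assms unfolding persp_def by blast
qed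

lemma persp_inj: "\<lbrakk>persp c p q x y; persp c p q x' y\<rbrakk> \<Longrightarrow> x = x'"
  using persp_unique persp_rev by blast

text \<open>By \<open>pasch\<close> the line through the points at infinity of two sides of the
  triangle meets the third side, and the intersection is again at infinity.\<close>

lemma dir_triangle:
  assumes A: "p \<in> A" "x \<in> A" "z \<in> A" and ne: "p \<noteq> x" "p \<noteq> z" "x \<noteq> z" and ij: "dir p x \<noteq> dir p z"
  shows "dir x z \<in> pline (dir p x) (dir p z)"
proof -
  have S: "p \<in> S" "x \<in> S" "z \<in> S" using A A_in by auto
  note i = dir_pline[OF A(1,2) ne(1)] dir_orth[OF A(1,2) ne(1)]
  note j = dir_pline[OF A(1,3) ne(2)] dir_orth[OF A(1,3) ne(2)]
  have "p \<notin> pline x z"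
  proof
    assume "p \<in> pline x z"
    then have "pline x z = pline p x" "pline x z = pline p z" 
      using pline_eq[of x z p x] pline_eq[of x z p z] S ne by auto
    then show False using ij i j dir_ex1[OF A(1,2) ne(1)] by auto
  qed
  then obtain m where m: "m \<in> pline (dir p x) (dir p z)" "m \<in> pline x z"
    using pasch[of x p z "dir p x" "dir p z"] S i j ij pline_commute by metis
  then have "m \<perp> org" using plineD' i j by blast
  then show ?thesis using m dirI A ne by metis
qed

text \<open>The points at infinity of \<open>x z\<close> and \<open>y w\<close> lie on the line at
  infinity \<open>?L\<close> of the plane \<open>p x z\<close>, and also in the plane
  \<open>c x z\<close>. If they differed, \<open>?L\<close> would be contained in the latter plane,
  which would put \<open>p\<close> there and make the whole configuration planar.\<close>

lemma desargues_space:
  assumes D: "persp c p q x y" "persp c p q z w" and np: "z \<notin> pplane c p x"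
  shows "persp c x y z w"
proof -
  have A: "p \<in> A" "q \<in> A" "x \<in> A" "y \<in> A" "z \<in> A" "w \<in> A" and c: "c \<in> S" using D unfolding persp_def by auto
  note S = A[THEN A_in]
  have xz: "z \<notin> pline c x"
    using np pline_pl(2)[where a=c and b=p and c=x] by blast
  have ij: "dir p x \<noteq> dir p z"
  proof
    assume "dir p x = dir p z"
    then have "z \<in> pline p x" using pline_dir[of p z] pline_dir[of p x] A persp_neq(1)[OF D(1)] persp_neq(1)[OF D(2)] S by auto
    then show False using np pline_pl(3)[where a=c and b=p and c=x] by blast
  qed
  have xz': "x \<noteq> z" "y \<noteq> w"
    using xz S D pline_sep[of c x z y] c unfolding persp_def by auto
  note ne = persp_neq[OF D(1)] persp_neq[OF D(2)]
  have deq: "dir p x = dir q y" "dir p z = dir q w" using D unfolding persp_def by auto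
  let ?L = "pline (dir p x) (dir p z)"
  have k: "dir x z \<in> ?L" using dir_triangle A xz' ij ne by blast
  have k': "dir y w \<in> ?L" using dir_triangle[of q y w] A xz' ij ne deq by auto
  have "dir x z = dir y w"
  proof (rule ccontr)
    assume kk: "dir x z \<noteq> dir y w"
    have "dir x z \<in> pplane c x z" "dir y w \<in> pplane c x z"
    proof -
      show "dir x z \<in> pplane c x z" using dir_pline[OF A(3,5) xz'(1)] pline_pl by blast
      have "y \<in> pline c x" "w \<in> pline c z" using D unfolding persp_def by auto
      then have "y \<in> pplane c x z" "w \<in> pplane c x z"
        using pline_pl(1)[where a=c and b=x and c=z] pline_pl(2)[where a=c and b=x and c=z] by auto
      then show "dir y w \<in> pplane c x z" using dir_pline[OF A(4,6) xz'(2)] pline_subset_pl by blast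
    qed
    moreover have "pline (dir x z) (dir y w) = ?L"
      using pline_eq[OF _ _ ij k k' kk] dir_in A ne by blast
    ultimately have "?L \<subseteq> pplane c x z" using pline_subset_pl by metis
    then have i: "dir p x \<in> pplane c x z" using dir_in A ne pline_left by blast
    have "p \<in> pline x (dir p x)" using pline_dir[of x p] A ne dir_commute S pline_right by metis
    then have "p \<in> pplane c x z" using pline_subset_pl[OF pplane_gen(2)[OF S(3)] i] by blast
    then have "z \<in> pplane c x p" using pplane_exchange[of c x z p] persp_sym[OF D(1)] c S unfolding persp_def by blast
    then show False using np unfolding pplane_def by blast
  qed
  then show ?thesis using D xz unfolding persp_def by auto
qed

text \<open>A planar configuration is lifted: a point \<open>r\<close> outside the plane and its
  image \<open>s\<close> form spatial configurations with each of the given pairs, so that the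
  spatial version applies three times.\<close>

lemma desargues:
  assumes D: "persp c p q x y" "persp c p q z w" and xz: "z \<notin> pline c x"
  shows "persp c x y z w"
proof (cases "z \<in> pplane c p x")
  case False
  then show ?thesis using desargues_space D by blast
next
  case True
  have A: "p \<in> A" "q \<in> A" "x \<in> A" "y \<in> A" "z \<in> A" "w \<in> A" and c: "c \<in> S" using D unfolding persp_def by auto
  note S = A[THEN A_in]
  obtain r where r: "r \<in> A" "r \<notin> pplane c p x" using off_plane[of c p x p] c A S pplane_gen by blast
  have rc: "r \<noteq> c" using r pplane_gen c by blast
  have "r \<notin> pline c p" using r pline_pl by blast
  then obtain s where s: "persp c p q r s"
    using persp_ex[of c p q r] D r rc unfolding persp_def by blast
  have 1: "persp c x y r s" using desargues_space[OF D(1) s r(2)] .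
  have sub: "pplane c p z \<subseteq> pplane c p x" using True unfolding pplane_def by blast
  then have "r \<notin> pplane c p z" using r by blast
  then have 2: "persp c z w r s" using desargues_space[OF D(2) s] by blast
  have "z \<notin> pplane c r x"
  proof
    assume "z \<in> pplane c r x"
    then have "z \<in> pplane c x r" unfolding pplane_def by blast
    then have "r \<in> pplane c x z" using pplane_exchange[of c x r z] xz c S r A_in by blast
    then show False using r True unfolding pplane_def by blast
  qed
  then show ?thesis using desargues_space persp_sym[OF 1] persp_sym[OF 2] by blast
qed

section \<open>Dilatations\<close>

definition dil :: "('a \<Rightarrow> 'a) \<Rightarrow> bool" where
  "dil \<sigma> \<longleftrightarrow> (\<forall>x\<in>A. \<sigma> x \<in> A) \<and>
     (\<forall>x\<in>A. \<forall>y\<in>A. x \<noteq> y \<longrightarrow> \<sigma> x \<noteq> \<sigma> y \<and> dir (\<sigma> x) (\<sigma> y) = dir x y)"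

lemma dilD:
  assumes "dil \<sigma>"
  shows "x \<in> A \<Longrightarrow> \<sigma> x \<in> A" "\<lbrakk>x \<in> A; y \<in> A; x \<noteq> y\<rbrakk> \<Longrightarrow> \<sigma> x \<noteq> \<sigma> y"
    "\<lbrakk>x \<in> A; y \<in> A; x \<noteq> y\<rbrakk> \<Longrightarrow> dir (\<sigma> x) (\<sigma> y) = dir x y"
  using assms unfolding dil_def by blast+

text \<open>The pair \<open>p\<close>, \<open>q\<close> prescribes the images of the points off the
  line \<open>c p\<close>; those on this line receive theirs from an auxiliary pair
  \<open>r0\<close>, \<open>s0\<close>, and Desargues shows that the choices fit together. The
  centre may be affine, which yields homotheties, or at infinity, which yields translations.\<close>

lemma central_dil_ex:
  assumes c: "c \<in> S" and p: "p \<in> A - {c}" and q: "q \<in> A - {c}" "q \<in> pline c p"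
  shows "\<exists>\<sigma>. dil \<sigma> \<and> \<sigma> p = q \<and> (\<forall>x\<in>A. \<sigma> x \<in> pline c x) \<and> (c \<in> A \<longrightarrow> \<sigma> c = c)"
proof -
  have pS: "p \<in> S" "p \<noteq> c" "p \<in> A" using p A_in by auto
  obtain r0 where r0: "r0 \<in> A" "r0 \<notin> pline c p" using off_line[of c p p] c pS by auto
  have r0c: "r0 \<in> A - {c}" using r0 c by auto
  obtain s0 where s0: "persp c p q r0 s0" using persp_ex[OF c p q r0c r0(2)] by blast
  define \<sigma> where "\<sigma> x = (if x = c then c else if x \<notin> pline c p then (SOME y. persp c p q x y)
     else (SOME y. persp c r0 s0 x y))" for x
  have off: "persp c p q x (\<sigma> x)" if "x \<in> A - {c}" "x \<notin> pline c p" for x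
    using someI_ex[OF persp_ex[OF c p q that]] that unfolding \<sigma>_def by auto
  have on: "persp c r0 s0 x (\<sigma> x)" if x: "x \<in> A - {c}" "x \<in> pline c p" for x
  proof -
    have "x \<notin> pline c r0" using pline_sep[of c p r0 x] c pS r0 r0c x A_in by auto
    then have "\<exists>y. persp c r0 s0 x y" using persp_ex[of c r0 s0 x] s0 x c unfolding persp_def by blast
    then show ?thesis using someI_ex[of "persp c r0 s0 x"] x unfolding \<sigma>_def by auto
  qed
  have inA: "\<sigma> x \<in> A - {c}" "\<sigma> x \<in> pline c x" if "x \<in> A - {c}" for x
    using off[OF that] on[OF that] unfolding persp_def by blast+
  have mixed: "persp c x (\<sigma> x) x' (\<sigma> x')" if x: "x \<in> A - {c}" "x' \<in> A - {c}" "x' \<notin> pline c x"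
    and on1: "x \<in> pline c p" and off1: "x' \<notin> pline c p" for x x'
  proof (cases "x' \<in> pline c r0")
    case False
    then have "persp c r0 s0 x' (\<sigma> x')" using desargues[OF s0 off[OF x(2) off1]] by blast
    then show ?thesis using desargues[OF on[OF x(1) on1]] x by blast
  next
    case True
    \<comment> \<open>With \<open>x'\<close> on the line \<open>c r0\<close> the pair
      \<open>r0\<close>, \<open>s0\<close> cannot be compared with \<open>x'\<close>. A pair
      \<open>r1\<close>, \<open>s1\<close> from outside the plane of \<open>c\<close>,
      \<open>p\<close>, \<open>r0\<close> mediates between \<open>x\<close> and
      \<open>x'\<close>.\<close>
    obtain r1 where r1: "r1 \<in> A" "r1 \<notin> pplane c p r0" using off_plane[of c p r0 p] c pS r0 A_in pplane_gen by blast
    have r1': "r1 \<notin> pline c p" "r1 \<notin> pline c r0" "r1 \<noteq> c"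
      using r1(2) pline_pl(1)[where a=c and b=p and c=r0] pline_pl(2)[where a=c and b=p and c=r0] pplane_gen(1)[OF c] by auto
    obtain s1 where s1: "persp c p q r1 s1" using persp_ex[OF c p q _ r1'(1)] r1 r1' by blast
    have x1: "x \<notin> pline c r1" using pline_sep[of c p r1 x] c pS r1 r1' on1 x A_in by blast
    have x2: "x' \<notin> pline c r1" using pline_sep[of c r0 r1 x'] c r0c r1 r1' True x A_in by blast
    have "persp c r0 s0 r1 s1" using desargues[OF s0 s1 r1'(2)] .
    then have "persp c r1 s1 x (\<sigma> x)" using desargues[OF _ on[OF x(1) on1] x1] by blast
    moreover have "persp c r1 s1 x' (\<sigma> x')" using desargues[OF s1 off[OF x(2) off1] x2] .
    ultimately show ?thesis using desargues x by blast
  qed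
  have gen: "persp c x (\<sigma> x) x' (\<sigma> x')" if x: "x \<in> A - {c}" "x' \<in> A - {c}" "x' \<notin> pline c x" for x x'
  proof -
    have nx: "x \<notin> pline c x'" using pline_through[of c x' x] x c A_in by auto
    consider "x \<notin> pline c p" "x' \<notin> pline c p" | "x \<in> pline c p" "x' \<notin> pline c p" | "x \<notin> pline c p" "x' \<in> pline c p"
      | "x \<in> pline c p" "x' \<in> pline c p" by blast
    then show ?thesis
    proof cases
      case 1 then show ?thesis using desargues[OF off[OF x(1)] off[OF x(2)] x(3)] by blast
    next
      case 2 then show ?thesis using mixed[OF x] by blast
    next
      case 3 then show ?thesis using mixed[OF x(2) x(1) nx] persp_sym by blast
    next
      case 4 then have "pline c x = pline c p" using pline_through(1)[of c p x] c pS(1,2) x(1) by blast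
      then show ?thesis using 4 x by blast
    qed
  qed
  have dil: "\<sigma> x \<noteq> \<sigma> x' \<and> dir (\<sigma> x) (\<sigma> x') = dir x x'" if x: "x \<in> A - {c}" "x' \<in> A - {c}" "x \<noteq> x'" for x x'
  proof (cases "x' \<in> pline c x")
    case False
    then have px: "persp c x (\<sigma> x) x' (\<sigma> x')" using gen[OF x(1,2)] by blast
    then have "dir x x' = dir (\<sigma> x) (\<sigma> x')" by (simp add: persp_def)
    then show ?thesis using persp_neq(2)[OF px] by simp
  next
    case True
    have S: "x \<in> S" "x' \<in> S" "x \<noteq> c" "x' \<noteq> c" "\<sigma> x \<in> S" "\<sigma> x' \<in> S" using x inA(1)[OF x(1)] inA(1)[OF x(2)] A_in by auto
    have l: "pline c x' = pline c x" using pline_through(1)[OF c S(1,3) True S(4)] .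
    have same: "x \<in> pline c p \<longleftrightarrow> x' \<in> pline c p"
      using pline_through[of c p x] pline_through[of c p x'] l S c pS by (metis pline_right)
    have ne: "\<sigma> x \<noteq> \<sigma> x'"
      using persp_inj[of c p q x "\<sigma> x" x'] persp_inj[of c r0 s0 x "\<sigma> x" x']
        off[OF x(1)] off[OF x(2)] on[OF x(1)] on[OF x(2)] same x(3) by metis
    have "\<sigma> x \<in> pline c x" "\<sigma> x' \<in> pline c x" using inA(2)[OF x(1)] inA(2)[OF x(2)] l by auto
    then have "pline (\<sigma> x) (\<sigma> x') = pline c x" using pline_eq[of c x "\<sigma> x" "\<sigma> x'"] c S ne by auto
    moreover have "pline x x' = pline c x" using pline_eq[of c x x x'] c S x True by auto
    ultimately show ?thesis using ne unfolding dir_def by simp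
  qed
  have dilc: "\<sigma> x \<noteq> c \<and> dir c (\<sigma> x) = dir c x" if x: "x \<in> A - {c}" for x
    using inA[OF x] pline_through[of c x "\<sigma> x"] x c A_in unfolding dir_def by auto
  have sc: "\<sigma> c = c" by (simp add: \<sigma>_def)
  have "dil \<sigma>"
    unfolding dil_def
  proof (intro conjI ballI impI)
    fix x assume x: "x \<in> A"
    then show "\<sigma> x \<in> A" using inA sc by (cases "x = c") auto
    fix y assume y: "y \<in> A" "x \<noteq> y"
    show "\<sigma> x \<noteq> \<sigma> y" using dil[of x y] dilc x y sc by (metis Diff_iff singletonD)
    show "dir (\<sigma> x) (\<sigma> y) = dir x y"
      using dil[of x y] dilc[of x] dilc[of y] x y sc dir_commute by (metis Diff_iff singletonD)
  qed
  moreover have "\<sigma> p = q"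
    using on[of p] p c pS persp_unique[OF persp_sym[OF s0]] by auto
  moreover have "\<forall>x\<in>A. \<sigma> x \<in> pline c x" using inA sc c by (metis Diff_iff singletonD pline_left)
  ultimately show ?thesis using sc by blast
qed

end

section \<open>Vector addition and scalars\<close>

context pointed_orthoset
begin

lemma two_dir_unique:
  assumes "a \<in> A" "b \<in> A" "i \<perp> org" "j \<perp> org" "i \<noteq> j"
    "u \<in> pline a i" "u \<in> pline b j" "v \<in> pline a i" "v \<in> pline b j"
  shows "u = v"
proof (rule ccontr)
  assume "u \<noteq> v"
  then have "pline a i = pline b j"
    using pline_meet_unique[of a i b j u v] assms A_in orth_in A_neq_inf by metis
  then have "j \<in> pline a i" using assms orth_in by auto
  then show False using inf_unique[of a i j] assms by blast
qed

lemma dir_eq_collinear: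
  assumes "p \<in> A" "q \<in> A" "x \<in> A" "x \<noteq> p" "x \<noteq> q" "p \<noteq> q" "dir p x = dir q x"
  shows "x \<in> pline p q"
proof -
  let ?i = "dir x p"
  have i: "?i \<perp> org" using dir_orth assms by blast
  have "p \<in> pline x ?i" "q \<in> pline x ?i"
    using mem_pline_dir[of x p ?i] mem_pline_dir[of x q ?i] assms i dir_commute by metis+
  then have "pline p q = pline x ?i"
    using pline_eq[of x ?i p q] assms i A_in orth_in A_neq_inf by metis
  then show ?thesis using assms A_in by auto
qed

lemma dil_in_pline:
  assumes "dil \<sigma>" "p \<in> A" "x \<in> A" "p \<noteq> x"
  shows "\<sigma> x \<in> pline (\<sigma> p) (dir p x)"
  using mem_pline_dir[of "\<sigma> p" "\<sigma> x" "dir p x"] dilD[OF assms(1)] dir_orth assms by metis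

text \<open>Off the line \<open>p q\<close> the image of \<open>x\<close> is the intersection of two
  lines through known points with known directions. A point on that line is treated with an
  auxiliary \<open>r\<close> in place of \<open>q\<close>.\<close>

lemma dil_eq2:
  assumes \<sigma>: "dil \<sigma>" and \<tau>: "dil \<tau>" and A: "p \<in> A" "q \<in> A" "x \<in> A" and pq: "p \<noteq> q"
    and eq: "\<sigma> p = \<tau> p" "\<sigma> q = \<tau> q"
  shows "\<sigma> x = \<tau> x"
proof -
  have off: "\<sigma> x = \<tau> x" if pq: "p \<in> A" "q \<in> A" "x \<in> A" "p \<noteq> q" "\<sigma> p = \<tau> p" "\<sigma> q = \<tau> q"
    and x: "x \<notin> pline p q" for p q x
  proof -
    have ne: "p \<noteq> x" "q \<noteq> x" using x pq A_in by auto
    have "dir p x \<noteq> dir q x" using dir_eq_collinear[of p q x] pq x ne by blast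
    moreover have "\<sigma> x \<in> pline (\<sigma> p) (dir p x)" "\<tau> x \<in> pline (\<sigma> p) (dir p x)"
      "\<sigma> x \<in> pline (\<sigma> q) (dir q x)" "\<tau> x \<in> pline (\<sigma> q) (dir q x)"
      using dil_in_pline[OF \<sigma> pq(1,3) ne(1)] dil_in_pline[OF \<tau> pq(1,3) ne(1)]
        dil_in_pline[OF \<sigma> pq(2,3) ne(2)] dil_in_pline[OF \<tau> pq(2,3) ne(2)] pq by simp_all
    ultimately show ?thesis
      using two_dir_unique[of "\<sigma> p" "\<sigma> q" "dir p x" "dir q x" "\<sigma> x" "\<tau> x"] dilD(1)[OF \<sigma>] pq ne dir_orth by metis
  qed
  show ?thesis
  proof (cases "x \<in> pline p q")
    case False then show ?thesis using off A pq eq by blast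
  next
    case True
    obtain r where r: "r \<in> A" "r \<notin> pline p q" using off_line[of p q p] A A_in by auto
    have r': "\<sigma> r = \<tau> r" using off[OF A(1,2) r(1) pq eq r(2)] .
    have rp: "r \<noteq> p" using r A A_in by auto
    show ?thesis
    proof (cases "x = p")
      case True then show ?thesis using eq by simp
    next
      case False
      have "x \<notin> pline p r" using pline_sep[of p q r x] True False A r rp pq A_in by auto
      then show ?thesis using off[OF A(1) r(1) A(3) rp[symmetric] eq(1) r'] by blast
    qed
  qed
qed

lemma dil_id: "dil (\<lambda>x. x)"
  by (simp add: dil_def)

lemma dil_comp: "\<lbrakk>dil \<sigma>; dil \<tau>\<rbrakk> \<Longrightarrow> dil (\<lambda>x. \<sigma> (\<tau> x))"
  by (simp add: dil_def)

section \<open>Translations\<close>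

definition trl :: "('a \<Rightarrow> 'a) \<Rightarrow> bool" where
  "trl \<sigma> \<longleftrightarrow> dil \<sigma> \<and> (\<exists>c. c \<perp> org \<and> (\<forall>x\<in>A. \<sigma> x \<in> pline x c))"

lemma trl_dil: "trl \<sigma> \<Longrightarrow> dil \<sigma>"
  by (simp add: trl_def)

lemma trl_A: "\<lbrakk>trl \<sigma>; x \<in> A\<rbrakk> \<Longrightarrow> \<sigma> x \<in> A"
  using trl_dil dilD(1) by blast

lemma trl_id: "trl (\<lambda>x. x)"
  using frame_at[OF org_in] A_in unfolding trl_def by (auto intro: dil_id pline_left)

lemma trl_ex:
  assumes "p \<in> A" "q \<in> A"
  shows "\<exists>\<sigma>. trl \<sigma> \<and> \<sigma> p = q"
proof (cases "p = q")
  case True then show ?thesis using trl_id by blast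
next
  case False
  let ?c = "dir p q"
  have c: "?c \<perp> org" using dir_orth assms False by blast
  then have "q \<in> pline ?c p" using mem_pline_dir[of p q ?c] assms False pline_commute by blast
  then obtain \<sigma> where "dil \<sigma>" "\<sigma> p = q" "\<forall>x\<in>A. \<sigma> x \<in> pline ?c x"
    using central_dil_ex[of ?c p q] c orth_in[OF c] assms A_neq_inf[OF _ c] by blast
  then show ?thesis using c pline_commute unfolding trl_def by blast
qed

text \<open>For \<open>y\<close> off the line \<open>p c\<close> the image lies on
  \<open>y c\<close> and, as \<open>p\<close> is fixed, also on \<open>p y\<close>. So
  \<open>y\<close> is a second fixed point, and two fixed points determine a dilatation.\<close>

lemma trl_fix:
  assumes \<sigma>: "trl \<sigma>" and p: "p \<in> A" "\<sigma> p = p" and x: "x \<in> A"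
  shows "\<sigma> x = x"
proof -
  obtain c where c: "c \<perp> org" "\<And>x. x \<in> A \<Longrightarrow> \<sigma> x \<in> pline x c" using \<sigma> unfolding trl_def by blast
  have cS: "c \<in> S" "p \<noteq> c" using c(1) orth_in A_neq_inf p by blast+
  obtain y where y: "y \<in> A" "y \<notin> pline p c" using off_line[of p c p] p A_in cS by auto
  have py: "p \<noteq> y" using y p A_in by auto
  have "dir p y \<noteq> c" using mem_pline_dir[of p y c] y p py c(1) by blast
  moreover have "\<sigma> y \<in> pline p (dir p y)" using dil_in_pline[OF trl_dil[OF \<sigma>] p(1) y(1) py] p by simp
  moreover have "y \<in> pline p (dir p y)" using mem_pline_dir[of p y "dir p y"] p y py dir_orth by blast
  moreover have "y \<in> pline y c" using y A_in by simp
  ultimately have "\<sigma> y = y"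
    using two_dir_unique[of y p c "dir p y" "\<sigma> y" y] y p c dir_orth py by metis
  then show ?thesis using dil_eq2[OF trl_dil[OF \<sigma>] dil_id p(1) y(1) x py] p by simp
qed

lemma trl_dir:
  assumes \<sigma>: "trl \<sigma>" and p: "p \<in> A" "\<sigma> p \<noteq> p" and x: "x \<in> A"
  shows "\<sigma> x \<noteq> x" "dir x (\<sigma> x) = dir p (\<sigma> p)"
proof -
  obtain c where c: "c \<perp> org" "\<And>x. x \<in> A \<Longrightarrow> \<sigma> x \<in> pline x c" using \<sigma> unfolding trl_def by blast
  show 1: "\<sigma> x \<noteq> x" using trl_fix[OF \<sigma> x] p by blast
  have "dir x (\<sigma> x) = c" using mem_pline_dir[of x "\<sigma> x" c] c x 1 trl_A[OF \<sigma> x] by metis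
  moreover have "dir p (\<sigma> p) = c" using mem_pline_dir[of p "\<sigma> p" c] c p trl_A[OF \<sigma> p(1)] by metis
  ultimately show "dir x (\<sigma> x) = dir p (\<sigma> p)" by simp
qed

lemma trl_mem:
  assumes \<sigma>: "trl \<sigma>" and p: "p \<in> A" "\<sigma> p \<noteq> p" and x: "x \<in> A"
  shows "\<sigma> x \<in> pline x (dir p (\<sigma> p))"
  using trl_dir[OF assms] mem_pline_dir[of x "\<sigma> x" "dir p (\<sigma> p)"] trl_A[OF \<sigma>] x p dir_orth by metis

lemma trl_eq:
  assumes \<sigma>: "trl \<sigma>" and \<tau>: "trl \<tau>" and p: "p \<in> A" "\<sigma> p = \<tau> p" and x: "x \<in> A"
  shows "\<sigma> x = \<tau> x"
proof (cases "\<sigma> p = p")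
  case True
  then show ?thesis using trl_fix[OF \<sigma> p(1) _ x] trl_fix[OF \<tau> p(1) _ x] p by simp
next
  case False
  let ?c = "dir p (\<sigma> p)"
  have A: "\<sigma> p \<in> A" using trl_A \<sigma> p by blast
  have c: "?c \<perp> org" using dir_orth p A False by metis
  obtain y where y: "y \<in> A" "y \<notin> pline p ?c" using off_line[of p ?c p] p A_in c orth_in by auto
  have py: "p \<noteq> y" using y p A_in by auto
  have "dir p y \<noteq> ?c" using mem_pline_dir[of p y ?c] y p py c by blast
  moreover have "\<sigma> y \<in> pline y ?c" "\<tau> y \<in> pline y ?c"
    using trl_mem[OF \<sigma> p(1) False y(1)] trl_mem[OF \<tau> p(1) _ y(1)] p False by simp_all
  moreover have "\<sigma> y \<in> pline (\<sigma> p) (dir p y)" "\<tau> y \<in> pline (\<sigma> p) (dir p y)"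
    using dil_in_pline[OF trl_dil[OF \<sigma>] p(1) y(1) py] dil_in_pline[OF trl_dil[OF \<tau>] p(1) y(1) py] p by simp_all
  ultimately have "\<sigma> y = \<tau> y"
    using two_dir_unique[of y "\<sigma> p" ?c "dir p y" "\<sigma> y" "\<tau> y"] y A c p py dir_orth by metis
  then show ?thesis using dil_eq2[OF trl_dil[OF \<sigma>] trl_dil[OF \<tau>] p(1) y(1) x py p(2)] by blast
qed

text \<open>Parallel lines are lines through a common point at infinity, so a parallelogram is a
  perspectivity with that centre. This makes Desargues available for triangles joined by parallel
  lines.\<close>

lemma persp_parallel:
  assumes "p \<in> A" "x \<in> A" "u \<in> A" "v \<in> A" "p \<noteq> x" "u \<noteq> v" "dir p x = i" "dir u v = i"
    "p \<noteq> u" "x \<noteq> v" "dir p u = dir x v" "dir p u \<noteq> i"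
  shows "persp i p x u v"
proof -
  have i: "i \<perp> org" using dir_orth assms by blast
  have "x \<in> pline i p" "v \<in> pline i u" using mem_pline_dir[of p x i] mem_pline_dir[of u v i] assms i pline_commute by metis+
  moreover have "u \<notin> pline i p" using mem_pline_dir[of p u i] assms i pline_commute by metis
  ultimately show ?thesis using assms i orth_in[OF i] A_neq_inf[OF _ i] unfolding persp_def by blast
qed

text \<open>When the two centres differ, no centre of the product is known in advance; it is
  obtained by showing that the direction from \<open>x\<close> to its image is the same for all
  \<open>x\<close>.\<close>

lemma trl_comp:
  assumes \<sigma>: "trl \<sigma>" and \<tau>: "trl \<tau>"
  shows "trl (\<lambda>x. \<sigma> (\<tau> x))"
proof -
  have dl: "dil (\<lambda>x. \<sigma> (\<tau> x))" using dil_comp trl_dil \<sigma> \<tau> by blast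
  obtain c where c: "c \<perp> org" "\<And>x. x \<in> A \<Longrightarrow> \<sigma> x \<in> pline x c" using \<sigma> unfolding trl_def by blast
  obtain d where d: "d \<perp> org" "\<And>x. x \<in> A \<Longrightarrow> \<tau> x \<in> pline x d" using \<tau> unfolding trl_def by blast
  have cdS: "c \<in> S" "d \<in> S" using c(1) d(1) orth_in by blast+
  consider "\<sigma> org = org" | "\<tau> org = org" | "c = d" | "\<sigma> org \<noteq> org" "\<tau> org \<noteq> org" "c \<noteq> d" by blast
  then show ?thesis
  proof cases
    case 1
    then have "\<sigma> (\<tau> x) = \<tau> x" if "x \<in> A" for x using trl_fix[OF \<sigma> org_A] trl_A[OF \<tau>] that by blast
    then have "\<forall>x\<in>A. \<sigma> (\<tau> x) \<in> pline x d" using d by simp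
    then show ?thesis using dl d(1) unfolding trl_def by blast
  next
    case 2
    then have "\<tau> x = x" if "x \<in> A" for x using trl_fix[OF \<tau> org_A] that by blast
    then have "\<forall>x\<in>A. \<sigma> (\<tau> x) \<in> pline x c" using c by simp
    then show ?thesis using dl c(1) unfolding trl_def by blast
  next
    case 3
    have "\<sigma> (\<tau> x) \<in> pline x c" if x: "x \<in> A" for x
    proof -
      have tx: "\<tau> x \<in> A" using trl_A \<tau> x by blast
      have "pline c (\<tau> x) = pline c x"
        using pline_through(1)[of c x "\<tau> x"] cdS A_in[OF x] A_neq_inf[OF x c(1)] A_neq_inf[OF tx c(1)]
          d(2)[OF x] 3 pline_commute by metis
      then show ?thesis using c(2)[OF tx] pline_commute by metis
    qed
    then show ?thesis using dl c(1) unfolding trl_def by blast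
  next
    case 4
    note \<sigma>n = 4(1) and \<tau>n = 4(2)
    define g where "g x = \<sigma> (\<tau> x)" for x
    have tA: "\<tau> x \<in> A" and gA: "g x \<in> A" if "x \<in> A" for x using that trl_A \<sigma> \<tau> unfolding g_def by blast+
    have tn: "\<tau> x \<noteq> x" if "x \<in> A" for x using trl_dir(1)[OF \<tau> org_A \<tau>n that] .
    have sn: "\<sigma> x \<noteq> x" if "x \<in> A" for x using trl_dir(1)[OF \<sigma> org_A \<sigma>n that] .
    have td: "dir x (\<tau> x) = d" if "x \<in> A" for x
      using mem_pline_dir[of x "\<tau> x" d] d that tA tn by metis
    have sd: "dir x (\<sigma> x) = c" if "x \<in> A" for x
      using mem_pline_dir[of x "\<sigma> x" c] c that trl_A[OF \<sigma>] sn by metis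
    have gn: "g x \<noteq> x" if x: "x \<in> A" for x
      using td[OF x] sd[OF tA[OF x]] 4(3) dir_commute unfolding g_def by metis
    \<comment> \<open>The triangles \<open>p\<close>, \<open>\<tau> p\<close>, \<open>g p\<close>
      and \<open>x\<close>, \<open>\<tau> x\<close>, \<open>g x\<close> are in perspective from the
      point at infinity of \<open>p x\<close>, so Desargues makes their third sides parallel. The
      conditions on \<open>dir p x\<close> keep the triangles nondegenerate.\<close>
    have step: "dir x (g x) = dir p (g p)"
      if p: "p \<in> A" and x: "x \<in> A" "p \<noteq> x" and i: "dir p x \<noteq> c" "dir p x \<noteq> d" "dir p x \<noteq> dir p (g p)" for p x
    proof -
      let ?i = "dir p x"
      have ne: "\<tau> p \<noteq> \<tau> x" "g p \<noteq> g x" and di: "dir (\<tau> p) (\<tau> x) = ?i" "dir (g p) (g x) = ?i"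
        using dilD(2,3)[OF trl_dil[OF \<tau>] p x] dilD(2,3)[OF dl p x] unfolding g_def by simp_all
      have td': "dir (\<tau> p) p = d" "dir (\<tau> x) x = d" using td p x dir_commute by metis+
      have sdp: "dir (\<tau> p) (g p) = c" "dir (\<tau> x) (g x) = c" "\<tau> p \<noteq> g p" "\<tau> x \<noteq> g x"
        using sd[OF tA[OF p]] sd[OF tA[OF x(1)]] sn[OF tA[OF p]] sn[OF tA[OF x(1)]] unfolding g_def by simp_all
      have 1: "persp ?i (\<tau> p) (\<tau> x) p x"
        by (rule persp_parallel) (use tA tn td' p x ne di i in auto)
      have 2: "persp ?i (\<tau> p) (\<tau> x) (g p) (g x)"
        by (rule persp_parallel) (use tA gA p x ne di i sdp in auto)
      have i': "?i \<perp> org" using dir_orth p x by blast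
      have "g p \<notin> pline ?i p" using mem_pline_dir[of p "g p" ?i] gA gn p i i' pline_commute by metis
      then have "persp ?i p x (g p) (g x)" using desargues[OF 1 2] by blast
      then show ?thesis unfolding persp_def by simp
    qed
    \<comment> \<open>The excluded directions all lie in the plane \<open>?P\<close>, so
      \<open>step\<close> applies along every line leaving \<open>?P\<close>; a point of
      \<open>?P\<close> is compared with one outside.\<close>
    let ?p = org and ?P = "pplane org c d"
    have PS: "c \<in> ?P" "d \<in> ?P" "org \<in> ?P" using pplane_gen cdS org_in by auto
    have "\<tau> org \<in> ?P" using d(2)[OF org_A] pline_subset_pl[OF PS(3,2)] by blast
    then have "g org \<in> ?P" using c(2)[OF tA[OF org_A]] pline_subset_pl PS(1) unfolding g_def by blast
    then have eP: "dir org (g org) \<in> ?P" 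
      using dir_pline[OF org_A gA[OF org_A] gn[OF org_A, symmetric]] pline_subset_pl[OF PS(3)] by blast
    have outP: "y \<in> ?P" if "p \<in> A" "p \<in> ?P" "y \<in> A" "p \<noteq> y" "dir p y \<in> ?P" for p y
      using mem_pline_dir[of p y "dir p y"] dir_orth that pline_subset_pl by blast
    have off: "dir y (g y) = dir org (g org)" if y: "y \<in> A" "y \<notin> ?P" for y
      using step[OF org_A y(1)] outP[OF org_A PS(3) y(1)] y eP PS by metis
    have all: "dir x (g x) = dir org (g org)" if x: "x \<in> A" for x
    proof (cases "x \<in> ?P")
      case False then show ?thesis using off x by blast
    next
      case True
      obtain y where y: "y \<in> A" "y \<notin> ?P" using off_plane[OF org_in cdS org_A PS(3)] by blast
      have "y \<noteq> x" using y True by blast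
      then show ?thesis
        using step[OF y(1) x] outP[OF x True y(1)] off[OF y] y eP PS dir_commute by metis
    qed
    have "g x \<in> pline x (dir org (g org))" if x: "x \<in> A" for x
      using mem_pline_dir[of x "g x" "dir org (g org)"] all[OF x] x gA gn dir_orth org_A by metis
    moreover have "dir org (g org) \<perp> org" using dir_orth gA gn org_A by metis
    ultimately show ?thesis using dl unfolding trl_def g_def by blast
  qed
qed

text \<open>For different directions both sides are the fourth vertex of the same parallelogram. For
  equal directions choose a translation \<open>\<rho>\<close> in another direction:
  \<open>\<sigma>\<close> commutes with \<open>\<rho>\<close> and with the product of
  \<open>\<rho>\<close> and \<open>\<tau>\<close>, hence with \<open>\<tau>\<close>.\<close>

lemma trl_comm:
  assumes \<sigma>: "trl \<sigma>" and \<tau>: "trl \<tau>" and p: "p \<in> A"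
  shows "\<sigma> (\<tau> p) = \<tau> (\<sigma> p)"
proof -
  have nonpar: "\<sigma> (\<tau> p) = \<tau> (\<sigma> p)" if \<sigma>: "trl \<sigma>" and \<tau>: "trl \<tau>" and p: "p \<in> A"
    and n: "\<sigma> p \<noteq> p" "\<tau> p \<noteq> p" "dir p (\<sigma> p) \<noteq> dir p (\<tau> p)" for \<sigma> \<tau> p
  proof -
    let ?c = "dir p (\<sigma> p)" and ?d = "dir p (\<tau> p)"
    have A: "\<sigma> p \<in> A" "\<tau> p \<in> A" using trl_A \<sigma> \<tau> p by blast+
    have "\<sigma> (\<tau> p) \<in> pline (\<tau> p) ?c" "\<tau> (\<sigma> p) \<in> pline (\<sigma> p) ?d"
      using trl_mem[OF \<sigma> p n(1) A(2)] trl_mem[OF \<tau> p n(2) A(1)] .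
    moreover have "\<sigma> (\<tau> p) \<in> pline (\<sigma> p) ?d" "\<tau> (\<sigma> p) \<in> pline (\<tau> p) ?c"
      using dil_in_pline[OF trl_dil[OF \<sigma>] p A(2)] dil_in_pline[OF trl_dil[OF \<tau>] p A(1)] n by simp_all
    moreover have "?c \<perp> org" "?d \<perp> org" using dir_orth[OF p A(1)] dir_orth[OF p A(2)] n by simp_all
    ultimately show ?thesis
      using two_dir_unique[OF A(2) A(1)] n(3) by blast
  qed
  consider "\<sigma> p = p" | "\<tau> p = p" | "\<sigma> p \<noteq> p" "\<tau> p \<noteq> p" "dir p (\<sigma> p) \<noteq> dir p (\<tau> p)"
    | "\<sigma> p \<noteq> p" "\<tau> p \<noteq> p" "dir p (\<sigma> p) = dir p (\<tau> p)" by blast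
  then show ?thesis
  proof cases
    case 1 then show ?thesis using trl_fix[OF \<sigma> p] trl_A[OF \<tau> p] by simp
  next
    case 2 then show ?thesis using trl_fix[OF \<tau> p] trl_A[OF \<sigma> p] by simp
  next
    case 3 then show ?thesis using nonpar \<sigma> \<tau> p by blast
  next
    case 4
    let ?c = "dir p (\<sigma> p)"
    have A: "\<sigma> p \<in> A" "\<tau> p \<in> A" using trl_A \<sigma> \<tau> p by blast+
    have c: "?c \<perp> org" using dir_orth[OF p A(1)] 4 by simp
    obtain q where q: "q \<in> A" "q \<notin> pline p ?c" using off_line[of p ?c p] p A_in c orth_in by auto
    obtain \<rho> where \<rho>: "trl \<rho>" "\<rho> p = q" using trl_ex p q by blast
    have pq: "\<rho> p \<noteq> p" using q p A_in \<rho> by auto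
    have dq: "dir p (\<rho> p) \<noteq> ?c" using mem_pline_dir[of p q ?c] q p pq c \<rho> by metis
    let ?g = "\<lambda>x. \<rho> (\<tau> x)"
    have g: "trl ?g" using trl_comp \<rho> \<tau> by blast
    have gA: "?g p \<in> A" using trl_A g p by blast
    have tp: "\<tau> p \<in> pline p ?c" using mem_pline_dir[of p "\<tau> p" ?c] p A 4 c by metis
    have gt: "dir (\<tau> p) (?g p) = dir p (\<rho> p)" "?g p \<noteq> \<tau> p" using trl_dir[OF \<rho>(1) p pq A(2)] by auto
    have nin: "?g p \<notin> pline p ?c"
    proof
      assume "?g p \<in> pline p ?c"
      moreover have "pline (\<tau> p) ?c = pline p ?c"
        using pline_through(1)[of ?c p "\<tau> p"] tp p c orth_in[OF c] A A_in A_neq_inf[OF p c] A_neq_inf[OF A(2) c] pline_commute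
        by metis
      ultimately have "dir (\<tau> p) (?g p) = ?c" using mem_pline_dir[OF A(2) gA] gt c by metis
      then show False using gt dq by simp
    qed
    then have gp1: "?g p \<noteq> p" using pline_left[OF A_in[OF p], of ?c] by metis
    have gp2: "dir p (?g p) \<noteq> ?c"
      using mem_pline_dir[OF p gA gp1[symmetric] c] nin by blast
    note gp = gp1 gp2
    have 1: "\<sigma> (\<rho> (\<tau> p)) = \<rho> (\<tau> (\<sigma> p))" using nonpar[OF \<sigma> g p 4(1) gp(1)] gp(2) by simp
    have ne: "\<sigma> (\<tau> p) \<noteq> \<tau> p" "dir (\<tau> p) (\<sigma> (\<tau> p)) = ?c" using trl_dir[OF \<sigma> p 4(1) A(2)] by auto
    have 2: "\<sigma> (\<rho> (\<tau> p)) = \<rho> (\<sigma> (\<tau> p))"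
      using nonpar[OF \<sigma> \<rho>(1) A(2) ne(1)] gt ne dq by simp
    show ?thesis using 1 2 dilD(2)[OF trl_dil[OF \<rho>(1)]] trl_A \<sigma> \<tau> A by metis
  qed
qed

section \<open>The group of vectors\<close>

definition add :: "'a \<Rightarrow> 'a \<Rightarrow> 'a" where "add x y = (SOME \<sigma>. trl \<sigma> \<and> \<sigma> org = x) y"

lemma add_trl:
  assumes "trl \<sigma>" "y \<in> A" shows "add (\<sigma> org) y = \<sigma> y"
  unfolding add_def
  using someI_ex[of "\<lambda>\<tau>. trl \<tau> \<and> \<tau> org = \<sigma> org"] assms trl_eq org_A by blast

lemma trl_add:
  assumes "x \<in> A" shows "trl (add x)" "add x org = x"
proof -
  have e: "\<exists>\<tau>. trl \<tau> \<and> \<tau> org = x" using trl_ex[OF org_A assms] .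
  show "trl (add x)" "add x org = x" using someI_ex[OF e] unfolding add_def by auto
qed

lemma add_closed [simp]: "\<lbrakk>x \<in> A; y \<in> A\<rbrakk> \<Longrightarrow> add x y \<in> A"
  using trl_A trl_add by blast

lemma add_0_right: "x \<in> A \<Longrightarrow> add x org = x"
  using trl_add by blast

lemma add_commute: "\<lbrakk>x \<in> A; y \<in> A\<rbrakk> \<Longrightarrow> add x y = add y x"
  using trl_comm[of "add x" "add y" org] trl_add org_A by simp

lemma add_0_left: "x \<in> A \<Longrightarrow> add org x = x"
  using add_commute[of org x] add_0_right[of x] by simp

lemma add_assoc:
  assumes "x \<in> A" "y \<in> A" "z \<in> A" shows "add (add x y) z = add x (add y z)"
  using add_trl[OF trl_comp[OF trl_add(1)[OF assms(1)] trl_add(1)[OF assms(2)]] assms(3)]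
    add_0_right[OF assms(2)] by simp

lemma neg_ex: assumes x: "x \<in> A" shows "\<exists>y\<in>A. add y x = org"
proof -
  obtain \<sigma> where "trl \<sigma>" "\<sigma> x = org" using trl_ex[OF x org_A] by blast
  then show ?thesis using add_trl[of \<sigma> x] x trl_A org_A by metis
qed

definition neg :: "'a \<Rightarrow> 'a" where "neg x = (SOME y. y \<in> A \<and> add y x = org)"

lemma
  assumes "x \<in> A"
  shows neg_closed [simp]: "neg x \<in> A" and add_neg_left: "add (neg x) x = org"
    and add_neg_right: "add x (neg x) = org"
proof -
  have "neg x \<in> A \<and> add (neg x) x = org" using someI_ex[of "\<lambda>y. y \<in> A \<and> add y x = org"] neg_ex[OF assms]
    unfolding neg_def by blast
  then show "neg x \<in> A" "add (neg x) x = org" "add x (neg x) = org" using add_commute assms by auto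
qed

lemma add_cancel: "\<lbrakk>x \<in> A; y \<in> A; z \<in> A; add x y = add x z\<rbrakk> \<Longrightarrow> y = z"
  using add_assoc[of "neg x" x y] add_assoc[of "neg x" x z] by (simp add: add_neg_left add_0_left)

lemma add_cancel_right: "\<lbrakk>x \<in> A; y \<in> A; z \<in> A; add y x = add z x\<rbrakk> \<Longrightarrow> y = z"
  using add_cancel[of x y z] add_commute[of x y] add_commute[of x z] by simp

lemma add_left_commute: "\<lbrakk>x \<in> A; y \<in> A; z \<in> A\<rbrakk> \<Longrightarrow> add x (add y z) = add y (add x z)"
  using add_assoc[of x y z] add_assoc[of y x z] add_commute[of x y] by simp

lemma dir_add: "\<lbrakk>x \<in> A; y \<in> A; z \<in> A; y \<noteq> z\<rbrakk> \<Longrightarrow> dir (add x y) (add x z) = dir y z"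
  using dilD(3)[OF trl_dil[OF trl_add(1)]] by blast

lemma dir_add0: "\<lbrakk>x \<in> A; y \<in> A; y \<noteq> org\<rbrakk> \<Longrightarrow> add x y \<noteq> x \<and> dir x (add x y) = dir org y"
  using dir_add[of x org y] dilD(2)[OF trl_dil[OF trl_add(1)], of x org y] add_0_right[of x] org_A by metis

lemma add_in_pline:
  assumes "x \<in> A" "y \<in> A" "y \<noteq> org" shows "add x y \<in> pline x (dir org y)"
  using mem_pline_dir[of x "add x y" "dir org y"] dir_add0[OF assms] assms dir_orth[OF org_A] add_closed by metis

lemma pline_org_add:
  assumes i: "i \<in> S" "i \<noteq> org" and x: "x \<in> A" "x \<in> pline org i" and y: "y \<in> A" "y \<in> pline org i"
  shows "add x y \<in> pline org i"
proof (cases "x = org \<or> y = org")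
  case True then show ?thesis using x y add_0_left add_0_right by auto
next
  case False
  then have "dir org y \<in> pline org i" using dir_pline[OF org_A y(1)] pline_subset[of org org i y] y i org_in by auto
  then show ?thesis using add_in_pline[of x y] x y False pline_subset[of x org i "dir org y"] by auto
qed

lemma pline_org_neg:
  assumes i: "i \<in> S" "i \<noteq> org" and x: "x \<in> A" "x \<in> pline org i"
  shows "neg x \<in> pline org i"
proof (cases "x = org \<or> neg x = org")
  case True then show ?thesis using x add_neg_right[OF x(1)] add_0_left[of "neg x"] org_in by (metis neg_closed pline_left)
next
  case False
  have "dir (neg x) org = dir org x" using dir_add0[of "neg x" x] add_neg_left x False by simp
  then have "neg x \<in> pline org (dir org x)" using mem_pline_dir[of org "neg x" "dir org x"] False x
    dir_orth[OF org_A x(1)] dir_commute org_A neg_closed by metis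
  moreover have "dir org x \<in> pline org i" using dir_pline[OF org_A x(1)] pline_subset[of org org i x] x i org_in False by auto
  ultimately show ?thesis using pline_subset[of org org i "dir org x"] org_in by auto
qed

section \<open>Independent vectors and additive maps\<close>

definition ind :: "'a \<Rightarrow> 'a \<Rightarrow> bool" where
  "ind x y \<longleftrightarrow> x \<in> A \<and> y \<in> A \<and> x \<noteq> org \<and> y \<noteq> org \<and> y \<notin> pline org x"

lemma ind_sym: "ind x y \<Longrightarrow> ind y x"
  using pline_through(2)[of org y x] A_in org_in unfolding ind_def by auto

lemma ind_dir: "\<lbrakk>x \<in> A; y \<in> A; x \<noteq> org; y \<noteq> org\<rbrakk> \<Longrightarrow> ind x y \<longleftrightarrow> dir org x \<noteq> dir org y"
  using mem_pline_dir[of org y "dir org x"] dir_orth[of org x] pline_dir[of org x] org_A unfolding ind_def by metis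

lemma ind_ex: "x \<in> A \<Longrightarrow> x \<noteq> org \<Longrightarrow> \<exists>y. ind x y"
  using off_line[of org x x] A_in org_in unfolding ind_def by (metis pline_left pline_right)

lemma add_parallelogram:
  assumes "ind x y" "w \<in> A" "w \<in> pline x (dir org y)" "w \<in> pline y (dir org x)"
  shows "w = add x y"
proof -
  have xy: "x \<in> A" "y \<in> A" "x \<noteq> org" "y \<noteq> org" using assms unfolding ind_def by auto
  have "add x y \<in> pline x (dir org y)" "add x y \<in> pline y (dir org x)"
    using add_in_pline[of x y] add_in_pline[of y x] add_commute[of x y] xy by auto
  then show ?thesis
    using two_dir_unique[of x y "dir org y" "dir org x" w "add x y"] assms xy ind_dir[OF xy] dir_orth[OF org_A] by metis
qed

lemma ind_line:
  assumes "ind x z" "y \<in> A" "y \<noteq> org" "y \<in> pline org x" shows "ind y z"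
  using assms pline_through(1)[of org x y] A_in org_in unfolding ind_def by auto

lemma ind_add:
  assumes xz: "ind x z" and y: "y \<in> A" "y \<in> pline org x" shows "ind x (add y z)"
proof -
  have A: "x \<in> A" "z \<in> A" "x \<noteq> org" "x \<in> S" using xz A_in unfolding ind_def by auto
  have "add y z \<notin> pline org x"
  proof
    assume "add y z \<in> pline org x"
    then have "add (neg y) (add y z) \<in> pline org x" using pline_org_add[of x "neg y" "add y z"] pline_org_neg[of x y] A y by auto
    then have "z \<in> pline org x" using add_assoc[of "neg y" y z] add_neg_left[of y] add_0_left[of z] A y by auto
    then show False using xz unfolding ind_def by blast
  qed
  moreover then have "add y z \<noteq> org" using org_in by auto
  ultimately show ?thesis using A y unfolding ind_def by auto
qed

text \<open>For dependent \<open>x\<close> and \<open>y\<close> take \<open>z\<close> independent of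
  both, expand the image of \<open>x + y + z\<close> in two ways and cancel the image of
  \<open>z\<close>. Parallelogram arguments, which fail for collinear vectors, thereby suffice
  everywhere.\<close>

lemma additive_from_ind:
  assumes f: "\<And>x. x \<in> A \<Longrightarrow> f x \<in> A" "f org = org"
    and ind: "\<And>x y. ind x y \<Longrightarrow> f (add x y) = add (f x) (f y)"
    and xy: "x \<in> A" "y \<in> A"
  shows "f (add x y) = add (f x) (f y)"
proof -
  consider "x = org" | "y = org" | "ind x y" | "x \<noteq> org" "y \<noteq> org" "y \<in> pline org x"
    using xy unfolding ind_def by blast
  then show ?thesis
  proof cases
    case 1 then show ?thesis using f xy add_0_left by simp
  next
    case 2 then show ?thesis using f xy add_0_right by simp
  next
    case 3 then show ?thesis using ind by blast
  next
    case 4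
    obtain z where z: "ind x z" using ind_ex xy 4 by blast
    have zA: "z \<in> A" using z unfolding ind_def by blast
    have fA: "f x \<in> A" "f y \<in> A" "f z \<in> A" using f xy zA by auto
    have "ind y z" using ind_line z xy 4 by blast
    then have 1: "f (add y z) = add (f y) (f z)" using ind by blast
    have 2: "f (add x (add y z)) = add (f x) (f (add y z))" using ind[OF ind_add[OF z xy(2) 4(3)]] .
    show ?thesis
    \<comment> \<open>A vanishing sum is not independent of \<open>z\<close> and is treated
      apart.\<close>
    proof (cases "add x y = org")
      case True
      then have "f z = add (add (f x) (f y)) (f z)"
        using 1 2 add_assoc[of x y z] add_assoc[of "f x" "f y" "f z"] add_0_left xy zA fA by simp
      then have "add (f x) (f y) = org" 
        using add_cancel_right[of "f z" org "add (f x) (f y)"] add_0_left fA by simp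
      then show ?thesis using True f by simp
    next
      case False
      have "add x y \<in> pline org x" using pline_org_add[of x x y] xy 4 A_in by auto
      then have "ind (add x y) z" using ind_line[OF z] xy False by auto
      then have "f (add (add x y) z) = add (f (add x y)) (f z)" using ind by blast
      then have "add (f (add x y)) (f z) = add (add (f x) (f y)) (f z)"
        using 1 2 add_assoc[of x y z] add_assoc[of "f x" "f y" "f z"] xy zA fA by simp
      then show ?thesis using add_cancel_right[of "f z" "f (add x y)" "add (f x) (f y)"] f fA xy by simp
    qed
  qed
qed

section \<open>Homotheties\<close>

definition hom :: "('a \<Rightarrow> 'a) \<Rightarrow> bool" where "hom \<delta> \<longleftrightarrow> dil \<delta> \<and> \<delta> org = org"

lemma hom_A: "\<lbrakk>hom \<delta>; x \<in> A\<rbrakk> \<Longrightarrow> \<delta> x \<in> A"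
  using dilD(1) unfolding hom_def by blast

lemma hom_nz: "\<lbrakk>hom \<delta>; x \<in> A; x \<noteq> org\<rbrakk> \<Longrightarrow> \<delta> x \<noteq> org \<and> dir org (\<delta> x) = dir org x"
  using dilD(2,3)[of \<delta> org x] org_A unfolding hom_def by (metis (no_types, lifting) dilD(2))

lemma hom_line: assumes "hom \<delta>" "x \<in> A" shows "\<delta> x \<in> pline org x"
proof (cases "x = org")
  case True then show ?thesis using assms org_in unfolding hom_def by simp
next
  case False
  then have "\<delta> x \<in> pline org (dir org x)" using dil_in_pline[of \<delta> org x] assms org_A unfolding hom_def by auto
  then show ?thesis using pline_dir[OF org_A assms(2)] False by auto
qed

lemma hom_ex:
  assumes "x \<in> A" "x \<noteq> org" "y \<in> A" "y \<noteq> org" "y \<in> pline org x"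
  shows "\<exists>\<delta>. hom \<delta> \<and> \<delta> x = y"
  using central_dil_ex[of org x y] assms org_in org_A unfolding hom_def by blast

lemma hom_eq: "\<lbrakk>hom \<delta>; hom \<epsilon>; p \<in> A; p \<noteq> org; \<delta> p = \<epsilon> p; x \<in> A\<rbrakk> \<Longrightarrow> \<delta> x = \<epsilon> x"
  using dil_eq2[of \<delta> \<epsilon> org p x] org_A unfolding hom_def by metis

lemma hom_comp: "\<lbrakk>hom \<delta>; hom \<epsilon>\<rbrakk> \<Longrightarrow> hom (\<lambda>x. \<delta> (\<epsilon> x))"
  using dil_comp unfolding hom_def by simp

text \<open>A homothety preserves directions, so it carries the parallelogram of \<open>x\<close>
  and \<open>y\<close> to that of their images.\<close>

lemma hom_add:
  assumes h: "hom \<delta>" and x: "x \<in> A" and y: "y \<in> A"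
  shows "\<delta> (add x y) = add (\<delta> x) (\<delta> y)"
proof (rule additive_from_ind[OF _ _ _ x y])
  show "\<delta> x \<in> A" if "x \<in> A" for x using hom_A h that by blast
  show "\<delta> org = org" using h unfolding hom_def by blast
  fix x y assume i: "ind x y"
  have xy: "x \<in> A" "y \<in> A" "x \<noteq> org" "y \<noteq> org" using i unfolding ind_def by auto
  note dx = hom_nz[OF h xy(1,3)] and dy = hom_nz[OF h xy(2,4)]
  have i': "ind (\<delta> x) (\<delta> y)" using ind_dir[of "\<delta> x" "\<delta> y"] ind_dir[OF xy] i dx dy hom_A[OF h] xy by simp
  note n = dir_add0[OF xy(1,2,4)] dir_add0[OF xy(2,1,3)]
  have "\<delta> (add x y) \<in> pline (\<delta> x) (dir org y)" "\<delta> (add x y) \<in> pline (\<delta> y) (dir org x)"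
    using dil_in_pline[of \<delta> x "add x y"] dil_in_pline[of \<delta> y "add x y"] h n xy add_commute[OF xy(1,2)] unfolding hom_def
    by (metis add_closed)+
  then show "\<delta> (add x y) = add (\<delta> x) (\<delta> y)"
    using add_parallelogram[OF i', of "\<delta> (add x y)"] dx dy hom_A[OF h] xy by simp
qed

text \<open>When \<open>f\<close> and \<open>g\<close> agree at \<open>p\<close>, their difference
  has the same value at \<open>x\<close> and at \<open>p + x\<close>. This value lies on the lines
  of \<open>\<phi> x\<close> and of \<open>\<phi> (p + x)\<close>, which meet only in
  \<open>org\<close>. In the applications \<open>\<phi>\<close> is the identity, for scalars, or an
  automorphism, in \<open>aut_smul\<close>.\<close>

lemma additive_line_eq:
  assumes f: "\<And>x. x \<in> A \<Longrightarrow> f x \<in> A" "\<And>x y. \<lbrakk>x \<in> A; y \<in> A\<rbrakk> \<Longrightarrow> f (add x y) = add (f x) (f y)"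
    and g: "\<And>x. x \<in> A \<Longrightarrow> g x \<in> A" "\<And>x y. \<lbrakk>x \<in> A; y \<in> A\<rbrakk> \<Longrightarrow> g (add x y) = add (g x) (g y)"
    and \<phi>: "\<And>x y. ind x y \<Longrightarrow> ind (\<phi> x) (\<phi> y)"
    and line: "\<And>x. x \<in> A \<Longrightarrow> f x \<in> pline org (\<phi> x)" "\<And>x. x \<in> A \<Longrightarrow> g x \<in> pline org (\<phi> x)"
    and p: "p \<in> A" "p \<noteq> org" "f p = g p" and x: "x \<in> A"
  shows "f x = g x"
proof -
  have f0: "f org = org" using f(2)[of org org] add_cancel[of "f org" "f org" org] f(1) add_0_right by simp
  have g0: "g org = org" using g(2)[of org org] add_cancel[of "g org" "g org" org] g(1) add_0_right by simp
  have main: "f x = g x" if pi: "ind p x" and eq: "f p = g p" for p x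
  proof -
    have A: "p \<in> A" "x \<in> A" "p \<noteq> org" "x \<noteq> org" using pi unfolding ind_def by auto
    let ?d = "add (f x) (neg (g x))"
    have fx: "f x = add ?d (g x)" using add_assoc[of "f x" "neg (g x)" "g x"] add_neg_left[of "g x"] add_0_right f g A by simp
    have ipx: "ind x (add p x)" using ind_add[OF ind_sym[OF pi], of x] ind_add[OF ind_sym[OF pi], of org]
      add_commute[OF A(1,2)] A A_in by simp
    have \<phi>x: "\<phi> x \<in> S" "\<phi> x \<noteq> org" using \<phi>[OF ipx] A_in unfolding ind_def by auto
    have \<phi>y: "\<phi> (add p x) \<in> S" "\<phi> (add p x) \<noteq> org" using \<phi>[OF ipx] A_in unfolding ind_def by auto
    have 1: "?d \<in> pline org (\<phi> x)" using pline_org_add[OF \<phi>x] pline_org_neg[OF \<phi>x] line f g A by auto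
    have "f (add p x) = add ?d (g (add p x))"
      using f(2)[OF A(1,2)] g(2)[OF A(1,2)] eq fx add_left_commute[of "g p" ?d "g x"] f g A by simp
    then have "?d = add (f (add p x)) (neg (g (add p x)))"
      using add_assoc[of ?d "g (add p x)" "neg (g (add p x))"] add_neg_right add_0_right f g A by simp
    moreover have pxA: "add p x \<in> A" using A by simp
    ultimately have 2: "?d \<in> pline org (\<phi> (add p x))"
      using pline_org_add[OF \<phi>y f(1)[OF pxA] line(1)[OF pxA] neg_closed[OF g(1)[OF pxA]]
        pline_org_neg[OF \<phi>y g(1)[OF pxA] line(2)[OF pxA]]] by simp
    have "?d = org"
      using pline_sep[of org "\<phi> x" "\<phi> (add p x)" ?d] 1 2 \<phi>[OF ipx] A_in org_in unfolding ind_def by auto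
    then show ?thesis using fx add_0_left g A by simp
  qed
  show ?thesis
  proof (cases "ind p x")
    case True then show ?thesis using main p by blast
  next
    case False
    obtain q where q: "ind p q" using ind_ex p by blast
    then have fq: "f q = g q" using main p by blast
    show ?thesis
    proof (cases "x = org")
      case True then show ?thesis using f0 g0 by simp
    next
      case xn: False
      then have "ind x q" using ind_line[OF q x xn] False p x unfolding ind_def by blast
      then show ?thesis using main[of q x] ind_sym fq by blast
    qed
  qed
qed

end

section \<open>Scalars\<close>

locale framed_orthoset = pointed_orthoset +
  fixes uni :: 'a
  assumes uni_A [simp]: "uni \<in> A" and uni_nz [simp]: "uni \<noteq> org"
begin

text \<open>A scalar is represented by its multiple of \<open>uni\<close>: the homothety with centre \<open>org\<close> taking \<open>uni\<close>
  to \<open>a\<close> is multiplication by \<open>a\<close>, so \<open>smul\<close> is also the product of scalars and \<open>add\<close> their sum.\<close>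

definition L :: "'a set" where "L = {x \<in> A. x \<in> pline org uni}"

definition smul :: "'a \<Rightarrow> 'a \<Rightarrow> 'a" where
  "smul a v = (if a = org then org else (SOME \<delta>. hom \<delta> \<and> \<delta> uni = a) v)"

lemma org_L [simp]: "org \<in> L" and uni_L [simp]: "uni \<in> L"
  by (simp_all add: L_def org_in A_in[OF uni_A])

lemma L_A [simp]: "a \<in> L \<Longrightarrow> a \<in> A"
  unfolding L_def by blast

lemma smul_0_left: "smul org v = org"
  by (simp add: smul_def)

lemma hom_smul: assumes "a \<in> L" "a \<noteq> org" shows "hom (smul a)" "smul a uni = a"
proof -
  have "\<exists>\<delta>. hom \<delta> \<and> \<delta> uni = a" using hom_ex[of uni a] assms unfolding L_def by auto
  from someI_ex[OF this] show "hom (smul a)" "smul a uni = a"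
    using assms unfolding smul_def by auto
qed

lemma smul_hom: assumes "hom \<delta>" "v \<in> A" shows "\<delta> uni \<in> L" "\<delta> uni \<noteq> org" "smul (\<delta> uni) v = \<delta> v"
proof -
  show 1: "\<delta> uni \<in> L" using hom_A hom_line assms unfolding L_def by auto
  show 2: "\<delta> uni \<noteq> org" using hom_nz[of \<delta> uni] assms by auto
  show "smul (\<delta> uni) v = \<delta> v" using hom_eq[of "smul (\<delta> uni)" \<delta> uni v] hom_smul[OF 1 2] assms by simp
qed

lemma smul_closed [simp]: "\<lbrakk>a \<in> L; v \<in> A\<rbrakk> \<Longrightarrow> smul a v \<in> A"
  using hom_A[OF hom_smul(1)] smul_0_left by (metis org_A)

lemma smul_line: "\<lbrakk>a \<in> L; v \<in> A\<rbrakk> \<Longrightarrow> smul a v \<in> pline org v"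
  using hom_line[OF hom_smul(1)] smul_0_left org_in by (metis pline_left)

lemma smul_uni: "a \<in> L \<Longrightarrow> smul a uni = a"
  using hom_smul(2) smul_0_left by metis

lemma smul_0_right: "a \<in> L \<Longrightarrow> smul a org = org"
  using hom_smul(1) smul_0_left unfolding hom_def by metis

lemma smul_1: "v \<in> A \<Longrightarrow> smul uni v = v"
  using smul_hom(3)[of "\<lambda>x. x" v] dil_id unfolding hom_def by simp

lemma smul_nz: "\<lbrakk>a \<in> L; v \<in> A; a \<noteq> org; v \<noteq> org\<rbrakk> \<Longrightarrow> smul a v \<noteq> org \<and> dir org (smul a v) = dir org v"
  using hom_nz[OF hom_smul(1)] by blast

lemma smul_add_right: "\<lbrakk>a \<in> L; v \<in> A; w \<in> A\<rbrakk> \<Longrightarrow> smul a (add v w) = add (smul a v) (smul a w)"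
  using hom_add[OF hom_smul(1)] smul_0_left add_0_right by (metis org_A)

lemma L_smul [simp]: "\<lbrakk>a \<in> L; b \<in> L\<rbrakk> \<Longrightarrow> smul a b \<in> L"
  using smul_line[of a b] pline_subset[of org org uni b] org_in smul_closed[of a b] unfolding L_def by auto

lemma L_add [simp]: "\<lbrakk>a \<in> L; b \<in> L\<rbrakk> \<Longrightarrow> add a b \<in> L"
  using pline_org_add[of uni a b] A_in unfolding L_def by auto

lemma L_neg [simp]: "a \<in> L \<Longrightarrow> neg a \<in> L"
  using pline_org_neg[of uni a] A_in unfolding L_def by auto

lemma smul_smul: assumes "a \<in> L" "b \<in> L" "v \<in> A" shows "smul (smul a b) v = smul a (smul b v)"
proof (cases "a = org \<or> b = org")
  case True then show ?thesis using smul_0_left smul_0_right assms by auto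
next
  case False
  then show ?thesis
    using smul_hom(3)[OF hom_comp[OF hom_smul(1)[OF assms(1)] hom_smul(1)[OF assms(2)]] assms(3)] hom_smul(2) assms by auto
qed

text \<open>Both sides are additive in \<open>v\<close>, stay on the line of \<open>v\<close> and
  agree at \<open>uni\<close>, where a scalar reproduces itself.\<close>

lemma smul_add_left:
  assumes a: "a \<in> L" and b: "b \<in> L" and v: "v \<in> A"
  shows "smul (add a b) v = add (smul a v) (smul b v)"
proof (rule additive_line_eq[where f = "smul (add a b)" and g = "\<lambda>x. add (smul a x) (smul b x)" and p = uni and \<phi> = "\<lambda>x. x"])
  show "add (smul a x) (smul b x) \<in> pline org x" if "x \<in> A" for x
    using that pline_org_add[of x "smul a x" "smul b x"] smul_line a b A_in smul_0_right add_0_left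
    by (cases "x = org") auto
  show "add (smul a (add x y)) (smul b (add x y)) = add (add (smul a x) (smul b x)) (add (smul a y) (smul b y))"
    if "x \<in> A" "y \<in> A" for x y
    using that a b by (simp add: smul_add_right add_assoc add_left_commute[of "smul b x"])
qed (use assms in \<open>simp_all add: smul_line smul_add_right smul_uni\<close>)

lemma inverse_ex: assumes "a \<in> L" "a \<noteq> org" shows "\<exists>b\<in>L. b \<noteq> org \<and> smul b a = uni"
proof -
  have "uni \<in> pline org a" using pline_through(2)[of org uni a] assms A_in org_in unfolding L_def by auto
  then obtain \<delta> where \<delta>: "hom \<delta>" "\<delta> a = uni" using hom_ex[of a uni] assms by auto
  then show ?thesis using smul_hom[OF \<delta>(1), of a] assms by auto
qed

lemma smul_transitive:
  assumes "v \<in> A" "v \<noteq> org" "w \<in> A" "w \<in> pline org v"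
  shows "\<exists>a\<in>L. w = smul a v"
proof (cases "w = org")
  case True then show ?thesis using smul_0_left org_L by metis
next
  case False
  then obtain \<delta> where "hom \<delta>" "\<delta> v = w" using hom_ex assms by blast
  then show ?thesis using smul_hom[of \<delta> v] assms by metis
qed

lemma smul_eq_0: "\<lbrakk>a \<in> L; v \<in> A; smul a v = org\<rbrakk> \<Longrightarrow> a = org \<or> v = org"
  using smul_nz by blast

lemma smul_neg_left: "\<lbrakk>a \<in> L; v \<in> A\<rbrakk> \<Longrightarrow> smul (neg a) v = neg (smul a v)"
  using smul_add_left[of a "neg a" v] add_neg_right[of a] smul_0_left add_neg_right[of "smul a v"]
    add_cancel[of "smul a v" "smul (neg a) v" "neg (smul a v)"] by simp

lemma smul_neg_right: "\<lbrakk>a \<in> L; v \<in> A\<rbrakk> \<Longrightarrow> smul a (neg v) = neg (smul a v)"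
  using smul_add_right[of a v "neg v"] add_neg_right[of v] smul_0_right add_neg_right[of "smul a v"]
    add_cancel[of "smul a v" "smul a (neg v)" "neg (smul a v)"] by simp

lemma smul_cancel: "\<lbrakk>a \<in> L; b \<in> L; v \<in> A; v \<noteq> org; smul a v = smul b v\<rbrakk> \<Longrightarrow> a = b"
  using smul_add_left[of a "neg b" v] smul_neg_left[of b v] add_neg_right[of "smul b v"]
    smul_eq_0[of "add a (neg b)" v] add_cancel_right[of "neg b" a b] add_neg_right[of b] by simp

end

section \<open>The bilinear form\<close>

context projective_orthoset
begin

definition aut :: "('a \<Rightarrow> 'a) \<Rightarrow> bool" where
  "aut \<phi> \<longleftrightarrow> bij_betw \<phi> S S \<and> (\<forall>x\<in>S. \<forall>y\<in>S. x \<perp> y \<longleftrightarrow> \<phi> x \<perp> \<phi> y)"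

lemma aut_in: "\<lbrakk>aut \<phi>; x \<in> S\<rbrakk> \<Longrightarrow> \<phi> x \<in> S"
  unfolding aut_def by (meson bij_betwE)

lemma aut_orth: "\<lbrakk>aut \<phi>; x \<in> S; y \<in> S\<rbrakk> \<Longrightarrow> \<phi> x \<perp> \<phi> y \<longleftrightarrow> x \<perp> y"
  unfolding aut_def by blast

lemma aut_inj: "\<lbrakk>aut \<phi>; x \<in> S; y \<in> S; \<phi> x = \<phi> y\<rbrakk> \<Longrightarrow> x = y"
  unfolding aut_def by (meson bij_betw_imp_inj_on inj_onD)

lemma aut_surj: "\<lbrakk>aut \<phi>; y \<in> S\<rbrakk> \<Longrightarrow> \<exists>x\<in>S. \<phi> x = y"
  unfolding aut_def by (metis bij_betw_imp_surj_on imageE)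

lemma aut_pline:
  assumes \<phi>: "aut \<phi>" and e: "e \<in> S" "f \<in> S" and x: "x \<in> pline e f"
  shows "\<phi> x \<in> pline (\<phi> e) (\<phi> f)"
proof (rule plineI)
  show "\<phi> x \<in> S" using aut_in \<phi> x pline_in by blast
  fix z assume z: "z \<perp> \<phi> e" "z \<perp> \<phi> f"
  obtain y where y: "y \<in> S" "\<phi> y = z" using aut_surj[OF \<phi> orth_in[OF z(1)]] by blast
  have "y \<perp> e" "y \<perp> f" using aut_orth[OF \<phi> y(1)] e z y(2) by blast+
  then have "y \<perp> x" using plineD x by blast
  then show "z \<perp> \<phi> x" using aut_orth[OF \<phi> y(1) pline_in[OF x]] y by blast
qed

end

context framed_orthoset
begin

section \<open>Orthogonal decomposition of vectors\<close>

lemma orth_add: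
  assumes "d \<perp> org" "w \<in> A" "w' \<in> A" "w \<perp> d" "w' \<perp> d"
  shows "add w w' \<perp> d"
proof (cases "w' = org")
  case True then show ?thesis using assms add_0_right by simp
next
  case False
  then have "dir org w' \<perp> d" using plineD'[OF dir_pline[OF org_A assms(3)]] assms orth_sym[OF assms(1)] by auto
  then show ?thesis using plineD'[OF add_in_pline[OF assms(2,3) False]] assms by blast
qed

lemma orth_smul: "\<lbrakk>d \<perp> org; w \<in> A; w \<perp> d; a \<in> L\<rbrakk> \<Longrightarrow> smul a w \<perp> d"
  using plineD'[OF smul_line[of a w] orth_sym[of d org]] by blast

lemma neg_smul: "w \<in> A \<Longrightarrow> neg w = smul (neg uni) w"
  using smul_neg_left[of uni w] smul_1 by simp

lemma neg_add: "\<lbrakk>a \<in> A; b \<in> A\<rbrakk> \<Longrightarrow> neg (add a b) = add (neg a) (neg b)"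
  using neg_smul[of a] neg_smul[of b] neg_smul[of "add a b"] smul_add_right[of "neg uni" a b] by simp

lemma orth_neg: "\<lbrakk>d \<perp> org; w \<in> A; w \<perp> d\<rbrakk> \<Longrightarrow> neg w \<perp> d"
  using orth_smul[of d w "neg uni"] neg_smul[of w] by simp

lemma neg_neg: "x \<in> A \<Longrightarrow> neg (neg x) = x"
  using add_cancel[of "neg x" "neg (neg x)" x] add_neg_left add_neg_right by simp

lemma neg_eq_0: "x \<in> A \<Longrightarrow> neg x = org \<Longrightarrow> x = org"
  using add_neg_left[of x] add_0_left by simp

lemma add_neg_cancel: "\<lbrakk>x \<in> A; y \<in> A\<rbrakk> \<Longrightarrow> add x (add (neg x) y) = y"
  using add_assoc[of x "neg x" y] add_neg_right add_0_left by simp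

lemma eq_from_diff: "\<lbrakk>x \<in> A; y \<in> A; add x (neg y) = org\<rbrakk> \<Longrightarrow> x = y"
  using add_cancel_right[of "neg y" x y] add_neg_right by simp

lemma smul_cancel_left: "\<lbrakk>c \<in> L; c \<noteq> org; x \<in> A; y \<in> A; smul c x = smul c y\<rbrakk> \<Longrightarrow> x = y"
  using smul_add_right[of c x "neg y"] smul_neg_right[of c y] add_neg_right[of "smul c y"]
    smul_eq_0[of c "add x (neg y)"] eq_from_diff[of x y] by simp

lemma dir_line:
  assumes "v \<in> A" "v \<noteq> org" "x \<in> A" "y \<in> A" "x \<noteq> y" "x \<in> pline org v" "y \<in> pline org v"
  shows "dir x y = dir org v"
  using pline_eq[of org v x y] assms A_in org_in unfolding dir_def by auto

text \<open>\<open>m\<close> is the point where the line through \<open>w\<close> in the direction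
  of \<open>v\<close> meets the hyperplane orthogonal to this direction.\<close>

lemma decomp_ex:
  assumes v: "v \<in> A" "v \<noteq> org" and b: "b \<in> A" "b \<noteq> org" "b \<in> pline org v" and w: "w \<in> A"
  shows "\<exists>t\<in>L. \<exists>m\<in>A. m \<perp> dir org v \<and> w = add m (smul t b)"
proof -
  let ?d = "dir org v"
  have d: "?d \<perp> org" "?d \<in> S" using dir_orth dir_in v org_A by auto
  obtain m where m: "m \<in> pline w ?d" "m \<perp> ?d"
    using meet_hyperplane[of w ?d ?d] w A_in d A_neq_inf[OF w d(1)] by blast
  have mA: "m \<in> A"
    using inf_unique[OF w d(1) m(1)] m orth_irrefl pline_in unfolding A_def by auto
  show ?thesis
  proof (cases "m = w")
    case True
    then show ?thesis using m mA smul_0_left add_0_right by (intro bexI[of _ org] bexI[of _ m]) auto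
  next
    case False
    let ?x = "add (neg m) w"
    have "dir m w = ?d" using mem_pline_dir[of w m ?d] m w mA d False dir_commute by metis
    then have "dir org ?x = ?d" using dir_add[of "neg m" m w] add_neg_left mA w False by simp
    moreover have xn: "?x \<noteq> org" using add_neg_cancel[OF mA w] add_0_right mA False by auto
    moreover have xA: "?x \<in> A" using mA w by simp
    ultimately have "?x \<in> pline org v" using mem_pline_dir[of org ?x ?d] d org_A pline_dir[of org v] v by metis
    then have "?x \<in> pline org b" using pline_through(1)[of org v b] b v A_in org_in by auto
    then obtain t where "t \<in> L" "?x = smul t b" using smul_transitive[of b ?x] b xA by blast
    then show ?thesis using add_neg_cancel[OF mA w] m mA by metis
  qed
qed

lemma not_orth_own_dir: assumes "u \<in> A" "u \<noteq> org" shows "\<not> u \<perp> dir org u"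
proof
  assume "u \<perp> dir org u"
  then have "dir org u \<perp> dir org u"
    using plineD'[OF dir_pline[OF org_A assms(1)], of "dir org u"] orth_sym[OF dir_orth[OF org_A assms(1)]] assms by auto
  then show False using orth_irrefl by blast
qed

text \<open>Two decompositions with different coefficients would make a nonzero multiple of
  \<open>b\<close> orthogonal to its own direction.\<close>

lemma decomp_unique:
  assumes v: "v \<in> A" "v \<noteq> org" and b: "b \<in> A" "b \<noteq> org" "b \<in> pline org v" and t: "t \<in> L" "t' \<in> L"
    and m: "m \<in> A" "m' \<in> A" "m \<perp> dir org v" "m' \<perp> dir org v"
    and eq: "add m (smul t b) = add m' (smul t' b)"
  shows "t = t'"
proof (rule ccontr)
  assume ne: "t \<noteq> t'"
  let ?d = "dir org v" and ?u = "smul (add t' (neg t)) b"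
  have d: "?d \<perp> org" using dir_orth v org_A by auto
  have A: "smul t b \<in> A" "smul t' b \<in> A" using t b by auto
  have "add t' (neg t) \<noteq> org" using eq_from_diff[of t' t] t ne by auto
  then have u: "?u \<noteq> org" "dir org ?u = dir org b" "?u \<in> A" using smul_nz[of "add t' (neg t)" b] t b by auto
  have "dir org b = ?d" using dir_line[of v org b] v b org_in by auto
  moreover have "?u = add m (neg m')"
  proof -
    have "add m' ?u = add m' (add (smul t' b) (neg (smul t b)))"
      using smul_add_left[of t' "neg t" b] smul_neg_left[of t b] t b by simp
    also have "\<dots> = m" using add_assoc[of m' "smul t' b" "neg (smul t b)"] eq
        add_assoc[of m "smul t b" "neg (smul t b)"] add_neg_right[OF A(1)] add_0_right[OF m(1)] A m by simp
    also have "m = add m' (add m (neg m'))" using add_left_commute[of m' m "neg m'"] add_neg_right[of m'] add_0_right m by simp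
    finally show ?thesis using add_cancel[of m' ?u "add m (neg m')"] m u by simp
  qed
  then have "?u \<perp> ?d" using orth_add[OF d] orth_neg[OF d] m by simp
  ultimately show False using not_orth_own_dir[of ?u] u by simp
qed

section \<open>Orthogonality as a linear functional\<close>

text \<open>\<open>B v\<close> is the linear functional taking the value \<open>-1\<close> on the affine points orthogonal to \<open>v\<close>,
  that is, the form normalised by \<open>(org, org) = 1\<close> satisfies \<open>(org + v, org + w) = 1 + B v w\<close>.
  The vector \<open>nf v\<close> on the line of \<open>v\<close> has \<open>B v (nf v) = 1\<close>.\<close>

definition nf :: "'a \<Rightarrow> 'a" where "nf v = neg (SOME y. y \<in> pline org v \<and> y \<perp> v)"

lemma nf:
  assumes v: "v \<in> A" "v \<noteq> org"
  shows "nf v \<in> A" "nf v \<noteq> org" "nf v \<in> pline org v" "neg (nf v) \<perp> v"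
proof -
  define y where "y = (SOME y. y \<in> pline org v \<and> y \<perp> v)"
  have "\<exists>y. y \<in> pline org v \<and> y \<perp> v" using meet_hyperplane[of org v v] v A_in org_in by auto
  then have y: "y \<in> pline org v" "y \<perp> v" using someI_ex[of "\<lambda>y. y \<in> pline org v \<and> y \<perp> v"] unfolding y_def by auto
  have yA: "y \<in> A"
  proof (rule ccontr)
    assume "y \<notin> A"
    then have "y \<perp> org" using y pline_in unfolding A_def by blast
    then have "dir org v = y" using dirI[of org v y] v y org_A by auto
    then show False using not_orth_own_dir[OF v] y orth_sym by blast
  qed
  have yn: "y \<noteq> org" using y v orth_sym unfolding A_def by blast
  have n: "nf v = neg y" unfolding nf_def y_def ..
  show "nf v \<in> A" using n yA by simp
  show "nf v \<noteq> org" using n neg_eq_0 yA yn by auto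
  show "nf v \<in> pline org v" using n pline_org_neg[of v y] v yA y A_in by simp
  show "neg (nf v) \<perp> v" using n neg_neg yA y by simp
qed

definition B :: "'a \<Rightarrow> 'a \<Rightarrow> 'a" where
  "B v w = (if v = org then org else
     (THE t. t \<in> L \<and> (\<exists>m\<in>A. m \<perp> dir org v \<and> w = add m (smul t (nf v)))))"

lemma B_org [simp]: "B org w = org"
  by (simp add: B_def)

lemma B_ex1:
  assumes "v \<in> A" "v \<noteq> org" "w \<in> A"
  shows "\<exists>!t. t \<in> L \<and> (\<exists>m\<in>A. m \<perp> dir org v \<and> w = add m (smul t (nf v)))"
proof (rule ex_ex1I)
  show "\<exists>t. t \<in> L \<and> (\<exists>m\<in>A. m \<perp> dir org v \<and> w = add m (smul t (nf v)))"
    using decomp_ex[OF assms(1,2) nf(1-3)[OF assms(1,2)] assms(3)] by blast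
  fix t t' assume "t \<in> L \<and> (\<exists>m\<in>A. m \<perp> dir org v \<and> w = add m (smul t (nf v)))"
    "t' \<in> L \<and> (\<exists>m\<in>A. m \<perp> dir org v \<and> w = add m (smul t' (nf v)))"
  then show "t = t'" using decomp_unique[OF assms(1,2) nf(1-3)[OF assms(1,2)]] by metis
qed

lemma B_decomp:
  assumes "v \<in> A" "v \<noteq> org" "w \<in> A"
  obtains m where "m \<in> A" "m \<perp> dir org v" "w = add m (smul (B v w) (nf v))"
  using theI'[OF B_ex1[OF assms]] assms(2) unfolding B_def by auto

lemma B_L [simp]: "\<lbrakk>v \<in> A; w \<in> A\<rbrakk> \<Longrightarrow> B v w \<in> L"
  using theI'[OF B_ex1[of v w]] unfolding B_def by (cases "v = org") auto

lemma B_eq: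
  assumes v: "v \<in> A" "v \<noteq> org" and m: "m \<in> A" "m \<perp> dir org v" and t: "t \<in> L"
  shows "B v (add m (smul t (nf v))) = t"
proof -
  have "add m (smul t (nf v)) \<in> A" using m t nf(1)[OF v] by simp
  from the1_equality[OF B_ex1[OF v this], of t] show ?thesis using v m t unfolding B_def by auto
qed

lemma B_nf: "\<lbrakk>v \<in> A; v \<noteq> org\<rbrakk> \<Longrightarrow> B v (nf v) = uni"
  using B_eq[of v org uni] nf[of v] smul_1 add_0_left orth_sym[OF dir_orth[of org v]] by simp

lemma B_add_right:
  assumes "v \<in> A" "x \<in> A" "y \<in> A"
  shows "B v (add x y) = add (B v x) (B v y)"
proof (cases "v = org")
  case True then show ?thesis using add_0_left by simp
next
  case False
  note v = assms(1) False
  have d: "dir org v \<perp> org" using dir_orth org_A v by auto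
  obtain m where m: "m \<in> A" "m \<perp> dir org v" "x = add m (smul (B v x) (nf v))" using B_decomp[OF v assms(2)] .
  obtain n where n: "n \<in> A" "n \<perp> dir org v" "y = add n (smul (B v y) (nf v))" using B_decomp[OF v assms(3)] .
  let ?s = "smul (B v x) (nf v)" and ?t = "smul (B v y) (nf v)"
  have A: "?s \<in> A" "?t \<in> A" using assms nf(1)[OF v] by auto
  have "add x y = add (add m ?s) (add n ?t)" using m(3) n(3) by simp
  also have "\<dots> = add (add m n) (add ?s ?t)" 
    using m(1) n(1) A by (simp add: add_assoc add_left_commute[of ?s n])
  also have "add ?s ?t = smul (add (B v x) (B v y)) (nf v)" using smul_add_left assms nf(1)[OF v] by simp
  finally show ?thesis
    using B_eq[OF v, of "add m n" "add (B v x) (B v y)"] orth_add[OF d] m n assms by simp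
qed

lemma B_smul_right:
  assumes "v \<in> A" "x \<in> A" "a \<in> L"
  shows "B v (smul a x) = smul a (B v x)"
proof (cases "v = org")
  case True then show ?thesis using smul_0_right assms by simp
next
  case False
  note v = assms(1) False
  have d: "dir org v \<perp> org" using dir_orth org_A v by auto
  obtain m where m: "m \<in> A" "m \<perp> dir org v" "x = add m (smul (B v x) (nf v))" using B_decomp[OF v assms(2)] .
  have "smul a x = add (smul a m) (smul (smul a (B v x)) (nf v))"
    using m(3) smul_add_right[of a m "smul (B v x) (nf v)"] smul_smul[of a "B v x" "nf v"] assms m nf(1)[OF v] by simp
  then show ?thesis using B_eq[OF v, of "smul a m" "smul a (B v x)"] orth_smul[OF d] m assms by simp
qed

lemma B_zero:
  assumes v: "v \<in> A" "v \<noteq> org" and w: "w \<in> A"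
  shows "B v w = org \<longleftrightarrow> w \<perp> dir org v"
proof
  assume "B v w = org"
  then show "w \<perp> dir org v" using B_decomp[OF v w] smul_0_left add_0_right by metis
next
  assume "w \<perp> dir org v"
  then show "B v w = org" using B_eq[OF v w, of org] smul_0_left add_0_right w by simp
qed

lemma B_org_right [simp]: "v \<in> A \<Longrightarrow> B v org = org"
  using B_zero[of v org] orth_sym[OF dir_orth[of org v]] by (cases "v = org") auto

lemma B_zero_dir:
  assumes v: "v \<in> A" "v \<noteq> org" and w: "w \<in> A" "w \<noteq> org"
  shows "B v w = org \<longleftrightarrow> dir org w \<perp> dir org v"
proof -
  let ?d = "dir org v"
  have d: "org \<perp> ?d" using orth_sym dir_orth org_A v by auto
  have "w \<perp> ?d \<longleftrightarrow> dir org w \<perp> ?d"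
  proof
    show "dir org w \<perp> ?d" if "w \<perp> ?d" using plineD'[OF dir_pline[OF org_A w(1)] d that] w by auto
    have "w \<in> pline org (dir org w)" using pline_dir[OF org_A w(1)] w A_in by simp
    then show "w \<perp> ?d" if "dir org w \<perp> ?d" using plineD'[OF _ d that] by auto
  qed
  then show ?thesis using B_zero v w by simp
qed

lemma B_zero_sym: "\<lbrakk>v \<in> A; w \<in> A; B v w = org\<rbrakk> \<Longrightarrow> B w v = org"
  using B_zero_dir[of v w] B_zero_dir[of w v] orth_sym by (metis B_org B_org_right)

lemma B_self_nz: "\<lbrakk>v \<in> A; v \<noteq> org\<rbrakk> \<Longrightarrow> B v v \<noteq> org"
  using B_zero_dir orth_irrefl by blast

text \<open>The kernel of \<open>B v\<close>, shifted by \<open>- nf v\<close>, consists of points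
  orthogonal to \<open>v\<close>. Conversely, if \<open>w\<close> is orthogonal to \<open>v\<close>
  and differs from the shifted point \<open>m - nf v\<close>, the two points differ by a multiple of
  \<open>v\<close>; so the direction of \<open>v\<close> would be orthogonal to
  \<open>v\<close>.\<close>

lemma B_orth:
  assumes v: "v \<in> A" and w: "w \<in> A"
  shows "w \<perp> v \<longleftrightarrow> B v w = neg uni"
proof (cases "v = org")
  case True
  then show ?thesis using A_orth[OF w] neg_eq_0[of uni] by auto
next
  case False
  note v = v False
  let ?d = "dir org v" and ?y = "neg (nf v)"
  have d: "?d \<perp> org" using dir_orth org_A v by auto
  note nf = nf[OF v]
  have vd: "v \<in> pline org ?d" using pline_dir[OF org_A v(1)] v A_in by simp
  have yA: "?y \<in> A" using nf by simp
  have key: "add m ?y \<perp> v" if m: "m \<in> A" "m \<perp> ?d" for m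
  proof (cases "m = org")
    case True then show ?thesis using nf yA add_0_left by simp
  next
    case False
    have "dir org m \<perp> ?d" using plineD'[OF dir_pline[OF org_A m(1)] orth_sym[OF d] m(2)] False by auto
    moreover have "dir org m \<perp> org" using dir_orth org_A m False by auto
    ultimately have "dir org m \<perp> v" using plineD[OF vd] by blast
    then have "add ?y m \<perp> v" using plineD'[OF add_in_pline[OF yA m(1) False] nf(4)] by blast
    then show ?thesis using add_commute yA m by simp
  qed
  obtain m where m: "m \<in> A" "m \<perp> ?d" "w = add m (smul (B v w) (nf v))" using B_decomp[OF v w] .
  have eqy: "smul (neg uni) (nf v) = ?y" using neg_smul[OF nf(1)] by simp
  show ?thesis
  proof
    assume "B v w = neg uni"
    then show "w \<perp> v" using key[OF m(1,2)] m(3) eqy by simp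
  next
    assume wv: "w \<perp> v"
    have "w = add m ?y"
    proof (rule ccontr)
      assume ne: "w \<noteq> add m ?y"
      let ?x = "smul (B v w) (nf v)"
      have x: "?x \<in> A" "?x \<in> pline org v" "?x \<noteq> ?y"
        using m(3) ne nf smul_line[of "B v w" "nf v"] pline_subset[of org org v "nf v"] org_in v w by auto
      have "?y \<in> pline org v" using pline_org_neg[of v "nf v"] nf v A_in by auto
      then have "dir ?x ?y = ?d" using dir_line[OF v x(1) yA x(3,2)] by blast
      then have "dir w (add m ?y) = ?d" using dir_add[of m ?x ?y] m x yA by simp
      then have "?d \<in> pline w (add m ?y)" using dir_pline[OF w _ ne] m yA by simp
      then have "?d \<perp> v" using plineD' wv key[OF m(1,2)] by blast
      then show False using not_orth_own_dir[OF v] orth_sym by blast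
    qed
    then show "B v w = neg uni" using B_eq[OF v m(1,2), of "neg uni"] eqy by simp
  qed
qed

text \<open>A nonzero value \<open>B v w\<close> can be read off from the scalar \<open>k\<close>
  for which \<open>k w\<close> is orthogonal to \<open>v\<close>, namely
  \<open>k = - 1 / B v w\<close>. Equality of values is thus reduced to a statement about
  orthogonality.\<close>

lemma B_transfer:
  assumes A: "v \<in> A" "w \<in> A" "v' \<in> A" "w' \<in> A"
    and orth: "\<And>k. \<lbrakk>k \<in> L; smul k w \<perp> v\<rbrakk> \<Longrightarrow> smul k w' \<perp> v'" and nz: "B v w \<noteq> org"
  shows "B v' w' = B v w"
proof -
  obtain c where c: "c \<in> L" "c \<noteq> org" "smul c (B v w) = uni" using inverse_ex[of "B v w"] nz A by auto
  have nc: "neg c \<in> L" "neg c \<noteq> org" using c neg_eq_0[of c] by auto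
  have "smul (neg c) w \<perp> v" 
    using B_orth[of v "smul (neg c) w"] B_smul_right[of v w "neg c"] smul_neg_left[of c "B v w"] c nc A by simp
  then have "smul (neg c) w' \<perp> v'" using orth nc by blast
  then have "smul (neg c) (B v' w') = neg uni"
    using B_orth[of v' "smul (neg c) w'"] B_smul_right[of v' w' "neg c"] nc A by simp
  also have "\<dots> = smul (neg c) (B v w)" using smul_neg_left[of c "B v w"] c A by simp
  finally show ?thesis using smul_cancel_left[OF nc, of "B v' w'" "B v w"] A by simp
qed

text \<open>A multiple of \<open>w\<close> is still orthogonal to the point at infinity of the line
  \<open>v v'\<close>. If it is also orthogonal to one of \<open>v\<close>, \<open>v'\<close>, it is
  orthogonal to the whole line, so \<open>B_transfer\<close> applies in both directions.\<close>

lemma B_eq_on_dir_perp: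
  assumes A: "v \<in> A" "v' \<in> A" "w \<in> A" and ne: "v \<noteq> v'" and w: "w \<perp> dir v v'"
  shows "B v w = B v' w"
proof -
  have d: "dir v v' \<perp> org" using dir_orth A ne by blast
  have step: "smul k w \<perp> v'" if v: "v \<in> A" "v' \<in> A" "v \<noteq> v'" "w \<perp> dir v v'" and k: "k \<in> L" "smul k w \<perp> v" for v v' k
  proof -
    have "smul k w \<perp> dir v v'" using orth_smul[OF dir_orth[OF v(1-3)] A(3) v(4) k(1)] .
    moreover have "v' \<in> pline v (dir v v')" using mem_pline_dir[OF v(1-3) dir_orth[OF v(1-3)]] by simp
    ultimately show ?thesis using plineD k by blast
  qed
  show ?thesis
  proof (cases "B v w = org \<and> B v' w = org")
    case False
    then consider "B v w \<noteq> org" | "B v' w \<noteq> org" by blast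
    then show ?thesis
    proof cases
      case 1 then show ?thesis using B_transfer[of v w v' w] step[of v v'] A ne w by simp
    next
      case 2 then show ?thesis using B_transfer[of v' w v w] step[of v' v] A ne w dir_commute[of v v'] by simp
    qed
  qed simp
qed

text \<open>\<open>w\<close> differs from \<open>B v w\<close> times \<open>nf v\<close> by a vector
  that \<open>f\<close> kills. The constant stands on the right because \<open>f\<close> is left
  linear and the scalars are not yet known to commute.\<close>

lemma functional_proportional:
  assumes v: "v \<in> A" "v \<noteq> org" and w: "w \<in> A"
    and f: "\<And>x y. \<lbrakk>x \<in> A; y \<in> A\<rbrakk> \<Longrightarrow> f (add x y) = add (f x) (f y)"
      "\<And>a x. \<lbrakk>a \<in> L; x \<in> A\<rbrakk> \<Longrightarrow> f (smul a x) = smul a (f x)" "f (nf v) \<in> L"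
    and ker: "\<And>x. \<lbrakk>x \<in> A; x \<perp> dir org v\<rbrakk> \<Longrightarrow> f x = org"
  shows "f w = smul (B v w) (f (nf v))"
proof -
  obtain m where m: "m \<in> A" "m \<perp> dir org v" "w = add m (smul (B v w) (nf v))" using B_decomp[OF v w] .
  have "f w = add (f m) (f (smul (B v w) (nf v)))" using f(1)[of m] m nf(1)[OF v] v w by (metis B_L smul_closed)
  then show ?thesis using f(2)[of "B v w" "nf v"] f(3) ker[OF m(1,2)] add_0_left nf(1)[OF v] v w by simp
qed

text \<open>The partner \<open>g\<close> is orthogonal to the direction of \<open>v\<close> but not
  to that of \<open>v'\<close>. If \<open>g\<close> is at infinity, an affine point of the line
  \<open>org g\<close> has the same property; scaling then adjusts the value at
  \<open>v'\<close>.\<close>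

lemma separate:
  assumes i: "ind v v'"
  obtains w where "w \<in> A" "B v w = org" "B v' w = uni"
proof -
  have v: "v \<in> A" "v' \<in> A" "v \<noteq> org" "v' \<noteq> org" using i unfolding ind_def by auto
  let ?d = "dir org v" and ?e = "dir org v'"
  have de: "?d \<noteq> ?e" using ind_dir[OF v] i by blast
  have d: "?d \<perp> org" "?e \<perp> org" using dir_orth v org_A by auto
  obtain g where g: "g \<perp> ?d" "\<And>z. z \<perp> ?d \<and> z \<perp> ?e \<longleftrightarrow> z \<perp> ?d \<and> z \<perp> g"
    using orth_partner[OF orth_in[OF d(1)] orth_in[OF d(2)] de] by blast
  have ge: "\<not> g \<perp> ?e" using g(2)[of g] g(1) orth_irrefl by blast
  have "\<exists>t\<in>A. t \<perp> ?d \<and> \<not> t \<perp> ?e"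
  proof (cases "g \<in> A")
    case True then show ?thesis using g ge by blast
  next
    case False
    then have go: "g \<perp> org" using g orth_in unfolding A_def by blast
    have ng: "org \<noteq> g" "g \<in> S" using go orth_irrefl orth_in by blast+
    obtain t where t: "t \<in> pline org g" "t \<noteq> org" "t \<noteq> g" using third_point[of org g] org_in ng by blast
    have "t \<in> A" using inf_unique[OF org_A go t(1)] t pline_in unfolding A_def by blast
    moreover have "t \<perp> ?d" using plineD'[OF t(1)] d g orth_sym by blast
    moreover have "g \<in> pline org t" using pline_exchange[of org g t] t org_in ng by blast
    then have "\<not> t \<perp> ?e" using plineD'[of g org t ?e] d ge orth_sym by blast
    ultimately show ?thesis by blast
  qed
  then obtain t where t: "t \<in> A" "t \<perp> ?d" "\<not> t \<perp> ?e" by blast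
  have "B v' t \<noteq> org" using B_zero[of v' t] v t by auto
  then obtain c where c: "c \<in> L" "smul c (B v' t) = uni" using inverse_ex[of "B v' t"] v t by auto
  have "B v t = org" using B_zero[of v t] v t by auto
  then show ?thesis using that[of "smul c t"] B_smul_right v t c smul_0_right by simp
qed

text \<open>The line from \<open>v\<close> to \<open>v + v'\<close> has the direction of
  \<open>v'\<close>, so \<open>B (v + v') - B v\<close> vanishes on the kernel of
  \<open>B v'\<close> and is a multiple of \<open>B v'\<close>. In the same way
  \<open>B (v + v') - B v'\<close> is a multiple of \<open>B v\<close>; evaluation at a vector
  killed by \<open>B v\<close> shows that the first multiple is one.\<close>

lemma B_add_left_ind:
  assumes i: "ind v v'" and w: "w \<in> A"
  shows "B (add v v') w = add (B v w) (B v' w)"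
proof -
  have v: "v \<in> A" "v' \<in> A" "v \<noteq> org" "v' \<noteq> org" using i unfolding ind_def by auto
  let ?u = "add v v'"
  have ne: "v \<noteq> ?u" "dir v ?u = dir org v'" "v' \<noteq> ?u" "dir v' ?u = dir org v"
    using dir_add0[OF v(1,2,4)] dir_add0[OF v(2,1,3)] add_commute[OF v(1,2)] by metis+
  define f where "f w = add (B ?u w) (neg (B v w))" for w
  have fL: "f x \<in> L" if "x \<in> A" for x using that v unfolding f_def by simp
  have pro: "f w = smul (B v' w) (f (nf v'))" if w: "w \<in> A" for w
  proof (rule functional_proportional[OF v(2,4) w])
    show "f (nf v') \<in> L" using fL nf[OF v(2,4)] by simp
    show "f (add x y) = add (f x) (f y)" if "x \<in> A" "y \<in> A" for x y
      using that v B_add_right unfolding f_def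
      by (simp add: neg_add add_assoc add_left_commute[of "B ?u y"])
    show "f (smul a x) = smul a (f x)" if "a \<in> L" "x \<in> A" for a x
      using that v unfolding f_def by (simp add: B_smul_right smul_add_right smul_neg_right)
    show "f x = org" if x: "x \<in> A" "x \<perp> dir org v'" for x
      using B_eq_on_dir_perp[of v ?u x] ne v x add_neg_right[of "B v x"] unfolding f_def by simp
  qed
  have Bu: "B ?u w = add (B v w) (f w)" if w: "w \<in> A" for w
    using add_commute[of "B v w" "f w"] add_assoc[of "B ?u w" "neg (B v w)" "B v w"] add_neg_left[of "B v w"] add_0_right v w
    unfolding f_def by simp
  define f' where "f' w = add (B ?u w) (neg (B v' w))" for w
  have fL': "f' x \<in> L" if "x \<in> A" for x using that v unfolding f'_def by simp
  have pro': "f' w = smul (B v w) (f' (nf v))" if w: "w \<in> A" for w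
  proof (rule functional_proportional[OF v(1,3) w])
    show "f' (nf v) \<in> L" using fL' nf[OF v(1,3)] by simp
    show "f' (add x y) = add (f' x) (f' y)" if "x \<in> A" "y \<in> A" for x y
      using that v B_add_right unfolding f'_def
      by (simp add: neg_add add_assoc add_left_commute[of "B ?u y"])
    show "f' (smul a x) = smul a (f' x)" if "a \<in> L" "x \<in> A" for a x
      using that v unfolding f'_def by (simp add: B_smul_right smul_add_right smul_neg_right)
    show "f' x = org" if x: "x \<in> A" "x \<perp> dir org v" for x
      using B_eq_on_dir_perp[of v' ?u x] ne v x add_neg_right[of "B v' x"] unfolding f'_def by simp
  qed
  have Bu': "B ?u w = add (B v' w) (f' w)" if w: "w \<in> A" for w
    using add_commute[of "B v' w" "f' w"] add_assoc[of "B ?u w" "neg (B v' w)" "B v' w"] add_neg_left[of "B v' w"] add_0_right v w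
    unfolding f'_def by simp
  obtain x where x: "x \<in> A" "B v x = org" "B v' x = uni" using separate[OF i] .
  have "f x = uni"
    using Bu[OF x(1)] Bu'[OF x(1)] pro'[OF x(1)] x smul_0_left add_0_left add_0_right fL[OF x(1)] by simp
  then have "f (nf v') = uni" using pro[OF x(1)] x smul_1 fL nf[OF v(2,4)] by simp
  then show ?thesis using Bu[OF w] pro[OF w] smul_uni v w by simp
qed

lemma B_add_left:
  assumes "v \<in> A" "v' \<in> A" "w \<in> A"
  shows "B (add v v') w = add (B v w) (B v' w)"
  using additive_from_ind[of "\<lambda>v. B v w" v v'] B_add_left_ind assms by simp

section \<open>Scalars in the left argument\<close>

definition th :: "'a \<Rightarrow> 'a \<Rightarrow> 'a" where "th v k = B (smul k v) (nf v)"

lemma th_L: "\<lbrakk>v \<in> A; v \<noteq> org; k \<in> L\<rbrakk> \<Longrightarrow> th v k \<in> L"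
  using nf(1) unfolding th_def by simp

text \<open>\<open>B (k v)\<close> and \<open>B v\<close> have the same kernel for nonzero
  \<open>k\<close>, hence are proportional, and \<open>th v k\<close> is the value at
  \<open>nf v\<close>, where \<open>B v\<close> is one. For a sesquilinear form this is the
  conjugate of \<open>k\<close>.\<close>

lemma B_smul_left_th:
  assumes v: "v \<in> A" "v \<noteq> org" and k: "k \<in> L" and w: "w \<in> A"
  shows "B (smul k v) w = smul (B v w) (th v k)"
proof (cases "k = org")
  case True
  then show ?thesis unfolding th_def using smul_0_left smul_0_right v w by simp
next
  case False
  note s = smul_nz[OF k v(1) False v(2)]
  show ?thesis unfolding th_def
    by (rule functional_proportional[OF v w])
      (use v k nf(1)[OF v] s B_zero[of "smul k v"] in \<open>simp_all add: B_add_right B_smul_right\<close>)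
qed

lemma th_ind:
  assumes i: "ind v v'" and k: "k \<in> L"
  shows "th (add v v') k = th v' k"
proof -
  have v: "v \<in> A" "v' \<in> A" "v \<noteq> org" "v' \<noteq> org" using i unfolding ind_def by auto
  obtain x where x: "x \<in> A" "B v x = org" "B v' x = uni" using separate[OF i] .
  have u: "add v v' \<noteq> org" using ind_add[OF i v(1)] A_in v unfolding ind_def by auto
  have "B (smul k (add v v')) x = add (B (smul k v) x) (B (smul k v') x)"
    using smul_add_right B_add_left v k x by simp
  then show ?thesis
    using B_smul_left_th[of v k x] B_smul_left_th[of v' k x] B_smul_left_th[of "add v v'" k x]
      B_add_left[of v v' x] u v k x smul_0_left smul_1 add_0_left th_L by simp
qed

text \<open>Independent vectors both share the factor of their sum; dependent ones are compared
  through a vector independent of both.\<close>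

lemma th_const:
  assumes "v \<in> A" "v \<noteq> org" "v' \<in> A" "v' \<noteq> org" "k \<in> L"
  shows "th v k = th v' k"
proof -
  have main: "th x k = th y k" if "ind x y" for x y
    using th_ind[OF that assms(5)] th_ind[OF ind_sym[OF that] assms(5)] add_commute[of x y] that unfolding ind_def by simp
  show ?thesis
  proof (cases "ind v v'")
    case True then show ?thesis using main by blast
  next
    case False
    obtain z where z: "ind v z" using ind_ex assms by blast
    have "v' \<in> pline org v" using False assms unfolding ind_def by blast
    then have "ind v' z" using ind_line[OF z] assms by blast
    then show ?thesis using main[OF z] main[of v' z] by simp
  qed
qed

text \<open>The factor of \<open>k\<close>, acting on the vector \<open>l uni\<close>, is written to
  the right of the factor of \<open>l\<close>. So \<open>th uni\<close> reverses products.\<close>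

lemma th_mult:
  assumes k: "k \<in> L" "l \<in> L"
  shows "th uni (smul k l) = smul (th uni l) (th uni k)"
proof (cases "l = org")
  case True
  then show ?thesis using k smul_0_right[OF k(1)] smul_0_left nf(1)[of uni] unfolding th_def by simp
next
  case False
  have n: "nf uni \<in> A" "B uni (nf uni) = uni" using nf(1) B_nf by auto
  have s: "smul l uni \<in> A" "smul l uni \<noteq> org" using smul_nz[of l uni] k False by auto
  have "B (smul (smul k l) uni) (nf uni) = smul (B (smul l uni) (nf uni)) (th (smul l uni) k)"
    using B_smul_left_th[OF s k(1) n(1)] smul_smul[of k l uni] k by simp
  then show ?thesis using th_const[OF s _ _ k(1), of uni] unfolding th_def by simp
qed

lemma th_1: "th uni uni = uni"
  using B_nf[of uni] smul_1 unfolding th_def by simp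

section \<open>Automorphisms fixing the origin\<close>

lemma aut_A: "\<lbrakk>aut \<phi>; \<phi> org = org; x \<in> A\<rbrakk> \<Longrightarrow> \<phi> x \<in> A"
  using aut_in aut_orth[of \<phi> x org] org_in unfolding A_def by auto

lemma aut_dir:
  assumes \<phi>: "aut \<phi>" "\<phi> org = org" and x: "x \<in> A" "y \<in> A" "x \<noteq> y"
  shows "dir (\<phi> x) (\<phi> y) = \<phi> (dir x y)"
proof (rule dirI)
  show "\<phi> x \<in> A" "\<phi> y \<in> A" using aut_A \<phi> x by blast+
  show "\<phi> x \<noteq> \<phi> y" using aut_inj[OF \<phi>(1)] x A_in by blast
  show "\<phi> (dir x y) \<in> pline (\<phi> x) (\<phi> y)" using aut_pline[OF \<phi>(1)] dir_pline x A_in by blast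
  show "\<phi> (dir x y) \<perp> org" using aut_orth[OF \<phi>(1) dir_in[OF x] org_in] dir_orth[OF x] \<phi> by simp
qed

lemma aut_nz: "\<lbrakk>aut \<phi>; \<phi> org = org; x \<in> A; x \<noteq> org\<rbrakk> \<Longrightarrow> \<phi> x \<noteq> org"
  using aut_inj[of \<phi> x org] org_in A_in by metis

lemma aut_ind:
  assumes \<phi>: "aut \<phi>" "\<phi> org = org" and i: "ind x y"
  shows "ind (\<phi> x) (\<phi> y)"
proof -
  have v: "x \<in> A" "y \<in> A" "x \<noteq> org" "y \<noteq> org" using i unfolding ind_def by auto
  have "dir org (\<phi> x) \<noteq> dir org (\<phi> y)"
    using aut_dir[OF \<phi> org_A v(1)] aut_dir[OF \<phi> org_A v(2)] \<phi> v ind_dir[OF v] i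
      aut_inj[OF \<phi>(1), of "dir org x" "dir org y"] dir_in[OF org_A] by metis
  then show ?thesis using ind_dir aut_A[OF \<phi>] aut_nz[OF \<phi>] v by blast
qed

lemma aut_add:
  assumes \<phi>: "aut \<phi>" "\<phi> org = org" and x: "x \<in> A" "y \<in> A"
  shows "\<phi> (add x y) = add (\<phi> x) (\<phi> y)"
proof (rule additive_from_ind[where f = \<phi>, OF _ \<phi>(2) _ x])
  show "\<phi> x \<in> A" if "x \<in> A" for x using aut_A \<phi> that by blast
  fix x y assume i: "ind x y"
  have v: "x \<in> A" "y \<in> A" "x \<noteq> org" "y \<noteq> org" using i unfolding ind_def by auto
  have d: "dir org x \<in> S" "dir org y \<in> S" using dir_in org_A v by metis+
  have "\<phi> (add x y) \<in> pline (\<phi> x) (\<phi> (dir org y))" "\<phi> (add x y) \<in> pline (\<phi> y) (\<phi> (dir org x))"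
    using aut_pline[OF \<phi>(1) _ d(2) add_in_pline[OF v(1,2,4)]] aut_pline[OF \<phi>(1) _ d(1) add_in_pline[OF v(2,1,3)]]
      add_commute[OF v(1,2)] A_in v by auto
  moreover have "\<phi> (dir org x) = dir org (\<phi> x)" "\<phi> (dir org y) = dir org (\<phi> y)"
    using aut_dir[OF \<phi> org_A v(1)] aut_dir[OF \<phi> org_A v(2)] \<phi> v by auto
  ultimately show "\<phi> (add x y) = add (\<phi> x) (\<phi> y)"
    using add_parallelogram[OF aut_ind[OF \<phi> i]] aut_A[OF \<phi>] v by simp
qed

text \<open>An automorphism fixing \<open>org\<close> could be merely semilinear; a line through
  \<open>org\<close> that is fixed pointwise makes it linear. Both sides are additive, lie on the
  line of \<open>\<phi> x\<close> and agree at \<open>p\<close>.\<close>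

lemma aut_smul:
  assumes \<phi>: "aut \<phi>" "\<phi> org = org" and p: "p \<in> A" "p \<noteq> org" "\<And>x. x \<in> pline org p \<Longrightarrow> \<phi> x = x"
    and k: "k \<in> L" and x: "x \<in> A"
  shows "\<phi> (smul k x) = smul k (\<phi> x)"
proof (rule additive_line_eq[where f = "\<lambda>x. \<phi> (smul k x)" and g = "\<lambda>x. smul k (\<phi> x)" and \<phi> = \<phi> and p = p])
  show "\<phi> (smul k x) \<in> pline org (\<phi> x)" if "x \<in> A" for x
    using aut_pline[OF \<phi>(1) org_in A_in[OF that] smul_line[OF k that]] \<phi> by simp
  show "\<phi> (smul k p) = smul k (\<phi> p)" using p smul_line[of k p] k A_in by simp
  show "ind (\<phi> x) (\<phi> y)" if "ind x y" for x y using aut_ind \<phi> that by blast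
qed (use p x k in \<open>simp_all add: aut_A[OF \<phi>] aut_add[OF \<phi>] smul_add_right smul_line\<close>)

text \<open>Linearity and invariance of orthogonality give the hypothesis of
  \<open>B_transfer\<close>. The value zero is expressed by orthogonality of directions
  instead.\<close>

lemma aut_B:
  assumes \<phi>: "aut \<phi>" "\<phi> org = org" and p: "p \<in> A" "p \<noteq> org" "\<And>x. x \<in> pline org p \<Longrightarrow> \<phi> x = x"
    and v: "v \<in> A" and w: "w \<in> A"
  shows "B (\<phi> v) (\<phi> w) = B v w"
proof (cases "B v w = org")
  case False
  show ?thesis
  proof (rule B_transfer[OF v w aut_A[OF \<phi> v] aut_A[OF \<phi> w] _ False])
    show "smul k (\<phi> w) \<perp> \<phi> v" if "k \<in> L" "smul k w \<perp> v" for k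
      using aut_smul[OF \<phi> p that(1) w] aut_orth[OF \<phi>(1), of "smul k w" v] that v w A_in by simp
  qed
next
  case True
  show ?thesis
  proof (cases "v = org \<or> w = org")
    case True then show ?thesis using \<phi>(2) v w aut_A[OF \<phi> v] by (elim disjE) simp_all
  next
    case False
    then have "\<phi> (dir org w) \<perp> \<phi> (dir org v)"
      using True B_zero_dir[of v w] v w aut_orth[OF \<phi>(1)] dir_in[OF org_A v] dir_in[OF org_A w] by metis
    moreover have "\<phi> (dir org v) = dir org (\<phi> v)" "\<phi> (dir org w) = dir org (\<phi> w)"
      using aut_dir[OF \<phi> org_A v] aut_dir[OF \<phi> org_A w] \<phi> False by auto
    ultimately show ?thesis
      using B_zero_dir[of "\<phi> v" "\<phi> w"] aut_A[OF \<phi>] aut_nz[OF \<phi>] v w False True by auto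
  qed
qed

lemma affine_point: "i \<perp> org \<Longrightarrow> \<exists>u\<in>A. u \<noteq> org \<and> dir org u = i"
proof -
  assume i: "i \<perp> org"
  have ni: "org \<noteq> i" "i \<in> S" using i orth_irrefl orth_in by blast+
  obtain t where t: "t \<in> pline org i" "t \<noteq> org" "t \<noteq> i" using third_point[of org i] org_in ni by blast
  have "t \<in> A" using inf_unique[OF org_A i t(1)] t pline_in unfolding A_def by blast
  then show ?thesis using mem_pline_dir[of org t i] t i org_A by blast
qed

text \<open>It suffices to test with points \<open>z\<close> orthogonal to \<open>org\<close>, for
  which orthogonality passes from the summands to the sum and to its direction; an affine
  \<open>z\<close> is replaced by its own direction. The lemma tells that \<open>u + k J u\<close>
  points into the plane of the quarter turn.\<close>

lemma dir_sum_in_pline: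
  assumes e: "e \<perp> org" "f \<perp> org" and u: "u \<in> A" "u \<in> pline org e" and v: "v \<in> A" "v \<in> pline org f" 
    and n: "add u v \<noteq> org"
  shows "dir org (add u v) \<in> pline e f"
proof -
  let ?x = "add u v" and ?d = "dir org (add u v)"
  have xA: "?x \<in> A" using u v by simp
  have d: "?d \<perp> org" "?d \<in> pline org ?x" using dir_orth[OF org_A xA] dir_pline[OF org_A xA] n by auto
  have main: "z \<perp> ?d" if z: "z \<perp> e" "z \<perp> f" "z \<perp> org" for z
  proof -
    have "?x \<perp> z" using orth_add[OF z(3) u(1) v(1)] plineD[OF u(2)] plineD[OF v(2)] z orth_sym by blast
    then show ?thesis using plineD[OF d(2) z(3)] orth_sym by blast
  qed
  show ?thesis
  proof (rule plineI)
    show "?d \<in> S" using d orth_in by blast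
    fix z assume z: "z \<perp> e" "z \<perp> f"
    show "z \<perp> ?d"
    proof (cases "z = org \<or> z \<perp> org")
      case True then show ?thesis using main[OF z] d orth_sym by blast
    next
      case False
      then have zA: "z \<in> A" "z \<noteq> org" using z orth_in unfolding A_def by blast+
      have z': "dir org z \<in> pline org z" "dir org z \<perp> org" using dir_pline[OF org_A zA(1)] dir_orth[OF org_A zA(1)] zA by auto
      have "dir org z \<perp> e" "dir org z \<perp> f" using plineD'[OF z'(1)] z e orth_sym by blast+
      then have "?d \<perp> dir org z" using main z' orth_sym by blast
      moreover have "z \<in> pline org (dir org z)" using pline_dir[OF org_A zA(1)] zA A_in by simp
      ultimately show ?thesis using plineD[of z org "dir org z" ?d] d orth_sym by blast
    qed
  qed
qed

end

section \<open>Commutativity of the scalars and symmetry of the form\<close>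

locale turning_orthoset = framed_orthoset +
  assumes quarter_turn: "e \<perp> f \<Longrightarrow>
    \<exists>J. aut J \<and> (\<forall>z. z \<perp> e \<and> z \<perp> f \<longrightarrow> J z = z) \<and> J e = f \<and> (\<forall>y\<in>pline e f. J y \<perp> y)"
begin

text \<open>If \<open>J\<close> is a quarter turn, \<open>u + k J u\<close> is orthogonal to \<open>J u + k J\<^sup>2 u\<close>. This forces the
  antiautomorphism \<open>th uni\<close> of the scalars to be inner, hence also an automorphism.\<close>

lemma th_conj: "\<exists>n\<in>L. n \<noteq> org \<and> add n n \<noteq> org \<and> (\<forall>k\<in>L. smul n (th uni k) = smul k n)"
proof -
  obtain e f g where efg: "e \<perp> org" "f \<perp> org" "g \<perp> org" "e \<perp> f" "e \<perp> g" "f \<perp> g"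
    using frame_at[OF org_in] by blast
  obtain J where J: "aut J" "\<And>z. \<lbrakk>z \<perp> e; z \<perp> f\<rbrakk> \<Longrightarrow> J z = z" "J e = f" "\<And>y. y \<in> pline e f \<Longrightarrow> J y \<perp> y"
    using quarter_turn[OF efg(4)] by blast
  have Jo: "J org = org" using J(2)[of org] efg orth_sym by blast
  obtain u where u: "u \<in> A" "u \<noteq> org" "dir org u = e" using affine_point[OF efg(1)] by blast
  obtain p where p: "p \<in> A" "p \<noteq> org" "dir org p = g" using affine_point[OF efg(3)] by blast
  have efS: "e \<in> S" "f \<in> S" using efg orth_in by blast+
  have pfix: "J x = x" if "x \<in> pline org p" for x
  proof -
    have "x \<in> pline org g" using that pline_dir[OF org_A p(1)] p by simp
    then show ?thesis using J(2)[of x] plineD' efg orth_sym by blast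
  qed
  have lin: "J (smul k x) = smul k (J x)" if "k \<in> L" "x \<in> A" for k x
    by (rule aut_smul[OF J(1) Jo p(1,2)]) (use pfix that in auto)
  have iso: "B (J x) (J y) = B x y" if "x \<in> A" "y \<in> A" for x y
    by (rule aut_B[OF J(1) Jo p(1,2)]) (use pfix that in auto)
  let ?v = "J u"
  have v: "?v \<in> A" "?v \<noteq> org" "dir org ?v = f"
    using aut_A[OF J(1) Jo u(1)] aut_nz[OF J(1) Jo u(1)] aut_dir[OF J(1) Jo org_A u(1)] Jo J(3) u by auto
  have Jf: "J f = e"
  proof (rule orth_partner_unique[of f e])
    show "f \<perp> e" using efg orth_sym by blast
    show "J f \<perp> f" using J(4)[of f] efS by simp
    have "z \<perp> J f" if "z \<perp> e" "z \<perp> f" for z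
      using aut_orth[OF J(1), of z f] J(2)[OF that] that efS orth_in by metis
    then show "J f \<in> pline f e" using aut_in[OF J(1) efS(2)] by (intro plineI) auto
  qed
  let ?w = "J ?v"
  have w: "?w \<in> A" "?w \<noteq> org" "dir org ?w = e"
    using aut_A[OF J(1) Jo v(1)] aut_nz[OF J(1) Jo v(1)] aut_dir[OF J(1) Jo org_A v(1)] Jo Jf v by auto
  have "?w \<in> pline org u" using mem_pline_dir[OF org_A w(1) w(2)[symmetric] efg(1)] w pline_dir[OF org_A u(1)] u by auto
  \<comment> \<open>\<open>J\<close> need not be known to have order four: its square acts on
    \<open>u\<close> by some scalar \<open>l\<close>, which is eliminated at the end.\<close>
  then obtain l where l: "l \<in> L" "?w = smul l u" using smul_transitive[OF u(1,2) w(1)] by blast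
  define n where "n = B u u"
  have n: "n \<in> L" "n \<noteq> org" using B_self_nz u unfolding n_def by auto
  have Bvv: "B ?v ?v = n" using iso[OF u(1) u(1)] n_def by simp
  have Buv: "B u ?v = org" "B ?v u = org"
    using B_zero_dir[OF u(1,2) v(1,2)] B_zero_dir[OF v(1,2) u(1,2)] u v efg orth_sym by auto
  have iuv: "ind ?v u" using ind_dir[OF v(1) u(1) v(2) u(2)] u v efg orth_irrefl by auto
  \<comment> \<open>The expansion of \<open>B (u + k J u) (J u + k l u) = 0\<close>, where
    \<open>u\<close> and \<open>J u\<close> are orthogonal and have the same norm
    \<open>n\<close>.\<close>
  have main: "add (smul (smul k l) n) (smul n (th uni k)) = org" if k: "k \<in> L" for k
  proof -
    let ?kv = "smul k ?v"
    let ?x = "add u ?kv" and ?y = "add ?v (smul (smul k l) u)"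
    have A: "?kv \<in> A" "?x \<in> A" "smul (smul k l) u \<in> A" using k l u v by auto
    have kl: "smul k l \<in> L" using k l by simp
    have xn: "?x \<noteq> org"
      using ind_add[OF iuv A(1) smul_line[OF k v(1)]] add_commute[OF u(1) A(1)] unfolding ind_def by auto
    have "u \<in> pline org e" "?v \<in> pline org f" using pline_dir[OF org_A u(1)] pline_dir[OF org_A v(1)] u v A_in by auto
    then have "?kv \<in> pline org f" using smul_line[OF k v(1)] pline_subset[of org org f ?v] org_in by auto
    then have dx: "dir org ?x \<in> pline e f"
      using dir_sum_in_pline[OF efg(1,2) u(1) \<open>u \<in> pline org e\<close> A(1) _ xn] by blast
    have Jx: "J ?x = ?y"
      using aut_add[OF J(1) Jo u(1) A(1)] lin[OF k v(1)] l smul_smul[OF k l(1) u(1)] by simp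
    have yA: "?y \<in> A" using A v by simp
    have "B ?x ?y = org"
    proof (cases "?y = org")
      case True then show ?thesis using A by simp
    next
      case False
      have "dir org ?y = J (dir org ?x)" using aut_dir[OF J(1) Jo org_A A(2)] Jo Jx xn by auto
      then have "dir org ?y \<perp> dir org ?x" using J(4)[OF dx] by simp
      then show ?thesis using B_zero_dir[OF A(2) xn yA False] by blast
    qed
    moreover have "B ?x ?y = add (B u ?y) (B ?kv ?y)" using B_add_left[OF u(1) A(1) yA] .
    moreover have "B u ?y = smul (smul k l) n"
      using B_add_right[OF u(1) v(1) A(3)] B_smul_right[OF u(1) u(1) kl] Buv add_0_left[of "smul (smul k l) n"] n kl
      unfolding n_def by simp
    moreover have "B ?v ?y = n"
      using B_add_right[OF v(1) v(1) A(3)] B_smul_right[OF v(1) u(1) kl] Buv Bvv smul_0_right[OF kl] add_0_right n by simp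
    then have "B ?kv ?y = smul n (th uni k)"
      using B_smul_left_th[OF v(1,2) k yA] th_const[OF v(1,2) uni_A uni_nz k] by simp
    ultimately show ?thesis by simp
  qed
  \<comment> \<open>The case \<open>k = uni\<close> of \<open>main\<close> removes the unknown
    \<open>l\<close>.\<close>
  have "smul l n = neg n"
    using main[of uni] th_1 smul_1[of l] smul_uni[OF n(1)] l add_cancel_right[of n "smul l n" "neg n"] add_neg_left[of n] n by simp
  then have "smul (smul k l) n = neg (smul k n)" if "k \<in> L" for k
    using smul_smul[of k l n] smul_neg_right[of k n] that l n by simp
  then have "smul n (th uni k) = smul k n" if k: "k \<in> L" for k
    using main[OF k] k n th_L[of uni k] add_cancel[of "neg (smul k n)" "smul n (th uni k)" "smul k n"]
      add_neg_left[of "smul k n"] by simp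
  \<comment> \<open>The sum is the form value of the nonzero vector \<open>u + J u\<close>. It will
    show that the characteristic is not two.\<close>
  moreover have "add n n \<noteq> org"
  proof -
    have A: "add u ?v \<in> A" using u v by simp
    have "B u (add u ?v) = n" "B ?v (add u ?v) = n"
      using B_add_right[OF u(1) u(1) v(1)] B_add_right[OF v(1) u(1) v(1)] Buv Bvv add_0_left add_0_right n
      unfolding n_def by simp_all
    then have "B (add u ?v) (add u ?v) = add n n" using B_add_left[OF u(1) v(1) A] by simp
    moreover have "add u ?v \<noteq> org"
      using ind_add[OF iuv v(1)] add_commute[OF u(1) v(1)] v A_in unfolding ind_def by auto
    ultimately show ?thesis using B_self_nz[OF A] by simp
  qed
  ultimately show ?thesis using n by blast
qed

lemma char_not_2: "add uni uni \<noteq> org"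
proof -
  obtain n where n: "n \<in> L" "add n n \<noteq> org" using th_conj by blast
  then show ?thesis using smul_add_left[of uni uni n] smul_1[of n] smul_0_left[of n] by auto
qed

lemma smul_commute:
  assumes "a \<in> L" "b \<in> L" shows "smul a b = smul b a"
proof -
  obtain n where n: "n \<in> L" "n \<noteq> org" "\<And>k. k \<in> L \<Longrightarrow> smul n (th uni k) = smul k n" using th_conj by blast
  have t: "th uni a \<in> L" "th uni b \<in> L" using th_L assms by auto
  have "smul (smul b a) n = smul n (th uni (smul b a))" using n assms by simp
  also have "\<dots> = smul (smul n (th uni a)) (th uni b)"
    using th_mult[of b a] smul_smul[of n "th uni a" "th uni b"] assms n t by simp
  also have "\<dots> = smul (smul a n) (th uni b)" using n(3)[OF assms(1)] by simp
  also have "\<dots> = smul (smul a b) n" using smul_smul[of a n "th uni b"] n assms t smul_smul[of a b n] by simp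
  finally show ?thesis using smul_cancel[of "smul a b" "smul b a" n] n assms by simp
qed

lemma B_smul_left:
  assumes "v \<in> A" "w \<in> A" "k \<in> L" shows "B (smul k v) w = smul k (B v w)"
proof (cases "v = org")
  case True then show ?thesis using smul_0_right assms by simp
next
  case False
  obtain n where n: "n \<in> L" "n \<noteq> org" "\<And>k. k \<in> L \<Longrightarrow> smul n (th uni k) = smul k n" using th_conj by blast
  have t: "th uni k \<in> L" using th_L assms by auto
  have "smul (th uni k) n = smul k n" using n(3)[OF assms(3)] smul_commute[OF n(1) t] by simp
  then have "th uni k = k" using smul_cancel[OF t assms(3) _ n(2)] n by simp
  then have "th v k = k" using th_const[OF assms(1) False uni_A uni_nz assms(3)] by simp
  then show ?thesis using B_smul_left_th[OF assms(1) False assms(3,2)] smul_commute[of k "B v w"] assms by simp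
qed

lemma B_sym:
  assumes "v \<in> A" "w \<in> A" shows "B v w = B w v"
proof (cases "B v w = org")
  case True then show ?thesis using B_zero_sym assms by simp
next
  case False
  show ?thesis
  proof (rule B_transfer[OF assms assms(2,1) _ False, symmetric])
    fix k assume k: "k \<in> L" "smul k w \<perp> v"
    then have "B (smul k w) v = neg uni" using B_orth[of "smul k w" v] assms orth_sym by simp
    then have "B w (smul k v) = neg uni" using B_smul_left[of w v k] B_smul_right[of w v k] k assms by simp
    then show "smul k v \<perp> w" using B_orth[of w "smul k v"] k assms by simp
  qed
qed

end

section \<open>Archimedean ordered fields\<close>

definition (in ring) cone :: "'a set \<Rightarrow> bool" where
  "cone P \<longleftrightarrow> P \<subseteq> carrier R \<and> (\<forall>a\<in>P. \<forall>b\<in>P. a \<oplus> b \<in> P \<and> a \<otimes> b \<in> P) \<and>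
     (\<forall>a\<in>carrier R. a \<otimes> a \<in> P) \<and> \<ominus> \<one> \<notin> P"

context field
begin

text \<open>The hypothesis says that \<open>1 + a^2\<close> is a nonzero square, which excludes
  \<open>-1\<close> as a square. Sums reduce to it by
  \<open>a^2 + b^2 = a^2 (1 + (b/a)^2)\<close>.\<close>

lemma pythagorean_squares_cone:
  assumes pyth: "\<And>a. a \<in> carrier R \<Longrightarrow> \<exists>b\<in>carrier R. b \<otimes> b \<otimes> (\<one> \<oplus> a \<otimes> a) = \<one>"
  shows "cone {a \<otimes> a | a. a \<in> carrier R}"
proof -
  let ?Q = "{a \<otimes> a | a. a \<in> carrier R}"
  have add: "\<exists>c\<in>carrier R. a \<otimes> a \<oplus> b \<otimes> b = c \<otimes> c" if ab: "a \<in> carrier R" "b \<in> carrier R" for a b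
  proof (cases "a = \<zero>")
    case True then show ?thesis using ab by (intro bexI[of _ b]) auto
  next
    case False
    then have ia: "inv a \<in> carrier R" "a \<otimes> inv a = \<one>" using ab field_Units by auto
    obtain c where c: "c \<in> carrier R" "c \<otimes> c \<otimes> (\<one> \<oplus> (inv a \<otimes> b) \<otimes> (inv a \<otimes> b)) = \<one>"
      using pyth[of "inv a \<otimes> b"] ia ab by auto
    have "c \<noteq> \<zero>" using c ab ia by auto
    then have ic: "inv c \<in> carrier R" "c \<otimes> inv c = \<one>" using c field_Units by auto
    let ?x = "a \<otimes> inv c" and ?s = "\<one> \<oplus> (inv a \<otimes> b) \<otimes> (inv a \<otimes> b)"
    have s: "?s \<in> carrier R" using ia ab by simp
    have "?x \<otimes> ?x = a \<otimes> a \<otimes> (inv c \<otimes> inv c) \<otimes> (c \<otimes> c \<otimes> ?s)" using c(2) ab ic by (simp add: m_ac)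
    also have "\<dots> = a \<otimes> a \<otimes> ((c \<otimes> inv c) \<otimes> (c \<otimes> inv c)) \<otimes> ?s" using ab c(1) ic(1) s by (simp add: m_ac)
    also have "\<dots> = a \<otimes> a \<otimes> ?s" using ab ic s by simp
    also have "\<dots> = a \<otimes> a \<oplus> (a \<otimes> inv a) \<otimes> (a \<otimes> inv a) \<otimes> (b \<otimes> b)"
      using ab ia(1) by (simp add: r_distr m_ac)
    also have "\<dots> = a \<otimes> a \<oplus> b \<otimes> b" using ab ia by simp
    finally show ?thesis using ab ic by (intro bexI[of _ ?x]) auto
  qed
  have "\<ominus> \<one> \<noteq> a \<otimes> a" if a: "a \<in> carrier R" for a
  proof
    assume "\<ominus> \<one> = a \<otimes> a"
    then have "\<one> \<oplus> a \<otimes> a = \<zero>" by (metis one_closed r_neg)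
    then show False using pyth[OF a] by auto
  qed
  moreover have "\<exists>c\<in>carrier R. (a \<otimes> a) \<otimes> (b \<otimes> b) = c \<otimes> c" if "a \<in> carrier R" "b \<in> carrier R" for a b
    using that by (intro bexI[of _ "a \<otimes> b"]) (auto simp: m_ac)
  ultimately have neg: "\<ominus> \<one> \<notin> ?Q"
    and mult: "\<And>a b. \<lbrakk>a \<in> carrier R; b \<in> carrier R\<rbrakk> \<Longrightarrow> \<exists>c\<in>carrier R. (a \<otimes> a) \<otimes> (b \<otimes> b) = c \<otimes> c" by blast+
  show ?thesis
    unfolding cone_def
  proof (intro conjI ballI)
    show "?Q \<subseteq> carrier R" "\<ominus> \<one> \<notin> ?Q" using neg by auto
    show "a \<otimes> a \<in> ?Q" if "a \<in> carrier R" for a using that by blast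
    fix x y assume "x \<in> ?Q" "y \<in> ?Q"
    then obtain a b where ab: "a \<in> carrier R" "b \<in> carrier R" "x = a \<otimes> a" "y = b \<otimes> b" by blast
    show "x \<oplus> y \<in> ?Q" using add[OF ab(1,2)] ab(3,4) by blast
    show "x \<otimes> y \<in> ?Q" using mult[OF ab(1,2)] ab(3,4) by blast
  qed
qed

text \<open>The Artin-Schreier step of adjoining \<open>- a\<close>. An equation
  \<open>- 1 = x - a y\<close> would give \<open>a = (1 + x) y (1/y)^2\<close>, an element of
  \<open>P\<close>.\<close>

lemma cone_extend:
  assumes P: "cone P" and a: "a \<in> carrier R" "a \<notin> P"
  shows "cone {x \<ominus> a \<otimes> y | x y. x \<in> P \<and> y \<in> P}" (is "cone ?P'")
    and "P \<subseteq> {x \<ominus> a \<otimes> y | x y. x \<in> P \<and> y \<in> P}" and "\<ominus> a \<in> {x \<ominus> a \<otimes> y | x y. x \<in> P \<and> y \<in> P}"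
proof -
  have PR: "x \<in> carrier R" if "x \<in> P" for x using P that unfolding cone_def by blast
  have Pa: "x \<oplus> y \<in> P" "x \<otimes> y \<in> P" if "x \<in> P" "y \<in> P" for x y using P that unfolding cone_def by blast+
  have Psq: "x \<otimes> x \<in> P" if "x \<in> carrier R" for x using P that unfolding cone_def by blast
  have m1: "\<ominus> \<one> \<notin> P" using P unfolding cone_def by blast
  have 0: "\<zero> \<in> P" "\<one> \<in> P" using Psq[of \<zero>] Psq[of \<one>] by auto
  show sub: "P \<subseteq> ?P'"
  proof
    fix x assume "x \<in> P"
    moreover then have "x = x \<ominus> a \<otimes> \<zero>" using a PR by (simp add: minus_eq)
    ultimately show "x \<in> ?P'" using 0 by blast
  qed
  have "\<ominus> a = \<zero> \<ominus> a \<otimes> \<one>" using a by (simp add: minus_eq)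
  then show "\<ominus> a \<in> ?P'" using 0 by blast
  have "\<ominus> \<one> \<notin> ?P'"
  proof
    assume "\<ominus> \<one> \<in> ?P'"
    then obtain x y where xy: "x \<in> P" "y \<in> P" "\<ominus> \<one> = x \<ominus> a \<otimes> y" by blast
    note c = PR[OF xy(1)] PR[OF xy(2)]
    have "a \<otimes> y = \<one> \<oplus> x"
    proof -
      have "\<one> \<oplus> x = a \<otimes> y \<oplus> (\<one> \<oplus> (x \<ominus> a \<otimes> y))" using c a by algebra
      also have "\<dots> = a \<otimes> y" unfolding xy(3)[symmetric] using c a by (simp add: r_neg)
      finally show ?thesis by simp
    qed
    moreover have "y \<noteq> \<zero>"
    proof
      assume "y = \<zero>"
      then have "\<ominus> \<one> = x" using xy c a by (simp add: minus_eq)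
      then show False using m1 xy by simp
    qed
    then have iy: "inv y \<in> carrier R" "y \<otimes> inv y = \<one>" using c field_Units by auto
    moreover have "a = (a \<otimes> y) \<otimes> y \<otimes> (inv y \<otimes> inv y)"
    proof -
      have "(a \<otimes> y) \<otimes> y \<otimes> (inv y \<otimes> inv y) = a \<otimes> ((y \<otimes> inv y) \<otimes> (y \<otimes> inv y))" using a c iy(1) by (simp add: m_ac)
      then show ?thesis using iy a by simp
    qed
    ultimately have "a = (\<one> \<oplus> x) \<otimes> y \<otimes> (inv y \<otimes> inv y)" by simp
    then have "a \<in> P" using Pa[OF Pa(2)[OF Pa(1)[OF 0(2) xy(1)] xy(2)] Psq[OF iy(1)]] by simp
    then show False using a by blast
  qed
  moreover have "?P' \<subseteq> carrier R" using PR a by (auto simp: minus_eq)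
  moreover have "\<forall>u\<in>?P'. \<forall>v\<in>?P'. u \<oplus> v \<in> ?P' \<and> u \<otimes> v \<in> ?P'"
  proof (intro ballI)
    fix u v assume "u \<in> ?P'" "v \<in> ?P'"
    then obtain x y x' y' where xy: "x \<in> P" "y \<in> P" "u = x \<ominus> a \<otimes> y" "x' \<in> P" "y' \<in> P" "v = x' \<ominus> a \<otimes> y'" by blast
    note c = PR[OF xy(1)] PR[OF xy(2)] PR[OF xy(4)] PR[OF xy(5)]
    have "u \<oplus> v = (x \<oplus> x') \<ominus> a \<otimes> (y \<oplus> y')" unfolding xy(3,6) using c a by algebra
    moreover have "u \<otimes> v = (x \<otimes> x' \<oplus> (a \<otimes> a) \<otimes> (y \<otimes> y')) \<ominus> a \<otimes> (x \<otimes> y' \<oplus> x' \<otimes> y)"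
      unfolding xy(3,6) using c a by algebra
    moreover have "x \<oplus> x' \<in> P" "y \<oplus> y' \<in> P" "x \<otimes> x' \<oplus> (a \<otimes> a) \<otimes> (y \<otimes> y') \<in> P" "x \<otimes> y' \<oplus> x' \<otimes> y \<in> P"
      using xy Pa Psq[OF a(1)] by auto
    ultimately show "u \<oplus> v \<in> ?P' \<and> u \<otimes> v \<in> ?P'" by blast
  qed
  ultimately show "cone ?P'" using sub Psq unfolding cone_def by blast
qed

text \<open>A maximal cone exists by Zorn's lemma and is total, since otherwise
  \<open>cone_extend\<close> would enlarge it.\<close>

lemma total_cone_ex:
  assumes "cone Q"
  shows "\<exists>P. cone P \<and> (\<forall>a\<in>carrier R. a \<in> P \<or> \<ominus> a \<in> P)"
proof -
  have "\<exists>M\<in>{P. cone P}. \<forall>N\<in>{P. cone P}. M \<subseteq> N \<longrightarrow> N = M"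
  proof (rule subset_Zorn_nonempty)
    show "{P. cone P} \<noteq> {}" using assms by blast
    fix C assume C: "C \<noteq> {}" "subset.chain {P. cone P} C"
    have cn: "cone N" if "N \<in> C" for N using C that unfolding subset.chain_def by blast
    have 1: "\<Union>C \<subseteq> carrier R" using cn unfolding cone_def by blast
    have 2: "a \<oplus> b \<in> \<Union>C \<and> a \<otimes> b \<in> \<Union>C" if ab: "a \<in> \<Union>C" "b \<in> \<Union>C" for a b
    proof -
      obtain N Y where XY: "N \<in> C" "Y \<in> C" "a \<in> N" "b \<in> Y" using ab by blast
      then have "N \<subseteq> Y \<or> Y \<subseteq> N" using C(2) by (meson subset_chain_def)
      then obtain Z where "Z \<in> C" "a \<in> Z" "b \<in> Z" using XY by blast
      then show ?thesis using cn[of Z] unfolding cone_def by blast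
    qed
    have 3: "a \<otimes> a \<in> \<Union>C" if "a \<in> carrier R" for a using C(1) cn that unfolding cone_def by blast
    have 4: "\<ominus> \<one> \<notin> \<Union>C" using cn unfolding cone_def by blast
    show "\<Union>C \<in> {P. cone P}" using 1 2 3 4 unfolding cone_def by blast
  qed
  then obtain M where M: "cone M" "\<And>N. \<lbrakk>cone N; M \<subseteq> N\<rbrakk> \<Longrightarrow> N = M" by auto
  have "a \<in> M \<or> \<ominus> a \<in> M" if a: "a \<in> carrier R" for a
  proof (rule ccontr)
    assume n: "\<not> ?thesis"
    then have "a \<notin> M" by blast
    note ext = cone_extend[OF M(1) a this]
    show False using M(2)[OF ext(1,2)] ext(3) n by simp
  qed
  then show ?thesis using M(1) by blast
qed

end

locale ordered_record_field = field R for R (structure) +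
  fixes P
  assumes cone: "cone P" and total: "a \<in> carrier R \<Longrightarrow> a \<in> P \<or> \<ominus> a \<in> P"
begin

lemma P_in: "x \<in> P \<Longrightarrow> x \<in> carrier R"
  using cone unfolding cone_def by blast

lemma P_add: "\<lbrakk>x \<in> P; y \<in> P\<rbrakk> \<Longrightarrow> x \<oplus> y \<in> P" and P_mult: "\<lbrakk>x \<in> P; y \<in> P\<rbrakk> \<Longrightarrow> x \<otimes> y \<in> P"
  using cone unfolding cone_def by blast+

lemma P_sq: "x \<in> carrier R \<Longrightarrow> x \<otimes> x \<in> P"
  using cone unfolding cone_def by blast

lemma m1_not_P: "\<ominus> \<one> \<notin> P"
  using cone unfolding cone_def by blast

lemma P_0: "\<zero> \<in> P" and P_1: "\<one> \<in> P"
  using P_sq[of \<zero>] P_sq[of \<one>] by auto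

primrec nK :: "nat \<Rightarrow> 'a" where
  "nK 0 = \<zero>" | "nK (Suc n) = nK n \<oplus> \<one>"

lemma nK_in [simp]: "nK n \<in> carrier R"
  by (induction n) auto

lemma nK_P: "nK n \<in> P"
  by (induction n) (auto simp: P_0 P_1 P_add)

lemma nK_add: "nK (m + n) = nK m \<oplus> nK n"
  by (induction n) (auto simp: a_assoc)

lemma nK_mult: "nK (m * n) = nK m \<otimes> nK n"
  by (induction n) (auto simp: nK_add r_distr a_comm)

lemma nK_diff_P: "nK i \<ominus> nK j \<in> P \<longleftrightarrow> j \<le> i"
proof
  assume "j \<le> i"
  then obtain d where "i = j + d" using le_iff_add by blast
  then have "nK i \<ominus> nK j = nK d" 
    using nK_in[of j] nK_in[of d] nK_add[of j d] by (simp add: minus_eq a_ac r_neg2 l_neg r_neg)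
  then show "nK i \<ominus> nK j \<in> P" using nK_P by simp
next
  assume p: "nK i \<ominus> nK j \<in> P"
  show "j \<le> i"
  proof (rule ccontr)
    assume "\<not> j \<le> i"
    then obtain d where "j = Suc (i + d)" using less_imp_Suc_add not_le by metis
    then have "nK j = nK i \<oplus> nK d \<oplus> \<one>" using nK_add by simp
    moreover have "(nK i \<ominus> (nK i \<oplus> nK d \<oplus> \<one>)) \<oplus> nK d = \<ominus> \<one>" using nK_in[of i] nK_in[of d] one_closed by algebra
    ultimately have "(nK i \<ominus> nK j) \<oplus> nK d = \<ominus> \<one>" by simp
    then show False using P_add[OF p nK_P[of d]] m1_not_P by simp
  qed
qed

text \<open>Lower cuts; an integer numerator is written as a difference of natural numbers.\<close>

definition Lo :: "'a \<Rightarrow> real set" where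
  "Lo a = {(real x - real y) / real n | x y n. n > 0 \<and> nK n \<otimes> a \<oplus> nK y \<ominus> nK x \<in> P}"

lemma LoI: "\<lbrakk>n > 0; nK n \<otimes> a \<oplus> nK y \<ominus> nK x \<in> P\<rbrakk> \<Longrightarrow> (real x - real y) / real n \<in> Lo a"
  unfolding Lo_def by blast

lemma Lo_E:
  assumes "r \<in> Lo a"
  obtains x y n where "n > 0" "nK n \<otimes> a \<oplus> nK y \<ominus> nK x \<in> P" "r = (real x - real y) / real n"
  using assms unfolding Lo_def by blast

lemma Lo_add:
  assumes a: "a \<in> carrier R" and b: "b \<in> carrier R" and r: "r \<in> Lo a" and s: "s \<in> Lo b"
  shows "r + s \<in> Lo (a \<oplus> b)"
proof -
  obtain x y n where 1: "n > 0" "nK n \<otimes> a \<oplus> nK y \<ominus> nK x \<in> P" "r = (real x - real y) / real n" using r by (rule Lo_E)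
  obtain x' y' n' where 2: "n' > 0" "nK n' \<otimes> b \<oplus> nK y' \<ominus> nK x' \<in> P" "s = (real x' - real y') / real n'" using s by (rule Lo_E)
  have "nK n' \<otimes> (nK n \<otimes> a \<oplus> nK y \<ominus> nK x) \<oplus> nK n \<otimes> (nK n' \<otimes> b \<oplus> nK y' \<ominus> nK x') \<in> P"
    using 1 2 P_add P_mult nK_P by simp
  moreover have "nK n' \<otimes> (nK n \<otimes> a \<oplus> nK y \<ominus> nK x) \<oplus> nK n \<otimes> (nK n' \<otimes> b \<oplus> nK y' \<ominus> nK x')
      = nK (n * n') \<otimes> (a \<oplus> b) \<oplus> nK (y * n' + y' * n) \<ominus> nK (x * n' + x' * n)"
    unfolding nK_add nK_mult
    using a b nK_in[of n] nK_in[of n'] nK_in[of x] nK_in[of x'] nK_in[of y] nK_in[of y'] by algebra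
  ultimately have "(real (x * n' + x' * n) - real (y * n' + y' * n)) / real (n * n') \<in> Lo (a \<oplus> b)"
    using LoI[of "n * n'" "a \<oplus> b" "y * n' + y' * n" "x * n' + x' * n"] 1(1) 2(1) by (metis nat_0_less_mult_iff)
  moreover have "r + s = (real (x * n' + x' * n) - real (y * n' + y' * n)) / real (n * n')"
    unfolding 1(3) 2(3) using 1(1) 2(1) by (simp add: field_simps)
  ultimately show ?thesis by simp
qed

end

section \<open>Embedding an archimedean field into the reals\<close>

locale archimedean_record_field = ordered_record_field +
  assumes arch: "a \<in> carrier R \<Longrightarrow> \<exists>n. nK n \<ominus> a \<in> P"
begin

lemma Lo_nonempty: assumes a: "a \<in> carrier R" shows "Lo a \<noteq> {}"
proof -
  obtain n where "nK n \<ominus> (\<ominus> a) \<in> P" using arch[of "\<ominus> a"] a by auto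
  moreover have "nK n \<ominus> (\<ominus> a) = nK 1 \<otimes> a \<oplus> nK n \<ominus> nK 0" using a nK_in[of n] by (simp add: minus_eq a_comm)
  ultimately show ?thesis using LoI[of 1 a n 0] by auto
qed

lemma Lo_bdd: assumes a: "a \<in> carrier R" shows "bdd_above (Lo a)"
proof -
  obtain m where m: "nK m \<ominus> a \<in> P" using arch[OF a] by blast
  have "r \<le> real m" if r: "r \<in> Lo a" for r
  proof -
    obtain x y n where 1: "n > 0" "nK n \<otimes> a \<oplus> nK y \<ominus> nK x \<in> P" "r = (real x - real y) / real n" using r by (rule Lo_E)
    have "nK n \<otimes> (nK m \<ominus> a) \<oplus> (nK n \<otimes> a \<oplus> nK y \<ominus> nK x) \<in> P" using 1 m P_add P_mult nK_P by simp
    moreover have "nK n \<otimes> (nK m \<ominus> a) \<oplus> (nK n \<otimes> a \<oplus> nK y \<ominus> nK x) = nK (n * m + y) \<ominus> nK x"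
      unfolding nK_add nK_mult using a nK_in[of n] nK_in[of m] nK_in[of y] nK_in[of x] by algebra
    ultimately have "x \<le> n * m + y" using nK_diff_P by simp
    then have "real x \<le> real n * real m + real y" by (metis of_nat_add of_nat_le_iff of_nat_mult)
    then show ?thesis unfolding 1(3) using 1(1) by (simp add: field_simps)
  qed
  then show ?thesis unfolding bdd_above_def by blast
qed

definition eta :: "'a \<Rightarrow> real" where "eta a = Sup (Lo a)"

lemma Lo_le: "\<lbrakk>a \<in> carrier R; r \<in> Lo a\<rbrakk> \<Longrightarrow> r \<le> eta a"
  unfolding eta_def by (rule cSup_upper[OF _ Lo_bdd])

lemma eta_le: "\<lbrakk>a \<in> carrier R; \<And>r. r \<in> Lo a \<Longrightarrow> r \<le> c\<rbrakk> \<Longrightarrow> eta a \<le> c"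
  unfolding eta_def by (rule cSup_least[OF Lo_nonempty])

lemma eta_superadd:
  assumes a: "a \<in> carrier R" and b: "b \<in> carrier R"
  shows "eta a + eta b \<le> eta (a \<oplus> b)"
proof -
  have "r + s \<le> eta (a \<oplus> b)" if "r \<in> Lo a" "s \<in> Lo b" for r s
    using Lo_le[OF _ Lo_add[OF a b that]] a b by simp
  then have "s \<le> eta (a \<oplus> b) - r" if "r \<in> Lo a" "s \<in> Lo b" for r s using that by (metis add.commute le_diff_eq)
  then have "eta b \<le> eta (a \<oplus> b) - r" if "r \<in> Lo a" for r using that eta_le[OF b] by blast
  then have "r \<le> eta (a \<oplus> b) - eta b" if "r \<in> Lo a" for r using that by (simp add: algebra_simps)
  then show ?thesis using eta_le[OF a, of "eta (a \<oplus> b) - eta b"] by simp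
qed

lemma eta_nonneg: assumes "a \<in> P" shows "eta a \<ge> 0"
proof -
  have a: "a \<in> carrier R" using assms P_in by blast
  have "nK 1 \<otimes> a \<oplus> nK 0 \<ominus> nK 0 = a" using a by (simp add: minus_eq)
  then have "0 \<in> Lo a" using LoI[of 1 a 0 0] assms by simp
  then show ?thesis using Lo_le a by blast
qed

lemma Lo_0: "r \<in> Lo \<zero> \<Longrightarrow> r \<le> 0"
proof (erule Lo_E)
  fix x y n assume h: "0 < n" "nK n \<otimes> \<zero> \<oplus> nK y \<ominus> nK x \<in> P" "r = (real x - real y) / real n"
  have "nK n \<otimes> \<zero> \<oplus> nK y \<ominus> nK x = nK y \<ominus> nK x" by simp
  then have "x \<le> y" using h nK_diff_P by simp
  then show "r \<le> 0" using h by (simp add: divide_nonpos_pos)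
qed

text \<open>Lower cuts by themselves give only superadditivity; totality of the order supplies the
  rest. A rational \<open>q\<close> above \<open>eta a\<close> is in no lower cut of
  \<open>a\<close>, so by totality \<open>- q\<close> is in the lower cut of \<open>- a\<close>,
  which bounds \<open>eta (- a)\<close> from below.\<close>

lemma eta_minus: assumes a: "a \<in> carrier R" shows "eta (\<ominus> a) = - eta a"
proof (rule antisym)
  have "eta \<zero> \<le> 0" using eta_le[of \<zero> 0] Lo_0 by simp
  then show "eta (\<ominus> a) \<le> - eta a" using eta_superadd[OF a a_inv_closed[OF a]] a by (simp add: r_neg)
  show "- eta a \<le> eta (\<ominus> a)"
  proof (rule ccontr)
    assume "\<not> ?thesis"
    then obtain q where q: "q \<in> \<rat>" "eta a < q" "q < - eta (\<ominus> a)" using Rats_dense_in_real[of "eta a" "- eta (\<ominus> a)"] by auto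
    obtain i n where "n > 0" and qi: "q = of_int i / of_int n" using q(1) by (rule Rats_cases')
    define x y N where xy: "x = nat i" "y = nat (- i)" "N = nat n"
    have N: "N > 0" "real N = of_int n" "real x - real y = of_int i" using \<open>n > 0\<close> xy by auto
    have qe: "q = (real x - real y) / real N" using qi N by simp
    have "nK N \<otimes> a \<oplus> nK y \<ominus> nK x \<notin> P"
      using LoI[OF N(1), of a y x] Lo_le[OF a] q(2) qe by fastforce
    then have "\<ominus> (nK N \<otimes> a \<oplus> nK y \<ominus> nK x) \<in> P" using total[of "nK N \<otimes> a \<oplus> nK y \<ominus> nK x"] a by (simp add: minus_eq)
    moreover have "\<ominus> (nK N \<otimes> a \<oplus> nK y \<ominus> nK x) = nK N \<otimes> (\<ominus> a) \<oplus> nK x \<ominus> nK y"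
      using a nK_in[of N] nK_in[of x] nK_in[of y] by algebra
    ultimately have "(real y - real x) / real N \<in> Lo (\<ominus> a)" using LoI[OF N(1)] by simp
    then have "(real y - real x) / real N \<le> eta (\<ominus> a)" using Lo_le a by simp
    moreover have "(real y - real x) / real N = - q" using qe by (simp add: diff_divide_distrib)
    ultimately show False using q by simp
  qed
qed

lemma eta_add:
  assumes a: "a \<in> carrier R" and b: "b \<in> carrier R"
  shows "eta (a \<oplus> b) = eta a + eta b"
proof (rule antisym)
  have "eta (\<ominus> a) + eta (\<ominus> b) \<le> eta (\<ominus> a \<oplus> \<ominus> b)" using eta_superadd a b by simp
  moreover have "\<ominus> a \<oplus> \<ominus> b = \<ominus> (a \<oplus> b)" using a b by (simp add: minus_add a_comm)
  ultimately show "eta (a \<oplus> b) \<le> eta a + eta b" using eta_minus a b by simp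
  show "eta a + eta b \<le> eta (a \<oplus> b)" using eta_superadd a b .
qed

text \<open>An additive map that is nonnegative on \<open>P\<close> respects all rational
  inequalities, hence the cuts. Applied to \<open>b \<mapsto> eta (a b)\<close> with
  \<open>a\<close> in \<open>P\<close> it yields that \<open>eta\<close> is multiplicative.\<close>

lemma monotone_additive_unique:
  assumes add: "\<And>a b. \<lbrakk>a \<in> carrier R; b \<in> carrier R\<rbrakk> \<Longrightarrow> f (a \<oplus> b) = f a + f b"
    and nn: "\<And>a. a \<in> P \<Longrightarrow> f a \<ge> (0::real)" and a: "a \<in> carrier R"
  shows "f a = eta a * f \<one>"
proof -
  have f0: "f \<zero> = 0" using add[of \<zero> \<zero>] by simp
  have fm: "f (\<ominus> x) = - f x" if "x \<in> carrier R" for x using add[of x "\<ominus> x"] f0 that by (simp add: r_neg)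
  have fn: "f (nK n \<otimes> x) = real n * f x" if "x \<in> carrier R" for n x
    by (induction n) (use that in \<open>simp_all add: f0 add l_distr algebra_simps\<close>)
  have fnK: "f (nK n) = real n * f \<one>" for n using fn[of \<one> n] by simp
  have f1: "f \<one> \<ge> 0" using nn P_1 by blast
  have le: "eta a * f \<one> \<le> f a" if a: "a \<in> carrier R" for a
  proof -
    have r: "r * f \<one> \<le> f a" if r: "r \<in> Lo a" for r
    proof -
      obtain x y n where 1: "n > 0" "nK n \<otimes> a \<oplus> nK y \<ominus> nK x \<in> P" "r = (real x - real y) / real n" using r by (rule Lo_E)
      have "f (nK n \<otimes> a \<oplus> nK y \<ominus> nK x) = real n * f a + real y * f \<one> - real x * f \<one>"
        unfolding minus_eq using a by (simp add: add fm fn fnK)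
      then have "real x * f \<one> - real y * f \<one> \<le> real n * f a" using nn[OF 1(2)] by simp
      then show ?thesis unfolding 1(3) using 1(1) by (simp add: field_simps)
    qed
    show ?thesis
    proof (cases "f \<one> = 0")
      case True then show ?thesis using r Lo_nonempty[OF a] by auto
    next
      case False
      then have "eta a \<le> f a / f \<one>" using f1 r by (intro eta_le[OF a]) (simp add: field_simps)
      then show ?thesis using False f1 by (simp add: field_simps)
    qed
  qed
  have "eta (\<ominus> a) * f \<one> \<le> f (\<ominus> a)" using le a by simp
  then have "f a \<le> eta a * f \<one>" using fm eta_minus a by simp
  then show ?thesis using le[OF a] by simp
qed

text \<open>Uniqueness applied to \<open>eta\<close> itself shows that \<open>eta \<one>\<close> is
  idempotent, and the cut shows that it is at least one.\<close>

lemma eta_one: "eta \<one> = 1"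
proof -
  have "nK 1 \<otimes> \<one> \<oplus> nK 0 \<ominus> nK 1 = \<zero>" by (simp add: r_neg minus_eq)
  then have "nK 1 \<otimes> \<one> \<oplus> nK 0 \<ominus> nK 1 \<in> P" using P_0 by metis
  from LoI[OF _ this] have "1 \<in> Lo \<one>" by simp
  then have "eta \<one> \<ge> 1" using Lo_le by blast
  moreover have "eta \<one> = eta \<one> * eta \<one>"
    using monotone_additive_unique[of eta \<one>] eta_add eta_nonneg by simp
  ultimately show ?thesis by simp
qed

lemma eta_mult:
  assumes a: "a \<in> carrier R" and b: "b \<in> carrier R"
  shows "eta (a \<otimes> b) = eta a * eta b"
proof -
  have pos: "eta (a \<otimes> b) = eta a * eta b" if "a \<in> P" for a
    using monotone_additive_unique[of "\<lambda>b. eta (a \<otimes> b)" b] eta_add eta_nonneg P_mult P_in[OF that] that b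
    by (simp add: r_distr)
  show ?thesis
  proof (cases "a \<in> P")
    case True then show ?thesis using pos by blast
  next
    case False
    then have "eta ((\<ominus> a) \<otimes> b) = eta (\<ominus> a) * eta b" using pos total a by blast
    moreover have "(\<ominus> a) \<otimes> b = \<ominus> (a \<otimes> b)" using a b by (simp add: l_minus)
    ultimately show ?thesis using eta_minus a b by simp
  qed
qed

lemma eta_zero: "eta \<zero> = 0"
  using eta_add[of \<zero> \<zero>] by simp

lemma eta_eq_0: "\<lbrakk>a \<in> carrier R; eta a = 0\<rbrakk> \<Longrightarrow> a = \<zero>"
  using eta_mult[of a "inv a"] eta_one field_Units by (cases "a = \<zero>") auto

lemma eta_inj: assumes "a \<in> carrier R" "b \<in> carrier R" "eta a = eta b" shows "a = b"
  using eta_eq_0[of "a \<ominus> b"] eta_add[of a "\<ominus> b"] eta_minus[of b] assms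
  by (simp add: minus_eq r_right_minus_eq[unfolded minus_eq])

end

section \<open>Rotations as isometries\<close>

text \<open>The last assumption records that \<open>rot e f\<close> depends only on the common
  orthocomplement of \<open>e\<close> and \<open>f\<close>. Hence any two distinct points of the
  line, in particular an orthogonal pair, generate the same rotations.\<close>

locale rotation_orthoset = projective_orthoset +
  fixes rot :: "'a \<Rightarrow> 'a \<Rightarrow> ('a \<Rightarrow> 'a) set"
  assumes rot_aut: "\<lbrakk>e \<in> S; f \<in> S; e \<noteq> f; \<rho> \<in> rot e f\<rbrakk> \<Longrightarrow> aut \<rho>"
    and rot_fix: "\<lbrakk>e \<in> S; f \<in> S; e \<noteq> f; \<rho> \<in> rot e f; z \<perp> e; z \<perp> f\<rbrakk> \<Longrightarrow> \<rho> z = z"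
    and rot_comm: "\<lbrakk>e \<in> S; f \<in> S; e \<noteq> f; \<rho> \<in> rot e f; \<sigma> \<in> rot e f; x \<in> S\<rbrakk> \<Longrightarrow> \<rho> (\<sigma> x) = \<sigma> (\<rho> x)"
    and rot_mult: "\<lbrakk>e \<in> S; f \<in> S; e \<noteq> f; \<rho> \<in> rot e f; \<sigma> \<in> rot e f\<rbrakk> \<Longrightarrow> \<exists>\<tau>\<in>rot e f. \<forall>x\<in>S. \<tau> x = \<rho> (\<sigma> x)"
    and rot_trans: "\<lbrakk>e \<in> S; f \<in> S; e \<noteq> f\<rbrakk> \<Longrightarrow> \<exists>\<rho>\<in>rot e f. \<rho> e = f"
    and rot_same: "\<lbrakk>e \<in> S; f \<in> S; e' \<in> S; f' \<in> S;
      \<And>z. z \<perp> e \<and> z \<perp> f \<longleftrightarrow> z \<perp> e' \<and> z \<perp> f'\<rbrakk> \<Longrightarrow> rot e f = rot e' f'"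
begin

lemma rot_line:
  assumes "e \<in> S" "f \<in> S" "e \<noteq> f" "y \<in> pline e f" "y \<noteq> e"
  shows "rot e f = rot e y"
proof (rule rot_same)
  show "y \<in> S" using assms pline_in by blast
  fix z
  have "f \<in> pline e y" using pline_exchange[OF assms] .
  then show "z \<perp> e \<and> z \<perp> f \<longleftrightarrow> z \<perp> e \<and> z \<perp> y" using plineD assms(4) by blast
qed (use assms in auto)

text \<open>Every \<open>y\<close> on the line is the image of \<open>e\<close> under some rotation
  of the same plane, and this rotation commutes with \<open>J\<close>.\<close>

lemma rot_orth_line:
  assumes e: "e \<in> S" "f \<in> S" "e \<noteq> f" and J: "J \<in> rot e f" "J e \<perp> e" and y: "y \<in> pline e f"
  shows "J y \<perp> y"
proof (cases "y = e")
  case True then show ?thesis using J by simp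
next
  case False
  have yS: "y \<in> S" using y pline_in by blast
  have "rot e f = rot e y" using rot_line e y False by blast
  then obtain \<rho> where r: "\<rho> \<in> rot e f" "\<rho> e = y" using rot_trans[of e y] e yS False by auto
  have "J y = \<rho> (J e)" using rot_comm[OF e J(1) r(1) e(1)] r by simp
  then show ?thesis
    using aut_orth[OF rot_aut[OF e r(1)], of "J e" e] aut_in[OF rot_aut[OF e J(1)] e(1)] J r e by simp
qed

lemma rot_quarter_turn:
  assumes "e \<perp> f"
  shows "\<exists>J. aut J \<and> (\<forall>z. z \<perp> e \<and> z \<perp> f \<longrightarrow> J z = z) \<and> J e = f \<and> (\<forall>y\<in>pline e f. J y \<perp> y)"
proof -
  have e: "e \<in> S" "f \<in> S" "e \<noteq> f" using assms orth_in orth_in2 orth_neq by blast+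
  obtain J where J: "J \<in> rot e f" "J e = f" using rot_trans[OF e] by blast
  have "J e \<perp> e" using J assms orth_sym by simp
  then show ?thesis using rot_aut[OF e J(1)] rot_fix[OF e J(1)] J(2) rot_orth_line[OF e J(1)] by blast
qed

end

section \<open>Calculation with anisotropic forms\<close>

context quadratic_space
begin

abbreviation va (infixl \<open>\<boxplus>\<close> 65) where "x \<boxplus> y \<equiv> x \<oplus>\<^bsub>H\<^esub> y"
abbreviation vs (infixr \<open>\<bullet>\<close> 75) where "a \<bullet> x \<equiv> a \<odot>\<^bsub>H\<^esub> x"
abbreviation vz where "vz \<equiv> \<zero>\<^bsub>H\<^esub>"

lemma form_add_right: "\<lbrakk>u \<in> carrier H; v \<in> carrier H; w \<in> carrier H\<rbrakk> \<Longrightarrow> form w (u \<boxplus> v) = form w u \<oplus> form w v"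
  using form_add_left[of u v w] form_sym[of w "u \<boxplus> v"] form_sym[of w u] form_sym[of w v] by simp

lemma form_smult_right: "\<lbrakk>a \<in> carrier K; u \<in> carrier H; v \<in> carrier H\<rbrakk> \<Longrightarrow> form v (a \<bullet> u) = a \<otimes> form v u"
  using form_smult_left[of a u v] form_sym[of v "a \<bullet> u"] form_sym[of v u] by simp

lemma form_zero [simp]: "v \<in> carrier H \<Longrightarrow> form v vz = \<zero>" "v \<in> carrier H \<Longrightarrow> form vz v = \<zero>"
proof -
  assume v: "v \<in> carrier H"
  have "form v (\<zero> \<bullet> v) = \<zero>" using form_smult_right[of \<zero> v v] v form_closed[OF v v] by simp
  then show "form v vz = \<zero>" using v by (simp add: smult_l_null)
  then show "form vz v = \<zero>" using form_sym[of v vz] v by simp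
qed

lemma form_nz: "\<lbrakk>v \<in> carrier H; v \<noteq> vz\<rbrakk> \<Longrightarrow> form v v \<noteq> \<zero>"
  using form_anisotropic by blast

lemmas form_simps = form_closed form_add_left form_add_right form_smult_left form_smult_right

lemma field_inv: "\<lbrakk>a \<in> carrier K; a \<noteq> \<zero>\<rbrakk> \<Longrightarrow> inv a \<in> carrier K \<and> inv a \<noteq> \<zero> \<and> a \<otimes> inv a = \<one> \<and> inv a \<otimes> a = \<one>"
  using K.field_Units nonzero_imp_inverse_nonzero by auto

lemma smult_inv: "\<lbrakk>a \<in> carrier K; a \<noteq> \<zero>; v \<in> carrier H\<rbrakk> \<Longrightarrow> inv a \<bullet> a \<bullet> v = v"
  using field_inv[of a] smult_assoc1[of "inv a" a v] by simp

lemma smult_nz: "\<lbrakk>a \<in> carrier K; v \<in> carrier H; a \<noteq> \<zero>; v \<noteq> vz\<rbrakk> \<Longrightarrow> a \<bullet> v \<noteq> vz"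
  using smult_inv[of a v] field_inv[of a] smult_r_null[of "inv a"] by auto

lemma vec_diff_zero:
  assumes "u \<in> carrier H" "v \<in> carrier H" "u \<boxplus> (\<ominus> \<one>) \<bullet> v = vz" shows "u = v"
  using assms by (simp add: smult_l_minus H.M.minus_equality H.M.minus_minus)
    (metis H.M.add.inv_closed H.M.minus_equality H.M.minus_minus)

text \<open>The difference \<open>u - v\<close> is orthogonal to itself. Only products with
  \<open>u - v\<close> are compared, so inside a subspace it is enough to know products with
  elements of that subspace.\<close>

lemma vec_eqI:
  assumes u: "u \<in> carrier H" and v: "v \<in> carrier H"
    and eq: "form u (u \<boxplus> (\<ominus> \<one>) \<bullet> v) = form v (u \<boxplus> (\<ominus> \<one>) \<bullet> v)"
  shows "u = v"
proof -
  let ?d = "u \<boxplus> (\<ominus> \<one>) \<bullet> v"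
  have d: "?d \<in> carrier H" using u v by simp
  have "form ?d ?d = form u ?d \<oplus> (\<ominus> \<one>) \<otimes> form v ?d"
    using form_add_left[of u "(\<ominus> \<one>) \<bullet> v" ?d] form_smult_left[of "\<ominus> \<one>" v ?d] u v d by simp
  also have "\<dots> = \<zero>" unfolding eq using form_closed[OF v d] one_closed by algebra
  finally show ?thesis using form_anisotropic[OF d] vec_diff_zero[OF u v] by blast
qed

lemma form_project:
  assumes u: "u \<in> carrier H" "u \<noteq> vz" and x: "x \<in> carrier H"
  obtains c z where "c \<in> carrier K" "z \<in> carrier H" "x = z \<boxplus> c \<bullet> u" "form u z = \<zero>"
proof -
  define c where "c = form u x \<otimes> inv (form u u)"
  note n = field_inv[OF form_closed[OF u(1) u(1)] form_nz[OF u]]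
  have fx: "form u x \<in> carrier K" "form u u \<in> carrier K" using form_closed u x by auto
  have c: "c \<in> carrier K" using n fx unfolding c_def by simp
  let ?z = "x \<boxplus> (\<ominus> c) \<bullet> u"
  have cu: "c \<otimes> form u u = form u x" unfolding c_def using n fx by (simp add: K.m_assoc)
  have z: "?z \<in> carrier H" using x c u by simp
  have "form u ?z = form u x \<oplus> (\<ominus> c) \<otimes> form u u" using u x c by (simp add: form_simps)
  also have "\<dots> = \<zero>" using cu c fx by (simp add: K.l_minus K.r_neg)
  finally have 1: "form u ?z = \<zero>" .
  have "?z \<boxplus> c \<bullet> u = x"
    using x u c by (simp add: smult_l_minus H.M.a_assoc H.M.l_neg)
  then show ?thesis using that[OF c z _ 1] by simp
qed

end

locale coordinatized_orthoset = rotation_orthoset S orth rot + quadratic_space K H form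
  for S :: "'a set" and orth (infix \<open>\<perp>\<close> 50) and rot
    and K :: "('k, 'm) ring_scheme" (structure) and H :: "('k, 'v, 'n) module_scheme" (structure) and form +
  fixes pt :: "'v \<Rightarrow> 'a"
  assumes pt_in: "\<lbrakk>x \<in> carrier H; x \<noteq> vz\<rbrakk> \<Longrightarrow> pt x \<in> S"
    and pt_surj: "s \<in> S \<Longrightarrow> \<exists>x\<in>carrier H. x \<noteq> vz \<and> pt x = s"
    and pt_eq: "\<lbrakk>x \<in> carrier H; y \<in> carrier H; x \<noteq> vz; y \<noteq> vz\<rbrakk> \<Longrightarrow> pt x = pt y \<longleftrightarrow> (\<exists>c\<in>carrier K. y = c \<bullet> x)"
    and pt_orth: "\<lbrakk>x \<in> carrier H; y \<in> carrier H; x \<noteq> vz; y \<noteq> vz\<rbrakk> \<Longrightarrow> pt x \<perp> pt y \<longleftrightarrow> form x y = \<zero>"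
    and unit_vector: "\<exists>x\<in>carrier H. form x x = \<one>"
begin

lemma pt_smult:
  assumes "x \<in> carrier H" "x \<noteq> vz" "c \<in> carrier K" "c \<noteq> \<zero>" shows "pt (c \<bullet> x) = pt x"
  using pt_eq[of x "c \<bullet> x"] smult_nz[of c x] assms by auto

end

section \<open>Automorphisms fixing the complement of a plane\<close>

locale coordinate_plane = coordinatized_orthoset S orth rot K H form pt
  for S :: "'a set" and orth (infix \<open>\<perp>\<close> 50) and rot
    and K :: "('k, 'm) ring_scheme" (structure) and H :: "('k, 'v, 'n) module_scheme" (structure) and form and pt +
  fixes p q :: 'v
  assumes p: "p \<in> carrier H" "p \<noteq> vz" and q: "q \<in> carrier H" "q \<noteq> vz" and pq: "form p q = \<zero>"
begin

definition W :: "'v set" where "W = {w \<in> carrier H. form p w = \<zero> \<and> form q w = \<zero>}"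
text \<open>Taking the double complement instead of the span of \<open>p\<close> and
  \<open>q\<close> makes orthogonality to \<open>W\<close> immediate; \<open>Pl_span\<close>
  recovers the coordinates.\<close>

definition Pl :: "'v set" where "Pl = {s \<in> carrier H. \<forall>w\<in>W. form s w = \<zero>}"

lemma W_in: "w \<in> W \<Longrightarrow> w \<in> carrier H" by (simp add: W_def)
lemma Pl_in: "s \<in> Pl \<Longrightarrow> s \<in> carrier H" by (simp add: Pl_def)

lemma W_add: "\<lbrakk>v \<in> W; w \<in> W\<rbrakk> \<Longrightarrow> v \<boxplus> w \<in> W"
  using p q unfolding W_def by (simp add: form_simps)
lemma W_smult: "\<lbrakk>a \<in> carrier K; w \<in> W\<rbrakk> \<Longrightarrow> a \<bullet> w \<in> W"
  using p q unfolding W_def by (simp add: form_simps)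
lemma Pl_add: "\<lbrakk>v \<in> Pl; w \<in> Pl\<rbrakk> \<Longrightarrow> v \<boxplus> w \<in> Pl"
  unfolding Pl_def using W_in by (simp add: form_simps)
lemma Pl_smult: "\<lbrakk>a \<in> carrier K; w \<in> Pl\<rbrakk> \<Longrightarrow> a \<bullet> w \<in> Pl"
  unfolding Pl_def using W_in by (simp add: form_simps)
lemma vz_W: "vz \<in> W" and vz_Pl: "vz \<in> Pl" and p_Pl: "p \<in> Pl" and q_Pl: "q \<in> Pl"
  using p q unfolding W_def Pl_def by simp_all

declare W_in [simp] Pl_in [simp] W_add [simp] W_smult [simp] Pl_add [simp] Pl_smult [simp]
  vz_W [simp] vz_Pl [simp] p_Pl [simp] q_Pl [simp]

lemma form_PlW [simp]: "\<lbrakk>s \<in> Pl; w \<in> W\<rbrakk> \<Longrightarrow> form s w = \<zero>"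
  unfolding Pl_def by blast
lemma form_WPl [simp]: "\<lbrakk>s \<in> Pl; w \<in> W\<rbrakk> \<Longrightarrow> form w s = \<zero>"
  using form_sym[of s w] by simp

lemma form_sum: "\<lbrakk>s \<in> Pl; w \<in> W; s' \<in> Pl; w' \<in> W\<rbrakk> \<Longrightarrow> form (s \<boxplus> w) (s' \<boxplus> w') = form s s' \<oplus> form w w'"
  by (simp add: form_simps)

lemma decomp_span:
  assumes x: "x \<in> carrier H"
  obtains c d w where "c \<in> carrier K" "d \<in> carrier K" "w \<in> W" "x = (c \<bullet> p \<boxplus> d \<bullet> q) \<boxplus> w"
proof -
  obtain c y where c: "c \<in> carrier K" "y \<in> carrier H" "x = y \<boxplus> c \<bullet> p" "form p y = \<zero>" using form_project[OF p x] .
  obtain d w where d: "d \<in> carrier K" "w \<in> carrier H" "y = w \<boxplus> d \<bullet> q" "form q w = \<zero>" using form_project[OF q c(2)] .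
  have "form p y = form p w" using d(1,2) p q pq unfolding d(3) by (simp add: form_simps)
  then have "w \<in> W" using c d unfolding W_def by simp
  moreover have "x = (c \<bullet> p \<boxplus> d \<bullet> q) \<boxplus> w" unfolding c(3) d(3) using c(1) d(1,2) p q by (simp add: H.M.a_ac)
  ultimately show ?thesis using that c d by blast
qed

lemma decomp:
  assumes x: "x \<in> carrier H"
  obtains s w where "s \<in> Pl" "w \<in> W" "x = s \<boxplus> w"
proof -
  obtain c d w where h: "c \<in> carrier K" "d \<in> carrier K" "w \<in> W" "x = (c \<bullet> p \<boxplus> d \<bullet> q) \<boxplus> w" using decomp_span[OF x] .
  show ?thesis using that[of "c \<bullet> p \<boxplus> d \<bullet> q" w] h by simp
qed

lemma Pl_span:
  assumes s: "s \<in> Pl"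
  obtains c d where "c \<in> carrier K" "d \<in> carrier K" "s = c \<bullet> p \<boxplus> d \<bullet> q"
proof -
  obtain c d w where h: "c \<in> carrier K" "d \<in> carrier K" "w \<in> W" "s = (c \<bullet> p \<boxplus> d \<bullet> q) \<boxplus> w" using decomp_span[of s] s by auto
  have "form s w = form w w" unfolding h(4) using h(1,2,3) by (subst form_add_left) (auto simp: form_closed)
  then have "w = vz" using form_anisotropic[of w] s h by simp
  then show ?thesis using that[of c d] h by simp
qed

lemma Pl_eqI: "\<lbrakk>s \<in> Pl; t \<in> Pl; \<And>r. r \<in> Pl \<Longrightarrow> form r s = form r t\<rbrakk> \<Longrightarrow> s = t"
  by (rule vec_eqI) (simp_all add: form_sym[of _ "s \<boxplus> (\<ominus> \<one>) \<bullet> t"])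

lemma W_eqI: "\<lbrakk>s \<in> W; t \<in> W; \<And>r. r \<in> W \<Longrightarrow> form r s = form r t\<rbrakk> \<Longrightarrow> s = t"
  by (rule vec_eqI) (simp_all add: form_sym[of _ "s \<boxplus> (\<ominus> \<one>) \<bullet> t"])

lemma decomp_eq:
  assumes "s \<in> Pl" "w \<in> W" "s' \<in> Pl" "w' \<in> W" "s \<boxplus> w = s' \<boxplus> w'"
  shows "s = s'" "w = w'"
proof -
  show "s = s'"
  proof (rule Pl_eqI[OF assms(1,3)])
    fix r assume r: "r \<in> Pl"
    have "form r (s \<boxplus> w) = form r (s' \<boxplus> w')" using assms by simp
    then show "form r s = form r s'" using assms(1-4) r by (simp add: form_simps)
  qed
  show "w = w'"
  proof (rule W_eqI[OF assms(2,4)])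
    fix r assume r: "r \<in> W"
    have "form r (s \<boxplus> w) = form r (s' \<boxplus> w')" using assms by simp
    then show "form r w = form r w'" using assms(1-4) r by (simp add: form_simps)
  qed
qed

lemma sum_nz: "\<lbrakk>s \<in> Pl; w \<in> W; w \<noteq> vz\<rbrakk> \<Longrightarrow> s \<boxplus> w \<noteq> vz"
  using decomp_eq(2)[of s w vz vz] by auto

definition stab :: "('a \<Rightarrow> 'a) \<Rightarrow> bool" where
  "stab \<phi> \<longleftrightarrow> aut \<phi> \<and> (\<forall>w\<in>W. w \<noteq> vz \<longrightarrow> \<phi> (pt w) = pt w)"

lemma stab_fix: "\<lbrakk>stab \<phi>; w \<in> W; w \<noteq> vz\<rbrakk> \<Longrightarrow> \<phi> (pt w) = pt w"
  by (simp add: stab_def)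

lemma stab_orth:
  assumes "stab \<phi>" "x \<in> carrier H" "y \<in> carrier H" "x \<noteq> vz" "y \<noteq> vz"
  shows "\<phi> (pt x) \<perp> \<phi> (pt y) \<longleftrightarrow> form x y = \<zero>"
  using aut_orth[of \<phi> "pt x" "pt y"] pt_orth pt_in assms unfolding stab_def by simp

lemma stab_surj:
  assumes "stab \<phi>" "z \<in> carrier H" "z \<noteq> vz"
  shows "\<exists>y\<in>carrier H. y \<noteq> vz \<and> \<phi> (pt y) = pt z"
  using aut_surj[of \<phi> "pt z"] pt_in assms pt_surj unfolding stab_def by metis

text \<open>Vectors of \<open>W\<close> orthogonal to \<open>w\<close> span fixed points orthogonal
  to \<open>s + w\<close>, hence to the image; so the component of the image in \<open>W\<close> is
  a multiple of \<open>w\<close>. It is nonzero because \<open>w\<close> is not orthogonal to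
  \<open>s + w\<close>, and can be scaled to \<open>w\<close>.\<close>

lemma stab_ex:
  assumes \<phi>: "stab \<phi>" and s: "s \<in> Pl" and w: "w \<in> W" "w \<noteq> vz"
  shows "\<exists>t\<in>Pl. \<phi> (pt (s \<boxplus> w)) = pt (t \<boxplus> w)"
proof -
  have sw: "s \<boxplus> w \<in> carrier H" "s \<boxplus> w \<noteq> vz" using sum_nz s w by auto
  have "\<phi> (pt (s \<boxplus> w)) \<in> S" using aut_in[of \<phi> "pt (s \<boxplus> w)"] pt_in sw \<phi> unfolding stab_def by simp
  then obtain y where y: "y \<in> carrier H" "y \<noteq> vz" "pt y = \<phi> (pt (s \<boxplus> w))" using pt_surj by blast
  obtain t v where tv: "t \<in> Pl" "v \<in> W" "y = t \<boxplus> v" using decomp[OF y(1)] .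
  have orth: "form z v = \<zero>" if z: "z \<in> W" "form z w = \<zero>" for z
  proof (cases "z = vz")
    case False
    have "form z (s \<boxplus> w) = \<zero>" using z s w by (simp add: form_simps)
    then have "\<phi> (pt z) \<perp> \<phi> (pt (s \<boxplus> w))" using stab_orth[OF \<phi>] z sw False by simp
    then have "form z y = \<zero>" using pt_orth[of z y] stab_fix[OF \<phi>] z False y by simp
    then show ?thesis unfolding tv(3) using z tv(1,2) by (simp add: form_simps)
  qed (use tv in simp)
  obtain c z where z: "c \<in> carrier K" "z \<in> carrier H" "v = z \<boxplus> c \<bullet> w" "form w z = \<zero>"
    using form_project[OF _ w(2)] w tv(2) by (metis W_in)
  have zW: "z \<in> W"
  proof -
    have "form p v = \<zero>" "form q v = \<zero>" "form p w = \<zero>" "form q w = \<zero>" using tv w unfolding W_def by auto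
    then have "form p z = \<zero>" "form q z = \<zero>" unfolding z(3) using z(1,2) w p q by (simp_all add: form_simps)
    then show ?thesis using z unfolding W_def by simp
  qed
  have zw: "form z w = \<zero>" using form_sym[of z w] z w by simp
  have "form z z = form z v" unfolding z(3) using z(1,2) w zw by (simp add: form_simps)
  then have "z = vz" using orth[OF zW zw] form_anisotropic z by simp
  then have v: "v = c \<bullet> w" using z w by simp
  have c: "c \<noteq> \<zero>"
  proof
    assume "c = \<zero>"
    then have "y = t" using tv v w by (simp add: smult_l_null)
    then have "form w y = \<zero>" using tv w by simp
    then have "\<phi> (pt w) \<perp> \<phi> (pt (s \<boxplus> w))" using pt_orth[of w y] stab_fix[OF \<phi> w] w y by simp
    then have "form w (s \<boxplus> w) = \<zero>" using stab_orth[OF \<phi>] w sw by simp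
    then have "form w w = \<zero>" using w s by (simp add: form_simps)
    then show False using form_nz w by simp
  qed
  note ic = field_inv[OF z(1) c]
  have "inv c \<bullet> y = (inv c \<bullet> t) \<boxplus> w" unfolding tv(3) v using tv(1) z(1) w ic smult_inv[OF z(1) c, of w] by (simp add: smult_r_distr)
  then have "pt y = pt ((inv c \<bullet> t) \<boxplus> w)" using pt_smult[OF y(1,2), of "inv c"] ic by simp
  then show ?thesis using y tv ic by (intro bexI[of _ "inv c \<bullet> t"]) auto
qed

lemma pt_sum_eq:
  assumes t: "t \<in> Pl" "t' \<in> Pl" and w: "w \<in> W" "w \<noteq> vz" and eq: "pt (t \<boxplus> w) = pt (t' \<boxplus> w)"
  shows "t = t'"
proof -
  obtain c where c: "c \<in> carrier K" "t' \<boxplus> w = c \<bullet> (t \<boxplus> w)"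
    using pt_eq[of "t \<boxplus> w" "t' \<boxplus> w"] eq sum_nz t w by auto
  then have e: "t' \<boxplus> w = c \<bullet> t \<boxplus> c \<bullet> w" using t w by (simp add: smult_r_distr)
  from decomp_eq(2)[OF t(2) w(1) _ _ e] have "w = c \<bullet> w" using c t w by simp
  then have "form w w = c \<otimes> form w w" using form_smult_left[OF c(1), of w w] w by simp
  then have "c = \<one>" using form_nz[of w] form_closed[of w w] w c(1) K.m_rcancel[of "form w w" c \<one>] by simp
  then show ?thesis using decomp_eq(1)[OF t(2) w(1) _ _ e] c t w by simp
qed

text \<open>A map fixing all points of \<open>W\<close> sends \<open>[s + w]\<close> to \<open>[t + w]\<close>, where \<open>t\<close> turns out not to
  depend on \<open>w\<close>; testing orthogonality of such points for all \<open>w\<close> shows that \<open>s \<mapsto> t\<close> preserves the form.\<close>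

definition trw :: "('a \<Rightarrow> 'a) \<Rightarrow> 'v \<Rightarrow> 'v \<Rightarrow> 'v" where
  "trw \<phi> w s = (SOME t. t \<in> Pl \<and> \<phi> (pt (s \<boxplus> w)) = pt (t \<boxplus> w))"

lemma trw:
  assumes "stab \<phi>" "s \<in> Pl" "w \<in> W" "w \<noteq> vz"
  shows "trw \<phi> w s \<in> Pl" "\<phi> (pt (s \<boxplus> w)) = pt (trw \<phi> w s \<boxplus> w)"
proof -
  have "\<exists>t. t \<in> Pl \<and> \<phi> (pt (s \<boxplus> w)) = pt (t \<boxplus> w)" using stab_ex[OF assms] by blast
  from someI_ex[OF this] show "trw \<phi> w s \<in> Pl" "\<phi> (pt (s \<boxplus> w)) = pt (trw \<phi> w s \<boxplus> w)"
    unfolding trw_def by auto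
qed

text \<open>The preimage of the point of \<open>z\<close> is orthogonal to \<open>x\<close> and
  \<open>y\<close>, hence to \<open>x + y\<close>.\<close>

lemma stab_collinear:
  assumes \<phi>: "stab \<phi>" and x: "x \<in> carrier H" "x \<noteq> vz" and y: "y \<in> carrier H" "y \<noteq> vz"
    and xy: "x \<boxplus> y \<noteq> vz" and z: "z \<in> carrier H"
    and x': "x' \<in> carrier H" "x' \<noteq> vz" "\<phi> (pt x) = pt x'" "form z x' = \<zero>"
    and y': "y' \<in> carrier H" "y' \<noteq> vz" "\<phi> (pt y) = pt y'" "form z y' = \<zero>"
    and u: "u \<in> carrier H" "u \<noteq> vz" "\<phi> (pt (x \<boxplus> y)) = pt u"
  shows "form z u = \<zero>"
proof (cases "z = vz")
  case False
  obtain z' where z': "z' \<in> carrier H" "z' \<noteq> vz" "\<phi> (pt z') = pt z" using stab_surj[OF \<phi> z False] by blast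
  have "form z' x = \<zero>" "form z' y = \<zero>"
    using stab_orth[OF \<phi> z'(1) x(1) z'(2) x(2)] stab_orth[OF \<phi> z'(1) y(1) z'(2) y(2)]
      pt_orth[OF z x'(1) False x'(2)] pt_orth[OF z y'(1) False y'(2)] x' y' z' by simp_all
  then have "form z' (x \<boxplus> y) = \<zero>" using z' x y by (simp add: form_simps)
  then have "\<phi> (pt z') \<perp> \<phi> (pt (x \<boxplus> y))" using stab_orth[OF \<phi> z'(1) _ z'(2) xy] x y by simp
  then show ?thesis using pt_orth[OF z u(1) False u(2)] z' u by simp
qed (use u in simp)

text \<open>Given \<open>r\<close> in the plane, \<open>k\<close> is chosen so that
  \<open>r + k w\<close> is orthogonal to \<open>trw \<phi> w s + w\<close>. This vector is
  orthogonal to \<open>v\<close> too, hence to the image of \<open>s + w + v\<close>, and that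
  equation says that both candidates have the same product with \<open>r\<close>.\<close>

lemma trw_add:
  assumes \<phi>: "stab \<phi>" and s: "s \<in> Pl" and w: "w \<in> W" "w \<noteq> vz" and v: "v \<in> W" "form w v = \<zero>"
  shows "trw \<phi> (w \<boxplus> v) s = trw \<phi> w s"
proof (cases "v = vz")
  case False
  have wv: "w \<boxplus> v \<in> W" "w \<boxplus> v \<noteq> vz"
  proof -
    show "w \<boxplus> v \<in> W" using w v by simp
    have "form w (w \<boxplus> v) = form w w" using w v by (simp add: form_simps)
    then show "w \<boxplus> v \<noteq> vz" using form_nz[OF W_in[OF w(1)] w(2)] w by auto
  qed
  note t = trw[OF \<phi> s w] and t' = trw[OF \<phi> s wv]
  show ?thesis
  proof (rule Pl_eqI[OF t'(1) t(1)])
    fix r assume r: "r \<in> Pl"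
    note n = field_inv[OF form_closed[of w w] form_nz[of w]]
    define k where "k = \<ominus> (form r (trw \<phi> w s) \<otimes> inv (form w w))"
    have fr: "form r (trw \<phi> w s) \<in> carrier K" "form r (trw \<phi> (w \<boxplus> v) s) \<in> carrier K" "form w w \<in> carrier K"
      using r t(1) t'(1) w form_closed by auto
    have k: "k \<in> carrier K" unfolding k_def using n w fr by simp
    have kw: "k \<otimes> form w w = \<ominus> form r (trw \<phi> w s)"
      unfolding k_def using n w fr by (simp add: K.l_minus K.m_assoc)
    let ?z = "r \<boxplus> k \<bullet> w"
    have z: "?z \<in> carrier H" using r k w by simp
    have 1: "form ?z (trw \<phi> w s \<boxplus> w) = \<zero>"
      using form_sum[OF r W_smult[OF k w(1)] t(1) w(1)] kw k w fr by (simp add: form_simps K.r_neg)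
    have 2: "form ?z v = \<zero>" using r k w v by (simp add: form_simps)
    have eq: "(s \<boxplus> w) \<boxplus> v = s \<boxplus> (w \<boxplus> v)" using s w v by (simp add: H.M.a_assoc)
    have "form ?z (trw \<phi> (w \<boxplus> v) s \<boxplus> (w \<boxplus> v)) = \<zero>"
    proof (rule stab_collinear[OF \<phi>, of "s \<boxplus> w" v ?z "trw \<phi> w s \<boxplus> w" v])
      show "\<phi> (pt (s \<boxplus> w)) = pt (trw \<phi> w s \<boxplus> w)" using t by simp
      show "\<phi> (pt v) = pt v" using stab_fix[OF \<phi> v(1) False] .
      show "\<phi> (pt (s \<boxplus> w \<boxplus> v)) = pt (trw \<phi> (w \<boxplus> v) s \<boxplus> (w \<boxplus> v))" unfolding eq using t' by simp
      show "s \<boxplus> w \<boxplus> v \<noteq> vz" unfolding eq using sum_nz s wv by simp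
    qed (use s w v t(1) t'(1) wv False z 1 2 sum_nz in simp_all)
    then have "form r (trw \<phi> (w \<boxplus> v) s) \<oplus> k \<otimes> form w w = \<zero>"
      using form_sum[OF r W_smult[OF k w(1)] t'(1) wv(1)] k w v by (simp add: form_simps)
    then show "form r (trw \<phi> (w \<boxplus> v) s) = form r (trw \<phi> w s)"
      unfolding kw using fr by (metis K.add.inv_closed K.minus_equality K.minus_minus)
  qed
qed (use w in simp)

lemma trw_orth:
  assumes \<phi>: "stab \<phi>" and s: "s \<in> Pl" and w: "w \<in> W" "w \<noteq> vz" and v: "v \<in> W" "v \<noteq> vz" and wv: "form w v = \<zero>"
  shows "trw \<phi> v s = trw \<phi> w s"
  using trw_add[OF \<phi> s w v(1) wv] trw_add[OF \<phi> s v w(1)] form_sym[of v w] wv w v by (simp add: H.M.a_comm)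

lemma W_orth_ex:
  assumes "w \<in> carrier H" "w \<noteq> vz" shows "\<exists>v\<in>W. v \<noteq> vz \<and> form w v = \<zero>"
proof -
  obtain z where z: "z \<perp> pt p" "z \<perp> pt q" "z \<perp> pt w" using orth_to_three[of "pt p" "pt q" "pt w"] pt_in p q assms by blast
  obtain v where v: "v \<in> carrier H" "v \<noteq> vz" "pt v = z" using pt_surj z orth_in by blast
  have "form v p = \<zero>" "form v q = \<zero>" "form v w = \<zero>" using pt_orth[OF v(1) _ v(2)] z v p q assms by auto
  then have "form p v = \<zero>" "form q v = \<zero>" "form w v = \<zero>" using form_sym[OF v(1)] p q assms by auto
  then show ?thesis using v unfolding W_def by blast
qed

text \<open>Write \<open>b = z + c w\<close>. The proportional vectors \<open>w\<close> and
  \<open>c w\<close> cannot be compared directly; both are compared with some \<open>u\<close> in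
  \<open>W\<close> orthogonal to them, which exists by the rank assumption.\<close>

lemma trw_const:
  assumes \<phi>: "stab \<phi>" and s: "s \<in> Pl" and w: "w \<in> W" "w \<noteq> vz" and b: "b \<in> W" "b \<noteq> vz"
  shows "trw \<phi> b s = trw \<phi> w s"
proof -
  obtain c z where z: "c \<in> carrier K" "z \<in> carrier H" "b = z \<boxplus> c \<bullet> w" "form w z = \<zero>"
    using form_project[OF _ w(2)] w b by (metis W_in)
  have zW: "z \<in> W"
  proof -
    have "form p b = \<zero>" "form q b = \<zero>" "form p w = \<zero>" "form q w = \<zero>" using b w unfolding W_def by auto
    then have "form p z = \<zero>" "form q z = \<zero>" unfolding z(3) using z(1,2) w p q by (simp_all add: form_simps)
    then show ?thesis using z unfolding W_def by simp
  qed
  show ?thesis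
  proof (cases "c = \<zero>")
    case True
    then have "b = z" using z w by (simp add: smult_l_null)
    then show ?thesis using trw_orth[OF \<phi> s w b] z by simp
  next
    case False
    let ?v = "c \<bullet> w"
    have v: "?v \<in> W" "?v \<noteq> vz" using smult_nz z w False by auto
    have "trw \<phi> b s = trw \<phi> ?v s"
      using trw_add[OF \<phi> s v zW] z w zW v form_smult_left[OF z(1)] by (simp add: H.M.a_comm)
    moreover obtain u where u: "u \<in> W" "u \<noteq> vz" "form w u = \<zero>" using W_orth_ex[OF W_in[OF w(1)] w(2)] by blast
    have "trw \<phi> u s = trw \<phi> ?v s" using trw_orth[OF \<phi> s v u(1,2)] u w z form_smult_left by simp
    ultimately show ?thesis using trw_orth[OF \<phi> s w u] by simp
  qed
qed

definition w0 :: 'v where "w0 = (SOME w. w \<in> W \<and> w \<noteq> vz)"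

lemma w0: "w0 \<in> W" "w0 \<noteq> vz"
proof -
  have "\<exists>w. w \<in> W \<and> w \<noteq> vz" using W_orth_ex[OF p] by blast
  from someI_ex[OF this] show "w0 \<in> W" "w0 \<noteq> vz" unfolding w0_def by auto
qed

definition tr :: "('a \<Rightarrow> 'a) \<Rightarrow> 'v \<Rightarrow> 'v" where "tr \<phi> s = trw \<phi> w0 s"

lemma tr_Pl [simp]: "\<lbrakk>stab \<phi>; s \<in> Pl\<rbrakk> \<Longrightarrow> tr \<phi> s \<in> Pl"
  unfolding tr_def using trw(1) w0 by blast

lemma tr_pt_sum: "\<lbrakk>stab \<phi>; s \<in> Pl; w \<in> W; w \<noteq> vz\<rbrakk> \<Longrightarrow> \<phi> (pt (s \<boxplus> w)) = pt (tr \<phi> s \<boxplus> w)"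
  unfolding tr_def using trw(2) trw_const[OF _ _ _ _ w0] by metis

lemma tr_unique: "\<lbrakk>stab \<phi>; s \<in> Pl; w \<in> W; w \<noteq> vz; t \<in> Pl; \<phi> (pt (s \<boxplus> w)) = pt (t \<boxplus> w)\<rbrakk> \<Longrightarrow> tr \<phi> s = t"
  using pt_sum_eq tr_pt_sum tr_Pl by metis

text \<open>In homogeneous coordinates \<open>c s + w0\<close> and \<open>s + w0 / c\<close>
  describe the same point.\<close>

lemma tr_smult:
  assumes \<phi>: "stab \<phi>" and s: "s \<in> Pl" and c: "c \<in> carrier K" "c \<noteq> \<zero>"
  shows "tr \<phi> (c \<bullet> s) = c \<bullet> tr \<phi> s"
proof (rule tr_unique[OF \<phi> _ w0])
  note ic = field_inv[OF c]
  let ?w = "inv c \<bullet> w0"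
  have w: "?w \<in> W" "?w \<noteq> vz" using w0 ic smult_nz[of "inv c" w0] by auto
  have cw: "c \<bullet> ?w = w0" using smult_assoc1[of c "inv c" w0] ic c w0 by simp
  have "pt (c \<bullet> s \<boxplus> w0) = pt (s \<boxplus> ?w)"
    using pt_smult[of "s \<boxplus> ?w" c] sum_nz[OF s w] s w c by (simp add: smult_r_distr cw)
  moreover have "pt (c \<bullet> tr \<phi> s \<boxplus> w0) = pt (tr \<phi> s \<boxplus> ?w)"
    using pt_smult[of "tr \<phi> s \<boxplus> ?w" c] sum_nz[OF tr_Pl[OF \<phi> s] w] tr_Pl[OF \<phi> s] w c by (simp add: smult_r_distr cw)
  ultimately show "\<phi> (pt (c \<bullet> s \<boxplus> w0)) = pt (c \<bullet> tr \<phi> s \<boxplus> w0)" using tr_pt_sum[OF \<phi> s w] by simp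
qed (use s c \<phi> in simp_all)

text \<open>The product of \<open>s\<close> and \<open>r\<close> is \<open>g\<close> exactly if
  \<open>s + w0\<close> is orthogonal to \<open>r + k w0\<close>, where
  \<open>k = - g / (w0, w0)\<close>. The value zero is left out since \<open>k w0\<close> has to be
  nonzero; \<open>tr_form\<close> recovers it by applying the equivalence to both products.\<close>

lemma tr_form_iff:
  assumes \<phi>: "stab \<phi>" and s: "s \<in> Pl" "r \<in> Pl" and g: "g \<in> carrier K" "g \<noteq> \<zero>"
  shows "form (tr \<phi> s) (tr \<phi> r) = g \<longleftrightarrow> form s r = g"
proof -
  have n: "form w0 w0 \<in> carrier K" "form w0 w0 \<noteq> \<zero>" using form_closed form_nz w0 by auto
  note inw = field_inv[OF n]
  define k where "k = (\<ominus> g) \<otimes> inv (form w0 w0)"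
  have k: "k \<in> carrier K" unfolding k_def using g inw by simp
  have kn: "k \<otimes> form w0 w0 = \<ominus> g" unfolding k_def using g inw n by (simp add: K.m_assoc)
  have "k \<noteq> \<zero>" using kn g n by (auto simp: K.minus_minus[symmetric])
      (metis K.add.inv_eq_1_iff K.l_null)
  then have kw: "k \<bullet> w0 \<in> W" "k \<bullet> w0 \<noteq> vz" using smult_nz k w0 by auto
  have eqv: "form x y \<oplus> k \<otimes> form w0 w0 = \<zero> \<longleftrightarrow> form x y = g" if "x \<in> Pl" "y \<in> Pl" for x y
    unfolding kn using form_closed[of x y] that g by (metis K.r_right_minus_eq K.minus_eq Pl_in)
  have f: "form (x \<boxplus> w0) (y \<boxplus> k \<bullet> w0) = form x y \<oplus> k \<otimes> form w0 w0" if "x \<in> Pl" "y \<in> Pl" for x y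
    using form_sum[OF that(1) w0(1) that(2) kw(1)] k w0 by (simp add: form_simps)
  have 1: "\<phi> (pt (s \<boxplus> w0)) = pt (tr \<phi> s \<boxplus> w0)" "\<phi> (pt (r \<boxplus> k \<bullet> w0)) = pt (tr \<phi> r \<boxplus> k \<bullet> w0)"
    using tr_pt_sum[OF \<phi>] s w0 kw by blast+
  have "form (tr \<phi> s \<boxplus> w0) (tr \<phi> r \<boxplus> k \<bullet> w0) = \<zero> \<longleftrightarrow> form (s \<boxplus> w0) (r \<boxplus> k \<bullet> w0) = \<zero>"
    using stab_orth[OF \<phi>, of "s \<boxplus> w0" "r \<boxplus> k \<bullet> w0"] pt_orth[of "tr \<phi> s \<boxplus> w0" "tr \<phi> r \<boxplus> k \<bullet> w0"] 1
      sum_nz s w0 kw tr_Pl[OF \<phi>] by simp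
  then show ?thesis using f eqv s tr_Pl[OF \<phi>] by simp
qed

lemma tr_form:
  assumes \<phi>: "stab \<phi>" and s: "s \<in> Pl" "r \<in> Pl"
  shows "form (tr \<phi> s) (tr \<phi> r) = form s r"
  using tr_form_iff[OF assms, of "form s r"] tr_form_iff[OF assms, of "form (tr \<phi> s) (tr \<phi> r)"]
    form_closed s tr_Pl[OF \<phi>] by (metis Pl_in)

lemma tr_nz: "\<lbrakk>stab \<phi>; s \<in> Pl; s \<noteq> vz\<rbrakk> \<Longrightarrow> tr \<phi> s \<noteq> vz"
  using tr_form[of \<phi> s s] form_nz[of s] by auto

lemma tr_comp:
  assumes "stab \<phi>" "stab \<psi>" "stab \<chi>" "\<And>x. x \<in> S \<Longrightarrow> \<chi> x = \<phi> (\<psi> x)" "s \<in> Pl"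
  shows "tr \<chi> s = tr \<phi> (tr \<psi> s)"
proof (rule tr_unique[OF assms(3,5) w0])
  show "tr \<phi> (tr \<psi> s) \<in> Pl" using assms by simp
  have "pt (s \<boxplus> w0) \<in> S" using pt_in sum_nz assms w0 by simp
  then show "\<chi> (pt (s \<boxplus> w0)) = pt (tr \<phi> (tr \<psi> s) \<boxplus> w0)"
    using assms tr_pt_sum[OF assms(2,5) w0] tr_pt_sum[OF assms(1) _ w0] by simp
qed

text \<open>A point of the plane has no component in \<open>W\<close>, so the definition of
  \<open>tr\<close> does not cover it. It is collinear with the points of \<open>s + w0\<close> and
  of \<open>- w0\<close>, whose images are known.\<close>

lemma tr_pt:
  assumes \<phi>: "stab \<phi>" and s: "s \<in> Pl" "s \<noteq> vz"
  shows "\<phi> (pt s) = pt (tr \<phi> s)"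
proof -
  have "\<phi> (pt s) \<in> S" using aut_in[of \<phi> "pt s"] pt_in s \<phi> unfolding stab_def by simp
  then obtain y where y: "y \<in> carrier H" "y \<noteq> vz" "pt y = \<phi> (pt s)" using pt_surj by blast
  let ?t = "tr \<phi> s" and ?m = "(\<ominus> \<one>) \<bullet> w0"
  have t: "?t \<in> Pl" "?t \<noteq> vz" using tr_nz \<phi> s by auto
  have yw: "form w y = \<zero>" if w: "w \<in> W" for w
  proof (cases "w = vz")
    case False
    have "\<phi> (pt w) \<perp> \<phi> (pt s)" using stab_orth[OF \<phi>] w s False by simp
    then show ?thesis using stab_fix[OF \<phi> w False] pt_orth[of w y] y w False by simp
  qed (use y in simp)
  have yPl: "y \<in> Pl" unfolding Pl_def using y yw form_sym[OF y(1)] by auto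
  obtain c z where z: "c \<in> carrier K" "z \<in> carrier H" "y = z \<boxplus> c \<bullet> ?t" "form ?t z = \<zero>"
    using form_project[of ?t y] t y by auto
  have "z \<in> Pl"
  proof -
    have "form z w = \<zero>" if w: "w \<in> W" for w
    proof -
      have "form y w = \<zero>" using yPl w by simp
      then show ?thesis unfolding z(3) using z(1,2) t w by (simp add: form_simps)
    qed
    then show ?thesis unfolding Pl_def using z by simp
  qed
  have m: "?m \<in> W" "?m \<noteq> vz" using w0 smult_nz[of "\<ominus> \<one>" w0] one_not_zero by auto
  have sm: "(s \<boxplus> w0) \<boxplus> ?m = s"
    using s w0 by (simp add: H.M.a_assoc smult_l_minus H.M.r_neg)
  have zt: "form z ?t = \<zero>" using form_sym[of z ?t] z t by simp
  have "form z y = \<zero>"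
  proof (rule stab_collinear[OF \<phi>, of "s \<boxplus> w0" ?m z "?t \<boxplus> w0" ?m])
    show "\<phi> (pt (s \<boxplus> w0)) = pt (?t \<boxplus> w0)" using tr_pt_sum \<phi> s w0 by blast
    show "\<phi> (pt ?m) = pt ?m" using stab_fix[OF \<phi> m] .
    show "\<phi> (pt (s \<boxplus> w0 \<boxplus> ?m)) = pt y" unfolding sm using y by simp
    show "s \<boxplus> w0 \<boxplus> ?m \<noteq> vz" unfolding sm using s by simp
    show "form z (?t \<boxplus> w0) = \<zero>" using \<open>z \<in> Pl\<close> zt t w0 by (simp add: form_simps)
  qed (use s t w0 m y z \<open>z \<in> Pl\<close> sum_nz in simp_all)
  moreover have "form z z = form z y" unfolding z(3) using z(1,2) t zt by (simp add: form_simps)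
  ultimately have "z = vz" using form_anisotropic z by simp
  then have yc: "y = c \<bullet> ?t" using z t by simp
  then have "pt ?t = pt y" using pt_eq[of ?t y] t y z by auto
  then show ?thesis using y by simp
qed

text \<open>The isometry is \<open>tr \<phi>\<close> on the plane and the identity on
  \<open>W\<close>; uniqueness of the decomposition makes it well defined.\<close>

lemma stab_isometry:
  assumes \<phi>: "stab \<phi>"
  obtains \<Phi> where "\<And>x. x \<in> carrier H \<Longrightarrow> \<Phi> x \<in> carrier H"
    "\<And>x y. \<lbrakk>x \<in> carrier H; y \<in> carrier H\<rbrakk> \<Longrightarrow> form (\<Phi> x) (\<Phi> y) = form x y"
    "\<And>x. \<lbrakk>x \<in> carrier H; x \<noteq> vz\<rbrakk> \<Longrightarrow> \<phi> (pt x) = pt (\<Phi> x)"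
    "\<And>s w. \<lbrakk>s \<in> Pl; w \<in> W\<rbrakk> \<Longrightarrow> \<Phi> (s \<boxplus> w) = tr \<phi> s \<boxplus> w"
proof -
  define \<Phi> where "\<Phi> x = (SOME y. \<exists>s w. s \<in> Pl \<and> w \<in> W \<and> x = s \<boxplus> w \<and> y = tr \<phi> s \<boxplus> w)" for x
  have sum: "\<Phi> (s \<boxplus> w) = tr \<phi> s \<boxplus> w" if s: "s \<in> Pl" and w: "w \<in> W" for s w
    unfolding \<Phi>_def
  proof (rule some_equality)
    show "\<exists>s' w'. s' \<in> Pl \<and> w' \<in> W \<and> s \<boxplus> w = s' \<boxplus> w' \<and> tr \<phi> s \<boxplus> w = tr \<phi> s' \<boxplus> w'" using s w by blast
    fix y assume "\<exists>s' w'. s' \<in> Pl \<and> w' \<in> W \<and> s \<boxplus> w = s' \<boxplus> w' \<and> y = tr \<phi> s' \<boxplus> w'"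
    then show "y = tr \<phi> s \<boxplus> w" using decomp_eq[OF s w] by metis
  qed
  have 1: "\<Phi> x \<in> carrier H" if x: "x \<in> carrier H" for x
    using decomp[OF x] sum tr_Pl[OF \<phi>] by (metis H.M.add.m_closed Pl_in W_in)
  have 2: "form (\<Phi> x) (\<Phi> y) = form x y" if x: "x \<in> carrier H" and y: "y \<in> carrier H" for x y
  proof -
    obtain s w where sw: "s \<in> Pl" "w \<in> W" "x = s \<boxplus> w" using decomp[OF x] .
    obtain s' w' where sw': "s' \<in> Pl" "w' \<in> W" "y = s' \<boxplus> w'" using decomp[OF y] .
    show ?thesis using sum form_sum sw sw' tr_Pl[OF \<phi>] tr_form[OF \<phi>] by simp
  qed
  have 3: "\<phi> (pt x) = pt (\<Phi> x)" if x: "x \<in> carrier H" "x \<noteq> vz" for x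
  proof -
    obtain s w where sw: "s \<in> Pl" "w \<in> W" "x = s \<boxplus> w" using decomp[OF x(1)] .
    show ?thesis
    proof (cases "w = vz")
      case True
      then have "x = s" "\<Phi> x = tr \<phi> s" using sw sum[OF sw(1,2)] tr_Pl[OF \<phi> sw(1)] by auto
      then show ?thesis using tr_pt[OF \<phi> sw(1)] x by simp
    next
      case False
      then show ?thesis using tr_pt_sum[OF \<phi> sw(1,2)] sum[OF sw(1,2)] sw by simp
    qed
  qed
  show ?thesis using that[OF 1 2 3 sum] .
qed

lemma rot_stab: assumes "\<rho> \<in> rot (pt p) (pt q)" shows "stab \<rho>"
proof -
  have e: "pt p \<in> S" "pt q \<in> S" using pt_in p q by auto
  have ne: "pt p \<noteq> pt q" using pt_orth[of p q] pq p q orth_irrefl by metis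
  have "\<rho> (pt w) = pt w" if w: "w \<in> W" "w \<noteq> vz" for w
    using rot_fix[OF e ne assms, of "pt w"] pt_orth[of w p] pt_orth[of w q] form_sym[of w p] form_sym[of w q] p q w
    unfolding W_def by auto
  then show ?thesis using rot_aut[OF e ne assms] unfolding stab_def by blast
qed

end

section \<open>Infinitesimal rotations\<close>

context ordered_record_field
begin

lemma P_div:
  assumes "x \<in> carrier R" "y \<in> P" "y \<noteq> \<zero>" "x \<otimes> y \<in> P" shows "x \<in> P"
proof -
  have y: "y \<in> carrier R" "inv y \<in> carrier R" "y \<otimes> inv y = \<one>" using assms P_in field_Units by auto
  have "x \<otimes> y \<otimes> y \<otimes> (inv y \<otimes> inv y) = x \<otimes> ((y \<otimes> inv y) \<otimes> (y \<otimes> inv y))" using assms(1) y(1,2) by (simp add: m_ac)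
  then have "x = x \<otimes> y \<otimes> y \<otimes> (inv y \<otimes> inv y)" using assms(1) y by simp
  moreover have "x \<otimes> y \<otimes> y \<otimes> (inv y \<otimes> inv y) \<in> P" using P_mult[OF P_mult[OF assms(4,2)] P_sq[OF y(2)]] .
  ultimately show ?thesis by simp
qed

lemma P_half:
  assumes "x \<in> carrier R" "x \<oplus> x \<in> P" shows "x \<in> P"
proof (rule ccontr)
  assume "x \<notin> P"
  then have "(x \<oplus> x) \<oplus> (\<ominus> x) \<in> P" using assms total P_add by blast
  moreover have "(x \<oplus> x) \<oplus> (\<ominus> x) = x" using assms(1) by algebra
  ultimately show False using \<open>x \<notin> P\<close> by simp
qed

lemma one_plus_P_nz: "x \<in> P \<Longrightarrow> \<one> \<oplus> x \<noteq> \<zero>"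
  using m1_not_P P_in by (metis minus_equality a_comm one_closed)

text \<open>Only an upper bound is imposed: the notion is applied to squared lengths, which are
  nonnegative, and it is then inherited by smaller elements.\<close>

definition small :: "'a \<Rightarrow> bool" where "small d \<longleftrightarrow> d \<in> carrier R \<and> (\<forall>n. \<one> \<ominus> nK n \<otimes> d \<in> P)"

lemma small_mult:
  assumes d: "small d" and k: "k \<in> carrier R" "k \<in> P" "\<one> \<ominus> k \<in> P"
  shows "small (k \<otimes> d)"
  unfolding small_def
proof (intro conjI allI)
  have dR: "d \<in> carrier R" using d unfolding small_def by blast
  then show "k \<otimes> d \<in> carrier R" using k by simp
  fix n
  have "(\<one> \<ominus> k) \<oplus> k \<otimes> (\<one> \<ominus> nK n \<otimes> d) \<in> P" using d k P_add P_mult unfolding small_def by simp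
  moreover have "(\<one> \<ominus> k) \<oplus> k \<otimes> (\<one> \<ominus> nK n \<otimes> d) = \<one> \<ominus> nK n \<otimes> (k \<otimes> d)"
    using dR k(1) nK_in[of n] one_closed by algebra
  ultimately show "\<one> \<ominus> nK n \<otimes> (k \<otimes> d) \<in> P" by simp
qed

lemma small_mono:
  assumes d: "small d" and d': "d' \<in> carrier R" "d \<ominus> d' \<in> P"
  shows "small d'"
  unfolding small_def
proof (intro conjI allI)
  have dR: "d \<in> carrier R" using d unfolding small_def by blast
  fix n
  have "(\<one> \<ominus> nK n \<otimes> d) \<oplus> nK n \<otimes> (d \<ominus> d') \<in> P" using d d' P_add P_mult nK_P unfolding small_def by simp
  moreover have "(\<one> \<ominus> nK n \<otimes> d) \<oplus> nK n \<otimes> (d \<ominus> d') = \<one> \<ominus> nK n \<otimes> d'"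
    using dR d'(1) nK_in[of n] one_closed by algebra
  ultimately show "\<one> \<ominus> nK n \<otimes> d' \<in> P" by simp
qed (use d' in simp)

lemma small_add:
  assumes d: "small d" "small d'" shows "small (d \<oplus> d')"
  unfolding small_def
proof (intro conjI allI)
  have dR: "d \<in> carrier R" "d' \<in> carrier R" using d unfolding small_def by blast+
  then show "d \<oplus> d' \<in> carrier R" by simp
  fix n
  let ?x = "\<one> \<ominus> nK n \<otimes> (d \<oplus> d')"
  have "(\<one> \<ominus> nK (n + n) \<otimes> d) \<oplus> (\<one> \<ominus> nK (n + n) \<otimes> d') \<in> P" using d P_add unfolding small_def by blast
  moreover have "(\<one> \<ominus> nK (n + n) \<otimes> d) \<oplus> (\<one> \<ominus> nK (n + n) \<otimes> d') = ?x \<oplus> ?x"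
    unfolding nK_add using dR nK_in[of n] one_closed by algebra
  ultimately show "?x \<in> P" using P_half[of ?x] dR by (simp add: minus_eq)
qed

text \<open>The inverse of an infinitely large element is infinitesimal and below one, so its square
  is infinitesimal too. The square is what governs the cosine of the rotation.\<close>

lemma infinitesimal_ex:
  assumes a: "a \<in> carrier R" and big: "\<And>n. nK n \<ominus> a \<notin> P"
  shows "\<exists>e\<in>carrier R. e \<noteq> \<zero> \<and> small (e \<otimes> e)"
proof -
  have ge: "a \<ominus> nK n \<in> P" for n
  proof -
    have "\<ominus> (nK n \<ominus> a) \<in> P" using total[of "nK n \<ominus> a"] big[of n] a by (simp add: minus_eq)
    moreover have "\<ominus> (nK n \<ominus> a) = a \<ominus> nK n" using a nK_in[of n] by algebra
    ultimately show ?thesis by simp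
  qed
  have aP: "a \<in> P" using ge[of 0] a by (simp add: minus_eq)
  have "a \<noteq> \<zero>" using ge[of 1] m1_not_P by (auto simp: minus_eq)
  then have e: "inv a \<in> carrier R" "a \<otimes> inv a = \<one>" "inv a \<noteq> \<zero>" using a field_Units nonzero_imp_inverse_nonzero by auto
  let ?e = "inv a"
  have "a \<otimes> (?e \<otimes> ?e) = ?e" using a e m_assoc[of a ?e ?e] by simp
  then have eP: "?e \<in> P" using P_mult[OF aP P_sq[OF e(1)]] by simp
  have lin: "\<one> \<ominus> nK n \<otimes> ?e \<in> P" for n
  proof -
    have "?e \<otimes> (a \<ominus> nK n) = a \<otimes> ?e \<ominus> nK n \<otimes> ?e" using a e(1) nK_in[of n] by algebra
    then show ?thesis using P_mult[OF eP ge[of n]] e by simp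
  qed
  have "small (?e \<otimes> ?e)"
  proof (rule small_mult)
    show "small ?e" unfolding small_def using e lin by blast
    show "\<one> \<ominus> ?e \<in> P" using lin[of 1] e by simp
  qed (use e eP in auto)
  then show ?thesis using e by blast
qed

text \<open>If \<open>c\<close> is the positive square root of \<open>1 / (1 + d)\<close>, then \<open>(c - 1 + d)(1 + d) = c(1 + d) - 1 + d\<^sup>2\<close>
  is nonnegative, hence \<open>2 - 2c \<le> 2d\<close>.\<close>

lemma small_cos:
  assumes d: "small d" "d \<in> P" and c: "c \<in> P" "c \<otimes> c \<otimes> (\<one> \<oplus> d) = \<one>"
  shows "small (\<one> \<oplus> \<one> \<ominus> (c \<oplus> c))"
proof (rule small_mono[OF small_add[OF d(1) d(1)]])
  have R: "c \<in> carrier R" "d \<in> carrier R" using c d P_in by auto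
  have d1: "\<one> \<oplus> d \<in> P" "\<one> \<oplus> d \<noteq> \<zero>" using P_add P_1 d one_plus_P_nz by auto
  let ?b = "c \<otimes> (\<one> \<oplus> d)"
  have bP: "?b \<in> P" using P_mult c d1 by blast
  have "?b \<otimes> ?b = (c \<otimes> c \<otimes> (\<one> \<oplus> d)) \<otimes> (\<one> \<oplus> d)" using R by (simp add: m_ac)
  then have bb: "?b \<otimes> ?b = \<one> \<oplus> d" using c R by simp
  have "(?b \<ominus> \<one>) \<otimes> (\<one> \<oplus> ?b) = ?b \<otimes> ?b \<ominus> \<one>" using R one_closed by algebra
  also have "\<dots> = d" unfolding bb using R one_closed by algebra
  finally have "?b \<ominus> \<one> \<in> P" using P_div[of "?b \<ominus> \<one>" "\<one> \<oplus> ?b"] P_add[OF P_1 bP] one_plus_P_nz[OF bP] d R by (simp add: minus_eq)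
  then have "(?b \<ominus> \<one>) \<oplus> d \<otimes> d \<in> P" using P_add P_sq R by simp
  moreover have "(c \<ominus> \<one> \<oplus> d) \<otimes> (\<one> \<oplus> d) = (?b \<ominus> \<one>) \<oplus> d \<otimes> d" using R one_closed by algebra
  ultimately have x: "c \<ominus> \<one> \<oplus> d \<in> P" using P_div[of "c \<ominus> \<one> \<oplus> d" "\<one> \<oplus> d"] d1 R by (simp add: minus_eq)
  have "(d \<oplus> d) \<ominus> (\<one> \<oplus> \<one> \<ominus> (c \<oplus> c)) = (c \<ominus> \<one> \<oplus> d) \<oplus> (c \<ominus> \<one> \<oplus> d)" using R one_closed by algebra
  then show "(d \<oplus> d) \<ominus> (\<one> \<oplus> \<one> \<ominus> (c \<oplus> c)) \<in> P" using P_add[OF x x] by simp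
  show "\<one> \<oplus> \<one> \<ominus> (c \<oplus> c) \<in> carrier R" using R by (simp add: minus_eq)
qed

end

section \<open>Unit vectors and the ordering of the scalars\<close>

context coordinatized_orthoset
begin

lemma plane_ex:
  assumes e: "e \<in> S" "f \<in> S" "e \<noteq> f"
  obtains p q where "coordinate_plane S orth rot K H form pt p q" "pt p = e" "rot e f = rot (pt p) (pt q)"
proof -
  obtain g where g: "g \<perp> e" "\<And>z. z \<perp> e \<and> z \<perp> f \<longleftrightarrow> z \<perp> e \<and> z \<perp> g" using orth_partner[OF e] by blast
  obtain p where p: "p \<in> carrier H" "p \<noteq> vz" "pt p = e" using pt_surj e by blast
  obtain q where q: "q \<in> carrier H" "q \<noteq> vz" "pt q = g" using pt_surj g orth_in by blast
  have "form p q = \<zero>" using pt_orth[OF p(1) q(1) p(2) q(2)] p q g orth_sym by blast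
  then have "coordinate_plane S orth rot K H form pt p q" using p q by unfold_locales
  moreover have "rot e f = rot e g" using rot_same[OF e(1,2) e(1) orth_in[OF g(1)] g(2)] .
  ultimately show ?thesis using that p q by simp
qed

lemma rot_isometry:
  assumes e: "e \<in> S" "f \<in> S" "e \<noteq> f" and r: "\<rho> \<in> rot e f"
  obtains \<Phi> where "\<And>x. x \<in> carrier H \<Longrightarrow> \<Phi> x \<in> carrier H"
    "\<And>x y. \<lbrakk>x \<in> carrier H; y \<in> carrier H\<rbrakk> \<Longrightarrow> form (\<Phi> x) (\<Phi> y) = form x y"
    "\<And>x. \<lbrakk>x \<in> carrier H; x \<noteq> vz\<rbrakk> \<Longrightarrow> \<rho> (pt x) = pt (\<Phi> x)"
proof -
  obtain p q where pq: "coordinate_plane S orth rot K H form pt p q" "pt p = e" "rot e f = rot (pt p) (pt q)"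
    using plane_ex[OF e] .
  interpret pl: coordinate_plane S orth rot K H form pt p q by (rule pq(1))
  show ?thesis using pl.stab_isometry[OF pl.rot_stab[of \<rho>]] r pq that by metis
qed

lemma unit_nz: "\<lbrakk>x \<in> carrier H; form x x = \<one>\<rbrakk> \<Longrightarrow> x \<noteq> vz"
  using one_not_zero by auto

text \<open>A rotation takes the line of a known unit vector to the line of \<open>x\<close>, and it
  is induced by an isometry.\<close>

lemma normalize:
  assumes x: "x \<in> carrier H" "x \<noteq> vz"
  obtains c where "c \<in> carrier K" "c \<noteq> \<zero>" "form (c \<bullet> x) (c \<bullet> x) = \<one>"
proof -
  obtain u where u: "u \<in> carrier H" "form u u = \<one>" using unit_vector by blast
  have un: "u \<noteq> vz" using unit_nz u by blast
  have "\<exists>v\<in>carrier H. form v v = \<one> \<and> pt v = pt x"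
  proof (cases "pt u = pt x")
    case True then show ?thesis using u by blast
  next
    case False
    have S: "pt u \<in> S" "pt x \<in> S" using pt_in u un x by auto
    obtain \<rho> where r: "\<rho> \<in> rot (pt u) (pt x)" "\<rho> (pt u) = pt x" using rot_trans[OF S False] by blast
    obtain \<Phi> where "\<And>x. x \<in> carrier H \<Longrightarrow> \<Phi> x \<in> carrier H"
      "\<And>x y. \<lbrakk>x \<in> carrier H; y \<in> carrier H\<rbrakk> \<Longrightarrow> form (\<Phi> x) (\<Phi> y) = form x y"
      "\<And>x. \<lbrakk>x \<in> carrier H; x \<noteq> vz\<rbrakk> \<Longrightarrow> \<rho> (pt x) = pt (\<Phi> x)" using rot_isometry[OF S False r(1)] by blast
    then show ?thesis using u un r by (intro bexI[of _ "\<Phi> u"]) auto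
  qed
  then obtain v where v: "v \<in> carrier H" "form v v = \<one>" "pt v = pt x" by blast
  have vn: "v \<noteq> vz" using unit_nz v by blast
  obtain c where c: "c \<in> carrier K" "v = c \<bullet> x" using pt_eq[OF x(1) v(1) x(2) vn] v by auto
  moreover have "c \<noteq> \<zero>" using c vn x by (auto simp: smult_l_null)
  ultimately show ?thesis using that v by simp
qed

lemma orthonormal_pair:
  obtains u v where "u \<in> carrier H" "v \<in> carrier H" "form u u = \<one>" "form v v = \<one>" "form u v = \<zero>"
proof -
  obtain u where u: "u \<in> carrier H" "form u u = \<one>" using unit_vector by blast
  have un: "u \<noteq> vz" using unit_nz u by blast
  obtain g where g: "g \<perp> pt u" using orth_third[OF pt_in[OF u(1) un] pt_in[OF u(1) un]] by blast
  obtain x where x: "x \<in> carrier H" "x \<noteq> vz" "pt x = g" using pt_surj g orth_in by blast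
  have xu: "form u x = \<zero>" using pt_orth[OF u(1) x(1) un x(2)] x g orth_sym by blast
  obtain c where c: "c \<in> carrier K" "c \<noteq> \<zero>" "form (c \<bullet> x) (c \<bullet> x) = \<one>" using normalize[OF x(1,2)] .
  have "form u (c \<bullet> x) = \<zero>" using xu c u x by (simp add: form_smult_right)
  then show ?thesis using that[of u "c \<bullet> x"] u c x by simp
qed

text \<open>Normalise \<open>u + a v\<close>, of norm \<open>1 + a^2\<close>, for orthonormal
  \<open>u\<close> and \<open>v\<close>.\<close>

lemma pythagorean:
  assumes a: "a \<in> carrier K"
  shows "\<exists>b\<in>carrier K. b \<otimes> b \<otimes> (\<one> \<oplus> a \<otimes> a) = \<one>"
proof -
  obtain u v where uv: "u \<in> carrier H" "v \<in> carrier H" "form u u = \<one>" "form v v = \<one>" "form u v = \<zero>" using orthonormal_pair .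
  have vu: "form v u = \<zero>" using form_sym uv by simp
  let ?y = "u \<boxplus> a \<bullet> v"
  have y: "?y \<in> carrier H" "form ?y ?y = \<one> \<oplus> a \<otimes> a" "form u ?y = \<one>"
    using uv vu a by (simp_all add: form_simps)
  have "?y \<noteq> vz" using y uv one_not_zero by auto
  then obtain c where c: "c \<in> carrier K" "form (c \<bullet> ?y) (c \<bullet> ?y) = \<one>" using normalize[OF y(1)] by blast
  have "form (c \<bullet> ?y) (c \<bullet> ?y) = c \<otimes> (c \<otimes> form ?y ?y)"
    using form_smult_left[OF c(1) y(1), of "c \<bullet> ?y"] form_smult_right[OF c(1) y(1) y(1)] c(1) y(1) by simp
  then have "c \<otimes> c \<otimes> (\<one> \<oplus> a \<otimes> a) = \<one>" using c y a by (simp add: K.m_assoc)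
  then show ?thesis using c by blast
qed

lemma ordering_ex: "\<exists>P. ordered_record_field K P"
proof -
  obtain P where "cone P" "\<forall>a\<in>carrier K. a \<in> P \<or> \<ominus> a \<in> P"
    using total_cone_ex[OF pythagorean_squares_cone[OF pythagorean]] by blast
  then have "ordered_record_field K P" by unfold_locales auto
  then show ?thesis by blast
qed

end

locale ordered_coordinates = coordinatized_orthoset S orth rot K H form pt + ordered_record_field K P
  for S :: "'a set" and orth (infix \<open>\<perp>\<close> 50) and rot
    and K :: "('k, 'm) ring_scheme" (structure) and H :: "('k, 'v, 'n) module_scheme" (structure) and form and pt and P
begin

lemma norm_P: assumes "x \<in> carrier H" shows "form x x \<in> P"
proof (cases "x = vz")
  case True then show ?thesis using P_0 assms by simp
next
  case False
  obtain c where c: "c \<in> carrier K" "c \<noteq> \<zero>" "form (c \<bullet> x) (c \<bullet> x) = \<one>" using normalize[OF assms False] .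
  note ic = field_inv[OF c(1,2)]
  have "x = inv c \<bullet> (c \<bullet> x)" using smult_inv c assms by simp
  then have "form x x = form (inv c \<bullet> (c \<bullet> x)) (inv c \<bullet> (c \<bullet> x))" by simp
  also have "\<dots> = inv c \<otimes> inv c"
    using form_smult_left[of "inv c" "c \<bullet> x" "inv c \<bullet> (c \<bullet> x)"] form_smult_right[of "inv c" "c \<bullet> x" "c \<bullet> x"] c ic assms by simp
  finally show ?thesis using P_sq ic by simp
qed

section \<open>Infinitesimal distance between points\<close>

definition dN :: "'v \<Rightarrow> 'v \<Rightarrow> 'k" where "dN u v = form u u \<oplus> form v v \<ominus> (form u v \<oplus> form u v)"

lemma dN_commute: "\<lbrakk>u \<in> carrier H; v \<in> carrier H\<rbrakk> \<Longrightarrow> dN u v = dN v u"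
  unfolding dN_def using form_sym[of u v] form_closed by (simp add: K.a_comm)

text \<open>\<open>dN u v\<close> is the norm of \<open>u - v\<close>. Unit vectors on a line are
  determined up to sign only, so nearness asks for some choice of representatives.\<close>

definition near :: "'a \<Rightarrow> 'a \<Rightarrow> bool" where
  "near x y \<longleftrightarrow> (\<exists>u\<in>carrier H. \<exists>v\<in>carrier H. form u u = \<one> \<and> form v v = \<one> \<and> pt u = x \<and> pt v = y \<and> small (dN u v))"

lemma unit_rep: assumes "x \<in> S" obtains u where "u \<in> carrier H" "form u u = \<one>" "pt u = x"
proof -
  obtain y where y: "y \<in> carrier H" "y \<noteq> vz" "pt y = x" using pt_surj assms by blast
  obtain c where c: "c \<in> carrier K" "c \<noteq> \<zero>" "form (c \<bullet> y) (c \<bullet> y) = \<one>" using normalize[OF y(1,2)] .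
  show ?thesis using that[of "c \<bullet> y"] c y pt_smult by simp
qed

lemma unit_prop:
  assumes "u \<in> carrier H" "v \<in> carrier H" "form u u = \<one>" "form v v = \<one>" "pt u = pt v"
  obtains c where "c \<in> carrier K" "v = c \<bullet> u" "c \<otimes> c = \<one>"
proof -
  obtain c where c: "c \<in> carrier K" "v = c \<bullet> u" using pt_eq[of u v] unit_nz assms by auto
  have "form v v = c \<otimes> (c \<otimes> form u u)"
    unfolding c(2) using form_smult_left[OF c(1), of u "c \<bullet> u"] form_smult_right[OF c(1), of u u] c(1) assms(1) by simp
  then show ?thesis using that[OF c] c assms by simp
qed

lemma near_sym: "near x y \<Longrightarrow> near y x"
  unfolding near_def using dN_commute by metis

text \<open>The norm of \<open>u - 2 v + w\<close> is nonnegative; by the parallelogram law this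
  bounds the squared distance of \<open>u\<close> and \<open>w\<close> by twice the sum of the other
  two. Beforehand \<open>w\<close> is multiplied by the sign \<open>c\<close> that matches the two
  representatives of \<open>y\<close>.\<close>

lemma near_trans:
  assumes "near x y" "near y z" shows "near x z"
proof -
  obtain u v where u: "u \<in> carrier H" "v \<in> carrier H" "form u u = \<one>" "form v v = \<one>" "pt u = x" "pt v = y" "small (dN u v)"
    using assms unfolding near_def by blast
  obtain v' w where v: "v' \<in> carrier H" "w \<in> carrier H" "form v' v' = \<one>" "form w w = \<one>" "pt v' = y" "pt w = z" "small (dN v' w)"
    using assms unfolding near_def by blast
  obtain c where c: "c \<in> carrier K" "v' = c \<bullet> v" "c \<otimes> c = \<one>" using unit_prop[of v v'] u v by metis
  have cn: "c \<noteq> \<zero>" using c one_not_zero by auto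
  let ?w = "c \<bullet> w"
  have w: "?w \<in> carrier H" "form ?w ?w = \<one>" "pt ?w = z"
    using form_smult_left[OF c(1), of w ?w] form_smult_right[OF c(1), of w w] c v pt_smult[of w c] unit_nz cn
    by (simp_all add: K.m_assoc[symmetric])
  have "form v' w = form v ?w" using c u v by (simp add: form_simps)
  then have D2: "small (dN v ?w)" using v u w unfolding dN_def by simp
  define al where "al = form u v"
  define be where "be = form v ?w"
  define ga where "ga = form u ?w"
  have R: "al \<in> carrier K" "be \<in> carrier K" "ga \<in> carrier K" unfolding al_def be_def ga_def using form_closed u w by auto
  have sy: "form v u = al" "form ?w v = be" "form ?w u = ga" unfolding al_def be_def ga_def using form_sym u w by auto
  have D: "dN u v = \<one> \<oplus> \<one> \<ominus> (al \<oplus> al)" "dN v ?w = \<one> \<oplus> \<one> \<ominus> (be \<oplus> be)" "dN u ?w = \<one> \<oplus> \<one> \<ominus> (ga \<oplus> ga)"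
    unfolding dN_def al_def be_def ga_def using u w by auto
  let ?x = "u \<boxplus> ?w \<boxplus> (\<ominus> (\<one> \<oplus> \<one>)) \<bullet> v"
  have x: "?x \<in> carrier H" using u w by simp
  have m: "\<ominus> (\<one> \<oplus> \<one>) \<in> carrier K" by simp
  have uw: "u \<boxplus> ?w \<in> carrier H" "(\<ominus> (\<one> \<oplus> \<one>)) \<bullet> v \<in> carrier H" using u w by auto
  have "form ?x ?x = (\<one> \<oplus> ga \<oplus> (\<ominus> (\<one> \<oplus> \<one>)) \<otimes> al) \<oplus> (ga \<oplus> \<one> \<oplus> (\<ominus> (\<one> \<oplus> \<one>)) \<otimes> be)
      \<oplus> (\<ominus> (\<one> \<oplus> \<one>)) \<otimes> (al \<oplus> be \<oplus> (\<ominus> (\<one> \<oplus> \<one>)) \<otimes> \<one>)"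
  proof -
    have l: "form y ?x = form y u \<oplus> form y ?w \<oplus> (\<ominus> (\<one> \<oplus> \<one>)) \<otimes> form y v" if y: "y \<in> carrier H" for y
      using form_add_right[OF uw y] form_add_right[OF u(1) w(1) y] form_smult_right[OF m u(2) y] by simp
    have "form ?x ?x = form u ?x \<oplus> form ?w ?x \<oplus> (\<ominus> (\<one> \<oplus> \<one>)) \<otimes> form v ?x"
      using form_add_left[OF uw x] form_add_left[OF u(1) w(1) x] form_smult_left[OF m u(2) x] by simp
    then show ?thesis unfolding l[OF u(1)] l[OF w(1)] l[OF u(2)] using u w sy
      unfolding al_def[symmetric] be_def[symmetric] ga_def[symmetric] by simp
  qed
  also have "\<dots> = (dN u v \<oplus> dN u v \<oplus> (dN v ?w \<oplus> dN v ?w)) \<ominus> dN u ?w"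
  proof -
    define t where "t = \<one> \<oplus> \<one>"
    have t: "t \<in> carrier K" "t \<otimes> t = t \<oplus> t" "ga \<oplus> ga = t \<otimes> ga" unfolding t_def using R by (simp_all add: K.l_distr)
    have D': "dN u v = t \<ominus> t \<otimes> al" "dN v ?w = t \<ominus> t \<otimes> be" "dN u ?w = t \<ominus> t \<otimes> ga"
      unfolding D t_def using R by (simp_all add: K.l_distr)
    have "(\<one> \<oplus> ga \<oplus> (\<ominus> t) \<otimes> al) \<oplus> (ga \<oplus> \<one> \<oplus> (\<ominus> t) \<otimes> be) \<oplus> (\<ominus> t) \<otimes> (al \<oplus> be \<oplus> (\<ominus> t) \<otimes> \<one>)
      = (\<one> \<oplus> \<one>) \<oplus> (ga \<oplus> ga) \<ominus> t \<otimes> al \<ominus> t \<otimes> al \<ominus> t \<otimes> be \<ominus> t \<otimes> be \<oplus> t \<otimes> t"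
      using R t(1) one_closed by algebra
    also have "\<dots> = t \<oplus> t \<otimes> ga \<ominus> t \<otimes> al \<ominus> t \<otimes> al \<ominus> t \<otimes> be \<ominus> t \<otimes> be \<oplus> (t \<oplus> t)"
      unfolding t(2,3) by (simp add: t_def)
    also have "\<dots> = (t \<ominus> t \<otimes> al \<oplus> (t \<ominus> t \<otimes> al) \<oplus> (t \<ominus> t \<otimes> be \<oplus> (t \<ominus> t \<otimes> be))) \<ominus> (t \<ominus> t \<otimes> ga)"
      using R t(1) by algebra
    finally show ?thesis unfolding D' t_def .
  qed
  finally have "(dN u v \<oplus> dN u v \<oplus> (dN v ?w \<oplus> dN v ?w)) \<ominus> dN u ?w \<in> P" using norm_P[OF x] by simp
  moreover have "dN u ?w \<in> carrier K" unfolding D using R by (simp add: K.minus_eq)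
  ultimately have "small (dN u ?w)"
    using small_mono small_add[OF small_add[OF u(7) u(7)] small_add[OF D2 D2]] by blast
  then show ?thesis unfolding near_def using u w by blast
qed

lemma near_rot:
  assumes e: "e \<in> S" "f \<in> S" "e \<noteq> f" "\<rho> \<in> rot e f" and n: "near x y"
  shows "near (\<rho> x) (\<rho> y)"
proof -
  obtain \<Phi> where P: "\<And>x. x \<in> carrier H \<Longrightarrow> \<Phi> x \<in> carrier H"
      "\<And>x y. \<lbrakk>x \<in> carrier H; y \<in> carrier H\<rbrakk> \<Longrightarrow> form (\<Phi> x) (\<Phi> y) = form x y"
      "\<And>x. \<lbrakk>x \<in> carrier H; x \<noteq> vz\<rbrakk> \<Longrightarrow> \<rho> (pt x) = pt (\<Phi> x)" using rot_isometry[OF e] by blast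
  obtain u v where u: "u \<in> carrier H" "v \<in> carrier H" "form u u = \<one>" "form v v = \<one>" "pt u = x" "pt v = y" "small (dN u v)"
    using n unfolding near_def by blast
  have "small (dN (\<Phi> u) (\<Phi> v))" using u P(2) unfolding dN_def by simp
  moreover have "form (\<Phi> u) (\<Phi> u) = \<one>" "form (\<Phi> v) (\<Phi> v) = \<one>" using P(2) u by simp_all
  moreover have "pt (\<Phi> u) = \<rho> x" "pt (\<Phi> v) = \<rho> y"
    using P(3)[OF u(1) unit_nz[OF u(1,3)]] P(3)[OF u(2) unit_nz[OF u(2,4)]] u(5,6) by simp_all
  ultimately show ?thesis unfolding near_def using P(1)[OF u(1)] P(1)[OF u(2)] by blast
qed

text \<open>Orthogonal unit vectors have squared distance two, whatever their signs.\<close>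

lemma not_near_ex: "\<exists>x\<in>S. \<exists>y\<in>S. \<not> near x y"
proof -
  obtain p q where pq: "p \<in> carrier H" "q \<in> carrier H" "form p p = \<one>" "form q q = \<one>" "form p q = \<zero>" using orthonormal_pair .
  have "\<not> near (pt p) (pt q)"
  proof
    assume "near (pt p) (pt q)"
    then obtain u v where u: "u \<in> carrier H" "v \<in> carrier H" "form u u = \<one>" "form v v = \<one>" "pt u = pt p" "pt v = pt q" "small (dN u v)"
      unfolding near_def by blast
    have "form u v = \<zero>" using pt_orth[of u v] pt_orth[of p q] u pq unit_nz by auto
    then have "dN u v = \<one> \<oplus> \<one>" using u unfolding dN_def by (simp add: K.minus_eq)
    then have "\<one> \<ominus> nK 1 \<otimes> (\<one> \<oplus> \<one>) \<in> P" using u(7) unfolding small_def by metis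
    moreover have "nK 1 = \<one>" by simp
    moreover have "\<one> \<ominus> \<one> \<otimes> (\<one> \<oplus> \<one>) = \<ominus> \<one>" using one_closed by algebra
    ultimately show False using m1_not_P by metis
  qed
  then show ?thesis using pt_in unit_nz pq by blast
qed

end

section \<open>The rotations of one plane\<close>

locale ordered_plane = coordinate_plane S orth rot K H form pt p q + ordered_coordinates S orth rot K H form pt P
  for S :: "'a set" and orth (infix \<open>\<perp>\<close> 50) and rot
    and K :: "('k, 'm) ring_scheme" (structure) and H :: "('k, 'v, 'n) module_scheme" (structure) and form and pt and p q and P +
  assumes pp: "form p p = \<one>" and qq: "form q q = \<one>"
begin

lemma eg: "pt p \<in> S" "pt q \<in> S" "pt p \<noteq> pt q"
  using pt_in p q pt_orth[of p q] pq orth_irrefl by auto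

lemma qp: "form q p = \<zero>"
  using form_sym[of p q] p q pq by simp

text \<open>A vector of the plane not proportional to \<open>p\<close> has a nonzero component along
  \<open>q\<close>, so \<open>p\<close>, \<open>s\<close> and \<open>p\<close>, \<open>q\<close>
  have the same orthocomplement.\<close>

lemma rot_plane:
  assumes s: "s \<in> Pl" "s \<noteq> vz" "pt s \<noteq> pt p"
  shows "rot (pt p) (pt s) = rot (pt p) (pt q)"
proof (rule rot_same)
  show "pt p \<in> S" "pt s \<in> S" "pt p \<in> S" "pt q \<in> S" using eg pt_in s by auto
  obtain c d where cd: "c \<in> carrier K" "d \<in> carrier K" "s = c \<bullet> p \<boxplus> d \<bullet> q" using Pl_span[OF s(1)] .
  have dn: "d \<noteq> \<zero>"
  proof
    assume "d = \<zero>"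
    then have sc: "s = c \<bullet> p" using cd p q by (simp add: smult_l_null)
    then have "pt p = pt s" using pt_eq[of p s] p s cd by auto
    then show False using s by simp
  qed
  fix z
  show "z \<perp> pt p \<and> z \<perp> pt s \<longleftrightarrow> z \<perp> pt p \<and> z \<perp> pt q"
  proof (cases "z \<in> S")
    case True
    then obtain y where y: "y \<in> carrier H" "y \<noteq> vz" "pt y = z" using pt_surj by blast
    have fs: "form y s = c \<otimes> form y p \<oplus> d \<otimes> form y q" unfolding cd(3) using cd(1,2) p q y by (simp add: form_simps)
    have "form y s = \<zero> \<longleftrightarrow> form y q = \<zero>" if "form y p = \<zero>"
      unfolding fs that using cd dn form_closed[of y q] y q K.integral[of d "form y q"] by auto
    then show ?thesis using pt_orth[OF y(1) _ y(2)] p q s y by auto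
  qed (use orth_in in blast)
qed

lemma tr_reach:
  assumes s: "s \<in> Pl" "form s s = \<one>" "pt s \<noteq> pt p"
  obtains \<theta> k where "\<theta> \<in> rot (pt p) (pt q)" "k \<in> carrier K" "k \<otimes> k = \<one>" "tr \<theta> p = k \<bullet> s"
proof -
  have sn: "s \<noteq> vz" using unit_nz s by simp
  obtain \<theta> where "\<theta> \<in> rot (pt p) (pt s)" and sp: "\<theta> (pt p) = pt s"
    using rot_trans[of "pt p" "pt s"] eg pt_in s sn by auto
  then have r: "\<theta> \<in> rot (pt p) (pt q)" using rot_plane[OF s(1) sn s(3)] by simp
  note st = rot_stab[OF r]
  have "pt s = pt (tr \<theta> p)" using tr_pt[OF st p_Pl p(2)] sp by simp
  moreover have "form (tr \<theta> p) (tr \<theta> p) = \<one>" using tr_form[OF st p_Pl p_Pl] pp by simp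
  ultimately obtain k where "k \<in> carrier K" "tr \<theta> p = k \<bullet> s" "k \<otimes> k = \<one>"
    using unit_prop[of s "tr \<theta> p"] s tr_Pl[OF st p_Pl] by (metis Pl_in)
  then show ?thesis using that r by blast
qed

lemma rot_comp_tr:
  assumes r: "\<rho> \<in> rot (pt p) (pt q)" "\<theta> \<in> rot (pt p) (pt q)"
  obtains \<tau> where "\<tau> \<in> rot (pt p) (pt q)" "\<And>s. s \<in> Pl \<Longrightarrow> tr \<tau> s = tr \<rho> (tr \<theta> s)"
    "\<And>s. s \<in> Pl \<Longrightarrow> tr \<tau> s = tr \<theta> (tr \<rho> s)"
proof -
  obtain \<tau> where t: "\<tau> \<in> rot (pt p) (pt q)" "\<And>x. x \<in> S \<Longrightarrow> \<tau> x = \<rho> (\<theta> x)" using rot_mult[OF eg r] by blast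
  have t': "\<tau> x = \<theta> (\<rho> x)" if "x \<in> S" for x using t(2)[OF that] rot_comm[OF eg r that] by simp
  show ?thesis
    using that[OF t(1)] tr_comp[OF rot_stab[OF r(1)] rot_stab[OF r(2)] rot_stab[OF t(1)] t(2)]
      tr_comp[OF rot_stab[OF r(2)] rot_stab[OF r(1)] rot_stab[OF t(1)] t'] by blast
qed

text \<open>Up to sign, \<open>s\<close> is the image of \<open>p\<close> under a rotation
  \<open>\<theta>\<close> of the same plane, which commutes with \<open>\<tau>\<close> and preserves
  the form. The common value is the cosine of \<open>\<tau>\<close>.\<close>

lemma tr_angle_const:
  assumes t: "\<tau> \<in> rot (pt p) (pt q)" and s: "s \<in> Pl" "form s s = \<one>"
  shows "form s (tr \<tau> s) = form p (tr \<tau> p)"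
proof -
  note st = rot_stab[OF t]
  have scale: "form (k \<bullet> x) (tr \<tau> (k \<bullet> x)) = form x (tr \<tau> x)"
    if k: "k \<in> carrier K" "k \<otimes> k = \<one>" and x: "x \<in> Pl" for k x
  proof -
    have kn: "k \<noteq> \<zero>" using k one_not_zero by auto
    have "form (k \<bullet> x) (tr \<tau> (k \<bullet> x)) = k \<otimes> (k \<otimes> form x (tr \<tau> x))"
      using tr_smult[OF st x k(1) kn] k(1) x tr_Pl[OF st x] by (simp add: form_simps)
    then show ?thesis using k x form_closed[of x "tr \<tau> x"] tr_Pl[OF st x] K.m_assoc[of k k "form x (tr \<tau> x)"] by simp
  qed
  show ?thesis
  proof (cases "pt s = pt p")
    case True
    obtain k where k: "k \<in> carrier K" "s = k \<bullet> p" "k \<otimes> k = \<one>" using unit_prop[of p s] True s p pp by (metis Pl_in)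
    then show ?thesis using scale[OF k(1,3) p_Pl] by simp
  next
    case False
    obtain \<theta> k where sg: "\<theta> \<in> rot (pt p) (pt q)" "k \<in> carrier K" "k \<otimes> k = \<one>" "tr \<theta> p = k \<bullet> s" using tr_reach[OF s False] .
    obtain \<chi> where c: "\<chi> \<in> rot (pt p) (pt q)" "\<And>s. s \<in> Pl \<Longrightarrow> tr \<chi> s = tr \<theta> (tr \<tau> s)"
      "\<And>s. s \<in> Pl \<Longrightarrow> tr \<chi> s = tr \<tau> (tr \<theta> s)" using rot_comp_tr[OF sg(1) t] by metis
    have "form s (tr \<tau> s) = form (tr \<theta> p) (tr \<tau> (tr \<theta> p))" using scale[OF sg(2,3) s(1)] sg(4) by simp
    also have "\<dots> = form (tr \<theta> p) (tr \<theta> (tr \<tau> p))" using c(2,3)[OF p_Pl] by simp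
    also have "\<dots> = form p (tr \<tau> p)" using tr_form[OF rot_stab[OF sg(1)] p_Pl tr_Pl[OF st p_Pl]] .
    finally show ?thesis .
  qed
qed

lemma Pl_pline: assumes "s \<in> Pl" "s \<noteq> vz" shows "pt s \<in> pline (pt p) (pt q)"
proof (rule plineI)
  show "pt s \<in> S" using pt_in assms by simp
  fix z assume z: "z \<perp> pt p" "z \<perp> pt q"
  obtain y where y: "y \<in> carrier H" "y \<noteq> vz" "pt y = z" using pt_surj orth_in[OF z(1)] by blast
  have "form y p = \<zero>" "form y q = \<zero>" using pt_orth[OF y(1) _ y(2)] p q y z by auto
  then have "y \<in> W" using form_sym[OF y(1)] p q y unfolding W_def by auto
  then show "z \<perp> pt s" using pt_orth[OF y(1) _ y(2), of s] assms y by simp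
qed

text \<open>For a quarter turn \<open>j\<close> put \<open>r = j p\<close>; then
  \<open>j r = a p\<close> with \<open>a^2 = 1\<close>. The vector \<open>p + r\<close> is
  orthogonal to its image, whose products with \<open>p\<close> and \<open>r\<close> are
  \<open>a\<close> and \<open>1\<close>. Hence \<open>a = - 1\<close>.\<close>

lemma half_turn:
  obtains j where "j \<in> rot (pt p) (pt q)" "tr j (tr j p) = (\<ominus> \<one>) \<bullet> p"
proof -
  obtain j where j: "j \<in> rot (pt p) (pt q)" "j (pt p) = pt q" using rot_trans[OF eg] by blast
  note st = rot_stab[OF j(1)]
  define r where "r = tr j p"
  have r: "r \<in> Pl" "form r r = \<one>" unfolding r_def using tr_Pl[OF st p_Pl] tr_form[OF st p_Pl p_Pl] pp by auto
  have "pt q = pt r" using tr_pt[OF st p_Pl p(2)] j unfolding r_def by simp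
  then obtain k where k: "k \<in> carrier K" "r = k \<bullet> q" "k \<otimes> k = \<one>" using unit_prop[of q r] r q qq by (metis Pl_in)
  have kn: "k \<noteq> \<zero>" using k one_not_zero by auto
  have rp: "form r p = \<zero>" "form p r = \<zero>" using k p q pq qp by (simp_all add: form_simps)
  define t where "t = tr j r"
  have t: "t \<in> Pl" "form t t = \<one>" "form t r = \<zero>" unfolding t_def
    using tr_Pl[OF st r(1)] tr_form[OF st r(1) r(1)] tr_form[OF st r(1) p_Pl] r rp r_def by auto
  obtain a b where ab: "a \<in> carrier K" "b \<in> carrier K" "t = a \<bullet> p \<boxplus> b \<bullet> q" using Pl_span[OF t(1)] .
  have "form t r = b \<otimes> k" unfolding ab(3) k(2) using ab(1,2) k(1) p q pq qp qq
    by (simp add: form_simps K.m_comm)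
  then have "b = \<zero>" using t(3) K.integral[of b k] ab k kn by auto
  then have ta: "t = a \<bullet> p" using ab p q by (simp add: smult_l_null)
  then have aa: "a \<otimes> a = \<one>" using t(2) ab(1) p pp by (simp add: form_simps)
  let ?s = "p \<boxplus> r"
  have s: "?s \<in> Pl" "form ?s p = \<one>" "form ?s r = \<one>" using r rp p pp by (simp_all add: form_simps)
  have sn: "?s \<noteq> vz" using s(2) p one_not_zero by auto
  define v where "v = tr j ?s"
  have v: "v \<in> Pl" "v \<noteq> vz" unfolding v_def using tr_Pl[OF st s(1)] tr_nz[OF st s(1) sn] by auto
  have vr: "form v r = \<one>" using tr_form[OF st s(1) p_Pl] s unfolding v_def r_def by simp
  have "form v t = \<one>" using tr_form[OF st s(1) r(1)] s unfolding v_def t_def by simp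
  then have "a \<otimes> form v p = \<one>" unfolding ta using ab(1) p v by (simp add: form_simps)
  then have "form v p = a"
    using aa ab(1) form_closed[of v p] v p K.m_assoc[of a a "form v p"] by simp
  moreover have "form v ?s = \<zero>"
  proof -
    have "j (pt ?s) \<perp> pt ?s"
      using rot_orth_line[OF eg j(1) _ Pl_pline[OF s(1) sn]] j pt_orth[of q p] p q qp by simp
    then show ?thesis using tr_pt[OF st s(1) sn] pt_orth[of v ?s] v s sn unfolding v_def by simp
  qed
  ultimately have "a \<oplus> \<one> = \<zero>" using vr v p r by (simp add: form_simps)
  then have "a = \<ominus> \<one>" using ab(1) K.minus_equality[of a \<one>] by simp
  then show ?thesis using that[OF j(1)] ta unfolding t_def r_def by simp
qed

text \<open>A rotation taking the point of \<open>p\<close> to that of \<open>p + e q\<close> sends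
  the vector \<open>p\<close> to \<open>c (p + e q)\<close> with \<open>c^2 (1 + e^2) = 1\<close>,
  so its cosine is \<open>c\<close>. A unit vector whose component in the plane has norm
  \<open>g\<close> is moved by the squared distance \<open>g (2 - 2 c)\<close>, where
  \<open>g\<close> is between zero and one.\<close>

lemma small_rotation:
  assumes e: "e \<in> carrier K" "e \<noteq> \<zero>" "small (e \<otimes> e)"
  shows "\<exists>\<tau>\<in>rot (pt p) (pt q). \<tau> (pt p) \<noteq> pt p \<and> (\<forall>x\<in>S. near (\<tau> x) x)"
proof -
  let ?y = "p \<boxplus> e \<bullet> q"
  have y: "?y \<in> Pl" "form ?y ?y = \<one> \<oplus> e \<otimes> e" "form p ?y = \<one>" "form q ?y = e"
    using e p q pp qq pq qp by (simp_all add: form_simps)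
  have yn: "?y \<noteq> vz" using y(3) p one_not_zero by auto
  have yp: "pt ?y \<noteq> pt p"
  proof
    assume "pt ?y = pt p"
    then obtain c where "c \<in> carrier K" "?y = c \<bullet> p" using pt_eq[of p ?y] p y(1) yn by auto
    then have "form q ?y = \<zero>" using p q qp by (simp add: form_smult_right)
    then show False using y e by simp
  qed
  obtain \<rho> where "\<rho> \<in> rot (pt p) (pt ?y)" and rp: "\<rho> (pt p) = pt ?y"
    using rot_trans[of "pt p" "pt ?y"] eg pt_in y(1) yn yp by auto
  then have r: "\<rho> \<in> rot (pt p) (pt q)" using rot_plane[OF y(1) yn yp] by simp
  note st = rot_stab[OF r]
  have "pt ?y = pt (tr \<rho> p)" using tr_pt[OF st p_Pl p(2)] rp by simp
  then obtain c where c: "c \<in> carrier K" "tr \<rho> p = c \<bullet> ?y"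
    using pt_eq[of ?y "tr \<rho> p"] y(1) yn tr_Pl[OF st p_Pl] tr_nz[OF st p_Pl p(2)] by auto
  have cc: "c \<otimes> c \<otimes> (\<one> \<oplus> e \<otimes> e) = \<one>"
  proof -
    have "form (tr \<rho> p) (tr \<rho> p) = \<one>" using tr_form[OF st p_Pl p_Pl] pp by simp
    moreover have "form (c \<bullet> ?y) (c \<bullet> ?y) = c \<otimes> (c \<otimes> form ?y ?y)"
      using form_smult_left[OF c(1), of ?y "c \<bullet> ?y"] form_smult_right[OF c(1), of ?y ?y] c(1) y(1) by simp
    ultimately show ?thesis unfolding c(2) y(2) using c(1) e by (simp add: K.m_assoc)
  qed
  have "\<exists>\<tau>\<in>rot (pt p) (pt q). \<exists>c\<in>P. tr \<tau> p = c \<bullet> ?y \<and> c \<otimes> c \<otimes> (\<one> \<oplus> e \<otimes> e) = \<one>"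
  proof (cases "c \<in> P")
    case True then show ?thesis using r c cc by blast
  next
    case False
    then have mc: "\<ominus> c \<in> P" using total c by blast
    \<comment> \<open>A negative cosine means an angle close to the half turn; composing with the
      half turn corrects the sign without changing the point to which \<open>p\<close> is
      sent.\<close>
    obtain j where j: "j \<in> rot (pt p) (pt q)" "tr j (tr j p) = (\<ominus> \<one>) \<bullet> p" using half_turn .
    obtain j2 where j2: "j2 \<in> rot (pt p) (pt q)" "\<And>s. s \<in> Pl \<Longrightarrow> tr j2 s = tr j (tr j s)"
      using rot_comp_tr[OF j(1) j(1)] by metis
    obtain \<tau> where t: "\<tau> \<in> rot (pt p) (pt q)" "\<And>s. s \<in> Pl \<Longrightarrow> tr \<tau> s = tr \<rho> (tr j2 s)"
      using rot_comp_tr[OF r j2(1)] by metis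
    have "tr \<tau> p = tr \<rho> ((\<ominus> \<one>) \<bullet> p)" using t(2)[OF p_Pl] j2(2)[OF p_Pl] j by simp
    also have "\<dots> = (\<ominus> \<one>) \<bullet> (c \<bullet> ?y)" using tr_smult[OF st p_Pl, of "\<ominus> \<one>"] c one_not_zero by simp
    also have "\<dots> = (\<ominus> c) \<bullet> ?y" using smult_assoc1[of "\<ominus> \<one>" c ?y] c(1) y(1) by (simp add: K.l_minus)
    finally have "tr \<tau> p = (\<ominus> c) \<bullet> ?y" .
    moreover have "(\<ominus> c) \<otimes> (\<ominus> c) \<otimes> (\<one> \<oplus> e \<otimes> e) = \<one>" using cc c(1) e(1) by (simp add: K.l_minus K.r_minus)
    ultimately show ?thesis using t(1) mc by blast
  qed
  then obtain \<tau> c where t: "\<tau> \<in> rot (pt p) (pt q)" and c: "c \<in> P" "tr \<tau> p = c \<bullet> ?y" "c \<otimes> c \<otimes> (\<one> \<oplus> e \<otimes> e) = \<one>" by blast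
  note st = rot_stab[OF t]
  have cK: "c \<in> carrier K" using c P_in by blast
  have cn: "c \<noteq> \<zero>" using c(3) e one_not_zero by auto
  have small: "small (\<one> \<oplus> \<one> \<ominus> (c \<oplus> c))" using small_cos[OF e(3) P_sq[OF e(1)] c(1,3)] .
  have cos: "form p (tr \<tau> p) = c" unfolding c(2) using cK y(1,3) p by (simp add: form_smult_right)
  have "\<tau> (pt p) = pt ?y" using tr_pt[OF st p_Pl p(2)] c(2) pt_smult[of ?y c] cK cn y(1) yn by simp
  then have ne: "\<tau> (pt p) \<noteq> pt p" using yp by simp
  have "near (\<tau> x) x" if x: "x \<in> S" for x
  proof -
    obtain u where u: "u \<in> carrier H" "form u u = \<one>" "pt u = x" using unit_rep[OF x] .
    obtain \<Phi> where F: "\<And>x. x \<in> carrier H \<Longrightarrow> \<Phi> x \<in> carrier H"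
      "\<And>x y. \<lbrakk>x \<in> carrier H; y \<in> carrier H\<rbrakk> \<Longrightarrow> form (\<Phi> x) (\<Phi> y) = form x y"
      "\<And>x. \<lbrakk>x \<in> carrier H; x \<noteq> vz\<rbrakk> \<Longrightarrow> \<tau> (pt x) = pt (\<Phi> x)"
      "\<And>s w. \<lbrakk>s \<in> Pl; w \<in> W\<rbrakk> \<Longrightarrow> \<Phi> (s \<boxplus> w) = tr \<tau> s \<boxplus> w" using stab_isometry[OF st] by blast
    obtain s w where sw: "s \<in> Pl" "w \<in> W" "u = s \<boxplus> w" using decomp[OF u(1)] .
    define g where "g = form s s"
    have g: "g \<in> carrier K" "g \<in> P" unfolding g_def using form_closed norm_P sw by auto
    have one: "\<one> = g \<oplus> form w w" using u(2) form_sum[OF sw(1,2) sw(1,2)] unfolding sw(3) g_def by simp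
    have wK: "form w w \<in> carrier K" "form w w \<in> P" using form_closed norm_P sw by auto
    have g1: "\<one> \<ominus> g \<in> P"
    proof -
      have "(g \<oplus> form w w) \<ominus> g = form w w" using g(1) wK(1) by algebra
      then show ?thesis using one wK by simp
    qed
    \<comment> \<open>The normalised vector \<open>k s\<close> has the same cosine as
      \<open>p\<close>, and \<open>g\<close> undoes the normalisation.\<close>
    have ts: "form (tr \<tau> s) s = g \<otimes> c"
    proof (cases "s = vz")
      case True
      then show ?thesis unfolding g_def using tr_Pl[OF st sw(1)] cK by simp
    next
      case False
      obtain k where k: "k \<in> carrier K" "k \<noteq> \<zero>" "form (k \<bullet> s) (k \<bullet> s) = \<one>" using normalize[of s] sw(1) False by auto
      have kk: "k \<otimes> k \<otimes> g = \<one>" using k sw(1) g unfolding g_def by (simp add: form_simps K.m_assoc)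
      have "c = form (k \<bullet> s) (tr \<tau> (k \<bullet> s))" using tr_angle_const[OF t _ k(3)] sw(1) k cos by simp
      also have "\<dots> = k \<otimes> k \<otimes> form s (tr \<tau> s)"
        using tr_smult[OF st sw(1) k(1,2)] k(1) sw(1) tr_Pl[OF st sw(1)] by (simp add: form_simps K.m_assoc)
      finally have "g \<otimes> c = k \<otimes> k \<otimes> g \<otimes> form s (tr \<tau> s)"
        using k(1) g(1) form_closed[of s "tr \<tau> s"] sw(1) tr_Pl[OF st sw(1)] by (simp add: K.m_ac)
      then show ?thesis using kk form_sym[of s "tr \<tau> s"] form_closed[of s "tr \<tau> s"] sw(1) tr_Pl[OF st sw(1)] by simp
    qed
    have fu: "form (\<Phi> u) u = g \<otimes> c \<oplus> form w w"
      using F(4)[OF sw(1,2)] form_sum[OF tr_Pl[OF st sw(1)] sw(2) sw(1,2)] ts unfolding sw(3) by simp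
    have "dN (\<Phi> u) u = (g \<oplus> form w w) \<oplus> (g \<oplus> form w w) \<ominus> ((g \<otimes> c \<oplus> form w w) \<oplus> (g \<otimes> c \<oplus> form w w))"
      unfolding dN_def F(2)[OF u(1) u(1)] u(2) fu using one by simp
    also have "\<dots> = g \<otimes> (\<one> \<oplus> \<one> \<ominus> (c \<oplus> c))" using g(1) wK(1) cK one_closed by algebra
    finally have "small (dN (\<Phi> u) u)" using small_mult[OF small g g1] by simp
    moreover have "form (\<Phi> u) (\<Phi> u) = \<one>" "pt (\<Phi> u) = \<tau> x"
      using F(2)[OF u(1) u(1)] F(3)[OF u(1) unit_nz[OF u(1,2)]] u by simp_all
    ultimately show ?thesis unfolding near_def using F(1)[OF u(1)] u by blast
  qed
  then show ?thesis using t ne by blast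
qed

end

context ordered_coordinates
begin

lemma small_rotation_ex:
  assumes "a \<in> carrier K" "\<And>n. nK n \<ominus> a \<notin> P"
  shows "\<exists>e\<in>S. \<exists>f\<in>S. e \<noteq> f \<and> (\<exists>\<tau>\<in>rot e f. \<tau> e \<noteq> e \<and> (\<forall>x\<in>S. near (\<tau> x) x))"
proof -
  obtain e where e: "e \<in> carrier K" "e \<noteq> \<zero>" "small (e \<otimes> e)" using infinitesimal_ex[OF assms] by blast
  obtain p q where pq: "p \<in> carrier H" "q \<in> carrier H" "form p p = \<one>" "form q q = \<one>" "form p q = \<zero>" using orthonormal_pair .
  interpret pl: ordered_plane S orth rot K H form pt p q P
    using pq unit_nz by unfold_locales auto
  show ?thesis using pl.small_rotation[OF e] pl.eg by blast
qed

end

section \<open>Coordinates over a subfield of the reals\<close>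

context turning_orthoset
begin

text \<open>Homogeneous coordinates: \<open>(a, v)\<close> stands for \<open>a org + v\<close>.\<close>

definition KF :: "'a ring" where
  "KF = \<lparr>carrier = L, monoid.mult = smul, one = uni, ring.zero = org, ring.add = add\<rparr>"

definition HF :: "('a, 'a \<times> 'a) module" where
  "HF = \<lparr>carrier = L \<times> A, monoid.mult = undefined, one = undefined, ring.zero = (org, org),
     ring.add = (\<lambda>x y. (add (fst x) (fst y), add (snd x) (snd y))),
     module.smult = (\<lambda>c x. (smul c (fst x), smul c (snd x)))\<rparr>"

definition ff :: "'a \<times> 'a \<Rightarrow> 'a \<times> 'a \<Rightarrow> 'a" where
  "ff x y = add (smul (fst x) (fst y)) (B (snd x) (snd y))"

definition iv :: "'a \<Rightarrow> 'a" where "iv a = (SOME b. b \<in> L \<and> b \<noteq> org \<and> smul b a = uni)"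

definition pf :: "'a \<times> 'a \<Rightarrow> 'a" where
  "pf x = (if fst x = org then dir org (snd x) else smul (iv (fst x)) (snd x))"

lemma KF_simps [simp]: "carrier KF = L" "a \<otimes>\<^bsub>KF\<^esub> b = smul a b" "\<one>\<^bsub>KF\<^esub> = uni" "\<zero>\<^bsub>KF\<^esub> = org" "a \<oplus>\<^bsub>KF\<^esub> b = add a b"
  by (simp_all add: KF_def)

lemma HF_simps [simp]: "carrier HF = L \<times> A" "\<zero>\<^bsub>HF\<^esub> = (org, org)"
  "x \<oplus>\<^bsub>HF\<^esub> y = (add (fst x) (fst y), add (snd x) (snd y))"
  "c \<odot>\<^bsub>HF\<^esub> x = (smul c (fst x), smul c (snd x))"
  by (simp_all add: HF_def)

lemma iv: assumes "a \<in> L" "a \<noteq> org" shows "iv a \<in> L" "iv a \<noteq> org" "smul (iv a) a = uni"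
proof -
  have "\<exists>b. b \<in> L \<and> b \<noteq> org \<and> smul b a = uni" using inverse_ex[OF assms] by blast
  from someI_ex[OF this] show "iv a \<in> L" "iv a \<noteq> org" "smul (iv a) a = uni" unfolding iv_def by auto
qed

lemma iv_cancel:
  assumes "a \<in> L" "a \<noteq> org" "z \<in> A"
  shows "smul (iv a) (smul a z) = z" "smul a (smul (iv a) z) = z"
  using iv[OF assms(1,2)] smul_smul[of "iv a" a z] smul_smul[of a "iv a" z] smul_1[of z] smul_commute[of a "iv a"] assms
  by auto

lemma abelian_group_KF: "abelian_group KF"
proof (rule abelian_groupI)
  show "\<exists>y\<in>carrier KF. y \<oplus>\<^bsub>KF\<^esub> x = \<zero>\<^bsub>KF\<^esub>" if "x \<in> carrier KF" for x
    using that add_neg_left[of x] by (auto intro!: bexI[of _ "neg x"])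
  show "x \<oplus>\<^bsub>KF\<^esub> y = y \<oplus>\<^bsub>KF\<^esub> x" if "x \<in> carrier KF" "y \<in> carrier KF" for x y
    using that add_commute[of x y] by simp
qed (simp_all add: add_assoc add_0_left)

lemma field_KF: "field KF"
proof -
  have "comm_monoid KF"
  proof (rule comm_monoidI)
    show "x \<otimes>\<^bsub>KF\<^esub> y = y \<otimes>\<^bsub>KF\<^esub> x" if "x \<in> carrier KF" "y \<in> carrier KF" for x y
      using that smul_commute[of x y] by simp
  qed (simp_all add: smul_smul smul_1)
  then have "cring KF" using abelian_group_KF
    by (intro cringI) (simp_all add: smul_add_left)
  then interpret cring KF .
  show ?thesis
  proof (rule cring_fieldI2)
    show "\<exists>b\<in>carrier KF. a \<otimes>\<^bsub>KF\<^esub> b = \<one>\<^bsub>KF\<^esub>" if "a \<in> carrier KF" "a \<noteq> \<zero>\<^bsub>KF\<^esub>" for a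
      using that iv[of a] smul_commute[of a "iv a"] by (intro bexI[of _ "iv a"]) auto
    show "\<zero>\<^bsub>KF\<^esub> \<noteq> \<one>\<^bsub>KF\<^esub>" using uni_nz by (simp add: eq_commute)
  qed
qed

lemma module_HF: "module KF HF"
proof (rule moduleI)
  show "cring KF" using field_KF by (simp add: field_def domain_def)
  show "abelian_group HF"
  proof (rule abelian_groupI)
    show "\<exists>y\<in>carrier HF. y \<oplus>\<^bsub>HF\<^esub> x = \<zero>\<^bsub>HF\<^esub>" if "x \<in> carrier HF" for x
      using that add_neg_left by (intro bexI[of _ "(neg (fst x), neg (snd x))"]) auto
    show "x \<oplus>\<^bsub>HF\<^esub> y = y \<oplus>\<^bsub>HF\<^esub> x" if "x \<in> carrier HF" "y \<in> carrier HF" for x y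
      using that add_commute[of "fst x" "fst y"] add_commute[of "snd x" "snd y"] by auto
  qed (auto simp: add_assoc add_0_left)
qed (auto simp: smul_add_left smul_add_right smul_smul smul_1)

lemma neg_unique: "\<lbrakk>x \<in> A; y \<in> A; add x y = org\<rbrakk> \<Longrightarrow> y = neg x"
  using add_cancel[of x y "neg x"] add_neg_right by simp

text \<open>For anisotropy, an isotropic pair with nonzero first entry \<open>a\<close> would make
  the affine point \<open>v / a\<close> orthogonal to itself by \<open>B_orth\<close>. If
  \<open>a\<close> vanishes, \<open>B_self_nz\<close> applies.\<close>

lemma quadratic_space_HF: "quadratic_space KF HF ff"
proof -
  interpret f: field KF by (rule field_KF)
  interpret m: module KF HF by (rule module_HF)
  show ?thesis
  proof
    show "\<one>\<^bsub>KF\<^esub> \<oplus>\<^bsub>KF\<^esub> \<one>\<^bsub>KF\<^esub> \<noteq> \<zero>\<^bsub>KF\<^esub>" using char_not_2 by simp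
    fix u v assume u: "u \<in> carrier HF" and v: "v \<in> carrier HF"
    then show "ff u v \<in> carrier KF" by (auto simp: ff_def)
    show "ff u v = ff v u" using u v by (auto simp: ff_def B_sym smul_commute)
    show "ff (u \<oplus>\<^bsub>HF\<^esub> v) w = ff u w \<oplus>\<^bsub>KF\<^esub> ff v w" if "w \<in> carrier HF" for w
      using u v that by (auto simp: ff_def smul_add_left B_add_left add_assoc add_left_commute)
    show "ff (a \<odot>\<^bsub>HF\<^esub> u) v = a \<otimes>\<^bsub>KF\<^esub> ff u v" if "a \<in> carrier KF" for a
      using u v that by (auto simp: ff_def smul_smul B_smul_left smul_add_right)
  next
    fix u assume u: "u \<in> carrier HF" "ff u u = \<zero>\<^bsub>KF\<^esub>"
    obtain a v where av: "u = (a, v)" "a \<in> L" "v \<in> A" using u by auto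
    have eq: "add (smul a a) (B v v) = org" using u av by (simp add: ff_def)
    have "a = org"
    proof (rule ccontr)
      assume an: "a \<noteq> org"
      note i = iv[OF av(2) an]
      let ?w = "smul (iv a) v"
      have "B v v = neg (smul a a)" using neg_unique[of "smul a a" "B v v"] eq av by simp
      then have "B ?w ?w = smul (iv a) (smul (iv a) (neg (smul a a)))"
        using B_smul_left[of v ?w "iv a"] B_smul_right[of v v "iv a"] i av by simp
      also have "\<dots> = neg uni" using iv_cancel[OF av(2) an, of a] i av by (simp add: smul_neg_right)
      finally have "?w \<perp> ?w" using B_orth[of ?w ?w] i av by simp
      then show False using orth_irrefl by blast
    qed
    moreover then have "B v v = org" using eq av smul_0_left add_0_left by simp
    then have "v = org" using B_self_nz av by blast
    ultimately show "u = \<zero>\<^bsub>HF\<^esub>" using av by simp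
  qed
qed

lemma pf_in: assumes "x \<in> carrier HF" "x \<noteq> \<zero>\<^bsub>HF\<^esub>"
  shows "fst x = org \<Longrightarrow> pf x \<perp> org" "fst x \<noteq> org \<Longrightarrow> pf x \<in> A" "pf x \<in> S"
proof -
  obtain a v where av: "x = (a, v)" "a \<in> L" "v \<in> A" "a \<noteq> org \<or> v \<noteq> org" using assms by auto
  show 1: "pf x \<perp> org" if "fst x = org" using that av dir_orth[of org v] by (simp add: pf_def)
  show 2: "pf x \<in> A" if "fst x \<noteq> org" using that av iv[of a] by (simp add: pf_def)
  show "pf x \<in> S" using 1 2 orth_in A_in by blast
qed

lemma pf_surj: assumes s: "s \<in> S" shows "\<exists>x\<in>carrier HF. x \<noteq> \<zero>\<^bsub>HF\<^esub> \<and> pf x = s"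
proof (cases "s \<perp> org")
  case True
  then obtain u where "u \<in> A" "u \<noteq> org" "dir org u = s" using affine_point by blast
  then show ?thesis by (intro bexI[of _ "(org, u)"]) (auto simp: pf_def)
next
  case False
  then have sA: "s \<in> A" using s unfolding A_def by simp
  have "smul (iv uni) s = s" using iv_cancel(1)[of uni s] smul_1[of s] sA by simp
  then show ?thesis using sA by (intro bexI[of _ "(uni, s)"]) (auto simp: pf_def)
qed

lemma pf_eq:
  assumes x: "x \<in> carrier HF" "x \<noteq> \<zero>\<^bsub>HF\<^esub>" and y: "y \<in> carrier HF" "y \<noteq> \<zero>\<^bsub>HF\<^esub>"
  shows "pf x = pf y \<longleftrightarrow> (\<exists>c\<in>carrier KF. y = c \<odot>\<^bsub>HF\<^esub> x)"
proof -
  obtain a v where av: "x = (a, v)" "a \<in> L" "v \<in> A" "a \<noteq> org \<or> v \<noteq> org" using x by auto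
  obtain b w where bw: "y = (b, w)" "b \<in> L" "w \<in> A" "b \<noteq> org \<or> w \<noteq> org" using y by auto
  show ?thesis
  proof
    assume eq: "pf x = pf y"
    have iff: "a = org \<longleftrightarrow> b = org" using pf_in[OF x] pf_in[OF y] eq av bw A_orth by (metis fst_conv)
    show "\<exists>c\<in>carrier KF. y = c \<odot>\<^bsub>HF\<^esub> x"
    proof (cases "a = org")
      case True
      then have n: "v \<noteq> org" "w \<noteq> org" "b = org" using av bw iff by auto
      have "dir org v = dir org w" using eq av bw True n by (simp add: pf_def)
      then have "w \<in> pline org v" using ind_dir[OF av(3) bw(3) n(1,2)] av bw n unfolding ind_def by blast
      then obtain c where "c \<in> L" "w = smul c v" using smul_transitive av bw n by blast
      then show ?thesis using av bw True n smul_0_right by (intro bexI[of _ c]) auto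
    next
      case False
      then have bn: "b \<noteq> org" using iff by simp
      note ia = iv[OF av(2) False] and ib = iv[OF bw(2) bn]
      have e: "smul (iv a) v = smul (iv b) w" using eq av bw False bn by (simp add: pf_def)
      let ?c = "smul b (iv a)"
      have "smul ?c a = b" using smul_smul[of b "iv a" a] ia av bw smul_uni by simp
      moreover have "smul ?c v = w" using smul_smul[of b "iv a" v] ia av bw e iv_cancel(2)[OF bw(2) bn bw(3)] by simp
      ultimately show ?thesis using av bw ia by (intro bexI[of _ ?c]) auto
    qed
  next
    assume "\<exists>c\<in>carrier KF. y = c \<odot>\<^bsub>HF\<^esub> x"
    then obtain c where c: "c \<in> L" "b = smul c a" "w = smul c v" using av bw by auto
    have cn: "c \<noteq> org" using c bw smul_0_left by auto
    show "pf x = pf y"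
    proof (cases "a = org")
      case True
      then have "b = org" "v \<noteq> org" using c smul_0_right av by auto
      then show ?thesis using True c av bw smul_nz[of c v] cn by (simp add: pf_def)
    next
      case False
      then have bn: "b \<noteq> org" using smul_nz[of c a] c cn av by auto
      note ia = iv[OF av(2) False] and ib = iv[OF bw(2) bn]
      have "smul b (smul (iv a) v) = smul c v"
        using c smul_smul[of c a "smul (iv a) v"] iv_cancel(2)[OF av(2) False av(3)] ia av by simp
      then have "smul (iv b) w = smul (iv a) v"
        using iv_cancel(1)[OF bw(2) bn, of "smul (iv a) v"] c ia av by simp
      then show ?thesis using av bw False bn by (simp add: pf_def)
    qed
  qed
qed

text \<open>Points at infinity are those with first entry zero, whence four cases. For two affine
  points the equation is \<open>B_orth\<close> at \<open>v / a\<close> and \<open>w / b\<close> with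
  denominators cleared.\<close>

lemma pf_orth:
  assumes x: "x \<in> carrier HF" "x \<noteq> \<zero>\<^bsub>HF\<^esub>" and y: "y \<in> carrier HF" "y \<noteq> \<zero>\<^bsub>HF\<^esub>"
  shows "pf x \<perp> pf y \<longleftrightarrow> ff x y = \<zero>\<^bsub>KF\<^esub>"
proof -
  obtain a v where av: "x = (a, v)" "a \<in> L" "v \<in> A" "a \<noteq> org \<or> v \<noteq> org" using x by auto
  obtain b w where bw: "y = (b, w)" "b \<in> L" "w \<in> A" "b \<noteq> org \<or> w \<noteq> org" using y by auto
  have mixed: "dir org v \<perp> smul (iv b) w \<longleftrightarrow> B v w = org"
    if v: "v \<in> A" "v \<noteq> org" and b: "b \<in> L" "b \<noteq> org" and w: "w \<in> A" for v b w
  proof -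
    note ib = iv[OF b]
    have "dir org v \<perp> smul (iv b) w \<longleftrightarrow> B v (smul (iv b) w) = org"
      using B_zero[OF v, of "smul (iv b) w"] orth_commute ib w by simp
    also have "\<dots> \<longleftrightarrow> B v w = org"
      using B_smul_right[OF v(1) w ib(1)] smul_eq_0[OF ib(1), of "B v w"] ib v w smul_0_right by auto
    finally show ?thesis .
  qed
  consider "a = org" "b = org" | "a = org" "b \<noteq> org" | "a \<noteq> org" "b = org" | "a \<noteq> org" "b \<noteq> org" by blast
  then show ?thesis
  proof cases
    case 1
    then show ?thesis using av bw B_zero_dir[of w v] B_sym[of v w] add_0_left smul_0_left by (simp add: pf_def ff_def)
  next
    case 2
    then show ?thesis using av bw mixed[of v b w] add_0_left smul_0_left by (simp add: pf_def ff_def)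
  next
    case 3
    then show ?thesis using av bw mixed[of w a v] B_sym[of v w] add_0_left smul_0_right orth_commute by (simp add: pf_def ff_def)
  next
    case 4
    note ia = iv[OF av(2) 4(1)] and ib = iv[OF bw(2) 4(2)]
    let ?v = "smul (iv a) v" and ?w = "smul (iv b) w" and ?\<beta> = "B v w"
    have A: "?v \<in> A" "?w \<in> A" "?\<beta> \<in> L" using ia ib av bw by auto
    have "B ?w ?v = smul (iv b) (smul (iv a) ?\<beta>)"
      using B_smul_left[of w ?v "iv b"] B_smul_right[of w v "iv a"] B_sym[of v w] ia ib av bw by simp
    then have "?v \<perp> ?w \<longleftrightarrow> smul (iv b) (smul (iv a) ?\<beta>) = neg uni" using B_orth[of ?w ?v] A by simp
    also have "\<dots> \<longleftrightarrow> ?\<beta> = neg (smul a b)"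
    proof
      assume h: "smul (iv b) (smul (iv a) ?\<beta>) = neg uni"
      have "?\<beta> = smul a (smul b (smul (iv b) (smul (iv a) ?\<beta>)))"
        using iv_cancel(2)[OF bw(2) 4(2), of "smul (iv a) ?\<beta>"] iv_cancel(2)[OF av(2) 4(1), of ?\<beta>] A ia by simp
      then show "?\<beta> = neg (smul a b)" unfolding h using av bw smul_uni by (simp add: smul_neg_right)
    next
      assume "?\<beta> = neg (smul a b)"
      then show "smul (iv b) (smul (iv a) ?\<beta>) = neg uni"
        using iv_cancel(1)[OF av(2) 4(1), of b] ia ib av bw by (simp add: smul_neg_right)
    qed
    also have "\<dots> \<longleftrightarrow> add (smul a b) ?\<beta> = org"
      using neg_unique[of "smul a b" ?\<beta>] add_neg_right[of "smul a b"] A av bw by auto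
    finally show ?thesis using 4 av bw by (simp add: pf_def ff_def)
  qed
qed

end

locale coordinatizable_orthoset = turning_orthoset S orth org uni + rotation_orthoset S orth rot
  for S :: "'a set" and orth (infix \<open>\<perp>\<close> 50) and org uni rot
begin

lemma coordinatized: "coordinatized_orthoset S orth rot KF HF ff pf"
proof -
  interpret q: quadratic_space KF HF ff by (rule quadratic_space_HF)
  show ?thesis
  proof
    show "\<exists>x\<in>carrier HF. ff x x = \<one>\<^bsub>KF\<^esub>"
      using smul_1[of uni] add_0_right[of uni] by (intro bexI[of _ "(uni, org)"]) (auto simp: ff_def)
  qed (use pf_in(3) pf_surj pf_eq pf_orth in blast)+
qed

end

section \<open>Transfer to a subfield of the reals\<close>

locale real_coordinates = coordinatized_orthoset S orth rot K H form pt + archimedean_record_field K P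
  for S :: "'a set" and orth (infix \<open>\<perp>\<close> 50) and rot
    and K :: "('k, 'm) ring_scheme" (structure) and H :: "('k, 'v, 'n) module_scheme" (structure) and form and pt and P
begin

definition rep :: "'a \<Rightarrow> 'v" where "rep y = (SOME r. r \<in> carrier H \<and> r \<noteq> vz \<and> pt r = y)"

lemma rep: assumes "y \<in> S" shows "rep y \<in> carrier H" "rep y \<noteq> vz" "pt (rep y) = y"
proof -
  have "\<exists>r. r \<in> carrier H \<and> r \<noteq> vz \<and> pt r = y" using pt_surj[OF assms] by blast
  from someI_ex[OF this] show "rep y \<in> carrier H" "rep y \<noteq> vz" "pt (rep y) = y" unfolding rep_def by auto
qed

text \<open>A vector is encoded by its inner products with chosen representatives of all points.\<close>

definition vec :: "'v \<Rightarrow> 'a \<Rightarrow> real" where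
  "vec x = (\<lambda>y. if y \<in> S then eta (form x (rep y)) else 0)"

lemma vec_add: "\<lbrakk>x \<in> carrier H; y \<in> carrier H\<rbrakk> \<Longrightarrow> vec (x \<boxplus> y) = (\<lambda>z. vec x z + vec y z)"
  unfolding vec_def using rep(1) by (auto simp: form_simps eta_add)

lemma vec_smult: "\<lbrakk>c \<in> carrier K; x \<in> carrier H\<rbrakk> \<Longrightarrow> vec (c \<bullet> x) = (\<lambda>z. eta c * vec x z)"
  unfolding vec_def using rep(1) by (auto simp: form_simps eta_mult)

lemma vec_zero: "vec vz = (\<lambda>z. 0)"
  unfolding vec_def using rep(1) by (auto simp: eta_zero)

text \<open>One of the chosen representatives spans the line of the difference \<open>x - y\<close>.
  Equal codes thus give equal products with \<open>x - y\<close>, which is the situation of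
  \<open>vec_eqI\<close>.\<close>

lemma vec_inj: assumes x: "x \<in> carrier H" and y: "y \<in> carrier H" and eq: "vec x = vec y" shows "x = y"
proof (rule ccontr)
  assume ne: "x \<noteq> y"
  let ?d = "x \<boxplus> (\<ominus> \<one>) \<bullet> y"
  have d: "?d \<in> carrier H" "?d \<noteq> vz" using x y vec_diff_zero ne by auto
  let ?r = "rep (pt ?d)"
  have S: "pt ?d \<in> S" using pt_in d by blast
  note r = rep[OF S]
  obtain c where c: "c \<in> carrier K" "?d = c \<bullet> ?r" using pt_eq[OF r(1) d(1) r(2) d(2)] r by auto
  have "eta (form x ?r) = eta (form y ?r)" using fun_cong[OF eq, of "pt ?d"] S by (simp add: vec_def)
  then have fr: "form x ?r = form y ?r" using eta_inj form_closed x y r by blast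
  have "form x ?d = form y ?d"
    using form_smult_right[OF c(1) r(1) x] form_smult_right[OF c(1) r(1) y] c(2) fr by simp
  then show False using vec_eqI[OF x y] ne by blast
qed

lemma vec_inj_on: "inj_on vec (carrier H)"
  using vec_inj by (auto simp: inj_on_def)

definition RF :: "real set" where "RF = eta ` carrier K"

definition HR :: "(real, 'a \<Rightarrow> real) module" where
  "HR = \<lparr>carrier = vec ` carrier H, monoid.mult = undefined, one = undefined, ring.zero = (\<lambda>z. 0),
     ring.add = (\<lambda>f g z. f z + g z), module.smult = (\<lambda>c f z. c * f z)\<rparr>"

definition formR :: "('a \<Rightarrow> real) \<Rightarrow> ('a \<Rightarrow> real) \<Rightarrow> real" where
  "formR f g = eta (form (inv_into (carrier H) vec f) (inv_into (carrier H) vec g))"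

abbreviation RK :: "real ring" where "RK \<equiv> real_ring\<lparr>carrier := RF\<rparr>"

lemma RK_simps [simp]: "carrier RK = RF" "a \<otimes>\<^bsub>real_ring\<^esub> b = a * b" "\<one>\<^bsub>real_ring\<^esub> = 1" "\<zero>\<^bsub>real_ring\<^esub> = 0"
  "a \<oplus>\<^bsub>real_ring\<^esub> b = a + b" for a b :: real
  by (simp_all add: ring_of_type_algebra_def)

lemma HR_simps [simp]: "carrier HR = vec ` carrier H" "\<zero>\<^bsub>HR\<^esub> = (\<lambda>z. 0)"
  "f \<oplus>\<^bsub>HR\<^esub> g = (\<lambda>z. f z + g z)" "c \<odot>\<^bsub>HR\<^esub> f = (\<lambda>z. c * f z)"
  by (simp_all add: HR_def)

lemma formR_vec: "\<lbrakk>x \<in> carrier H; y \<in> carrier H\<rbrakk> \<Longrightarrow> formR (vec x) (vec y) = eta (form x y)"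
  unfolding formR_def by (simp add: inv_into_f_f[OF vec_inj_on])

lemma field_RK: "field RK"
proof -
  have ab: "abelian_group RK"
  proof (rule abelian_groupI)
    show "\<exists>y\<in>carrier RK. y \<oplus>\<^bsub>RK\<^esub> x = \<zero>\<^bsub>RK\<^esub>" if x: "x \<in> carrier RK" for x
    proof -
      obtain a where a: "a \<in> carrier K" "x = eta a" using x by (auto simp: RF_def)
      have "eta (\<ominus> a) \<in> RF" unfolding RF_def using a by blast
      then show ?thesis using eta_minus[of a] a by (intro bexI[of _ "eta (\<ominus> a)"]) simp_all
    qed
    show "x \<oplus>\<^bsub>RK\<^esub> y \<in> carrier RK" if "x \<in> carrier RK" "y \<in> carrier RK" for x y
      using that eta_add by (auto simp: RF_def) (metis K.a_closed image_eqI)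
    show "\<zero>\<^bsub>RK\<^esub> \<in> carrier RK" using eta_zero by (auto simp: RF_def intro!: image_eqI[of _ _ \<zero>])
  qed (simp_all add: algebra_simps)
  have cm: "comm_monoid RK"
  proof (rule comm_monoidI)
    show "x \<otimes>\<^bsub>RK\<^esub> y \<in> carrier RK" if "x \<in> carrier RK" "y \<in> carrier RK" for x y
      using that eta_mult by (auto simp: RF_def) (metis K.m_closed image_eqI)
    show "\<one>\<^bsub>RK\<^esub> \<in> carrier RK" using eta_one by (auto simp: RF_def intro!: image_eqI[of _ _ \<one>])
  qed (simp_all add: algebra_simps)
  have "cring RK" by (rule cringI[OF ab cm]) (simp add: algebra_simps)
  then interpret r: cring RK .
  show ?thesis
  proof (rule r.cring_fieldI2)
    show "\<zero>\<^bsub>RK\<^esub> \<noteq> \<one>\<^bsub>RK\<^esub>" by simp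
    show "\<exists>b\<in>carrier RK. a \<otimes>\<^bsub>RK\<^esub> b = \<one>\<^bsub>RK\<^esub>" if x: "a \<in> carrier RK" "a \<noteq> \<zero>\<^bsub>RK\<^esub>" for a
    proof -
      obtain k where k: "k \<in> carrier K" "a = eta k" using x by (auto simp: RF_def)
      have "k \<noteq> \<zero>" using x k eta_zero by auto
      note ik = field_inv[OF k(1) this]
      have "a * eta (inv k) = 1" using eta_mult[of k "inv k"] eta_one k ik by simp
      then show ?thesis using ik by (intro bexI[of _ "eta (inv k)"]) (auto simp: RF_def)
    qed
  qed
qed

lemma subfield_RF: "subfield RF real_ring"
proof -
  interpret r: field real_ring by (rule field_from_type_algebra)
  show ?thesis by (rule r.subfield_iff(1)[OF field_RK]) (simp add: ring_of_type_algebra_def)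
qed

lemma module_HR: "module RK HR"
proof (rule moduleI)
  show "cring RK" using field_RK by (simp add: field_def domain_def)
  show "abelian_group HR"
  proof (rule abelian_groupI)
    show "x \<oplus>\<^bsub>HR\<^esub> y \<in> carrier HR" if "x \<in> carrier HR" "y \<in> carrier HR" for x y
    proof -
      obtain u v where "u \<in> carrier H" "v \<in> carrier H" "x = vec u" "y = vec v" using \<open>x \<in> carrier HR\<close> \<open>y \<in> carrier HR\<close> by auto
      then show ?thesis using vec_add[of u v] by (simp add: image_eqI[of _ _ "u \<boxplus> v"])
    qed
    show "\<zero>\<^bsub>HR\<^esub> \<in> carrier HR" using vec_zero by (simp add: image_eqI[of _ _ vz])
    show "\<exists>y\<in>carrier HR. y \<oplus>\<^bsub>HR\<^esub> x = \<zero>\<^bsub>HR\<^esub>" if x: "x \<in> carrier HR" for x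
    proof -
      obtain u where u: "u \<in> carrier H" "x = vec u" using x by auto
      have "vec ((\<ominus> \<one>) \<bullet> u) = (\<lambda>z. - vec u z)" using vec_smult[of "\<ominus> \<one>" u] u eta_minus[of \<one>] eta_one by simp
      moreover have "vec ((\<ominus> \<one>) \<bullet> u) \<in> vec ` carrier H" using u by blast
      ultimately show ?thesis using u by (intro bexI[of _ "vec ((\<ominus> \<one>) \<bullet> u)"]) simp_all
    qed
  qed (auto simp: algebra_simps)
  show "a \<odot>\<^bsub>HR\<^esub> x \<in> carrier HR" if ax: "a \<in> carrier RK" "x \<in> carrier HR" for a x
  proof -
    obtain k u where "k \<in> carrier K" "u \<in> carrier H" "a = eta k" "x = vec u" using ax by (auto simp: RF_def)
    then show ?thesis using vec_smult[of k u] by (simp add: image_eqI[of _ _ "k \<bullet> u"])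
  qed
qed (auto simp: algebra_simps)

lemma quadratic_space_HR: "quadratic_space RK HR formR"
proof -
  interpret f: field RK by (rule field_RK)
  interpret m: module RK HR by (rule module_HR)
  show ?thesis
  proof
    show "\<one>\<^bsub>RK\<^esub> \<oplus>\<^bsub>RK\<^esub> \<one>\<^bsub>RK\<^esub> \<noteq> \<zero>\<^bsub>RK\<^esub>" by simp
    fix u v assume "u \<in> carrier HR" "v \<in> carrier HR"
    then obtain x y where xy: "x \<in> carrier H" "u = vec x" "y \<in> carrier H" "v = vec y" by auto
    show "formR u v \<in> carrier RK" using xy form_closed by (simp add: formR_vec RF_def)
    show "formR u v = formR v u" using xy form_sym[of x y] by (simp add: formR_vec)
    show "formR (u \<oplus>\<^bsub>HR\<^esub> v) w = formR u w \<oplus>\<^bsub>RK\<^esub> formR v w" if "w \<in> carrier HR" for w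
    proof -
      obtain t where t: "t \<in> carrier H" "w = vec t" using \<open>w \<in> carrier HR\<close> by auto
      have "u \<oplus>\<^bsub>HR\<^esub> v = vec (x \<boxplus> y)" using vec_add xy by simp
      then show ?thesis using xy t by (simp add: formR_vec form_simps eta_add)
    qed
    show "formR (a \<odot>\<^bsub>HR\<^esub> u) v = a \<otimes>\<^bsub>RK\<^esub> formR u v" if "a \<in> carrier RK" for a
    proof -
      obtain k where k: "k \<in> carrier K" "a = eta k" using \<open>a \<in> carrier RK\<close> by (auto simp: RF_def)
      have "a \<odot>\<^bsub>HR\<^esub> u = vec (k \<bullet> x)" using vec_smult xy k by simp
      then show ?thesis using xy k by (simp add: formR_vec form_simps eta_mult)
    qed
  next
    fix u assume "u \<in> carrier HR" "formR u u = \<zero>\<^bsub>RK\<^esub>"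
    then obtain x where x: "x \<in> carrier H" "u = vec x" "eta (form x x) = 0" by (auto simp: formR_vec)
    then have "x = vz" using eta_eq_0 form_closed form_anisotropic by blast
    then show "u = \<zero>\<^bsub>HR\<^esub>" using x vec_zero by simp
  qed
qed

lemma vec_nz: "\<lbrakk>x \<in> carrier H; x \<noteq> vz\<rbrakk> \<Longrightarrow> vec x \<noteq> (\<lambda>z. 0)"
  using vec_inj[of x vz] vec_zero by auto

lemma norm_eta_pos: assumes x: "x \<in> carrier H" "x \<noteq> vz" shows "eta (form x x) > 0"
proof -
  obtain c where c: "c \<in> carrier K" "c \<noteq> \<zero>" "form (c \<bullet> x) (c \<bullet> x) = \<one>" using normalize[OF x] .
  have "form (c \<bullet> x) (c \<bullet> x) = c \<otimes> (c \<otimes> form x x)" using c(1) x by (simp add: form_simps)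
  then have "eta c * eta c * eta (form x x) = 1" using c eta_one eta_mult form_closed[of x x] x by simp
  then have "0 < eta c * eta c * eta (form x x)" by simp
  then show ?thesis by (metis zero_less_mult_pos not_square_less_zero mult_eq_0_iff linorder_neqE_linordered_idom less_irrefl)
qed

lemma positive_definite_HR: "positive_definite HR formR"
  unfolding positive_definite_def
proof (intro ballI impI)
  fix u assume "u \<in> carrier HR" "u \<noteq> \<zero>\<^bsub>HR\<^esub>"
  then obtain x where x: "x \<in> carrier H" "u = vec x" "x \<noteq> vz" using vec_zero by auto
  then show "formR u u > 0" using norm_eta_pos by (simp add: formR_vec)
qed

lemma line_HR: assumes "x \<in> carrier H" shows "line RK HR (vec x) = {vec (c \<bullet> x) | c. c \<in> carrier K}"
proof -
  have "line RK HR (vec x) = (\<lambda>c z. eta c * vec x z) ` carrier K"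
    by (simp add: line_def Setcompr_eq_image RF_def image_image)
  also have "\<dots> = (\<lambda>c. vec (c \<bullet> x)) ` carrier K" by (rule image_cong) (simp_all add: vec_smult assms)
  also have "\<dots> = {vec (c \<bullet> x) | c. c \<in> carrier K}" by (simp add: Setcompr_eq_image)
  finally show ?thesis .
qed

lemma line_eq_iff:
  assumes x: "x \<in> carrier H" "x \<noteq> vz" and y: "y \<in> carrier H" "y \<noteq> vz"
  shows "line RK HR (vec x) = line RK HR (vec y) \<longleftrightarrow> pt x = pt y"
proof
  assume "line RK HR (vec x) = line RK HR (vec y)"
  moreover have "vec y \<in> line RK HR (vec y)" unfolding line_HR[OF y(1)] using y by (auto intro!: exI[of _ \<one>])
  ultimately obtain c where c: "c \<in> carrier K" "vec y = vec (c \<bullet> x)" unfolding line_HR[OF x(1)] by auto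
  then have "y = c \<bullet> x" using vec_inj x y by simp
  then show "pt x = pt y" using pt_eq[OF x(1) y(1) x(2) y(2)] c by blast
next
  assume "pt x = pt y"
  then obtain c where c: "c \<in> carrier K" "y = c \<bullet> x" using pt_eq[OF x(1) y(1) x(2) y(2)] by blast
  have cn: "c \<noteq> \<zero>" using c y x by (auto simp: smult_l_null)
  note ic = field_inv[OF c(1) cn]
  have "vec (d \<bullet> y) = vec ((d \<otimes> c) \<bullet> x)" if "d \<in> carrier K" for d using smult_assoc1 c x that by simp
  moreover have "vec (d \<bullet> x) = vec ((d \<otimes> inv c) \<bullet> y)" if d: "d \<in> carrier K" for d
  proof -
    have "(d \<otimes> inv c) \<bullet> y = (d \<otimes> inv c \<otimes> c) \<bullet> x" using smult_assoc1[of "d \<otimes> inv c" c x] c x d ic by simp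
    then show ?thesis using d c(1) ic by (simp add: K.m_assoc)
  qed
  ultimately show "line RK HR (vec x) = line RK HR (vec y)"
    unfolding line_HR[OF x(1)] line_HR[OF y(1)] using c(1) ic by (auto, metis K.m_closed, metis K.m_closed)
qed

lemma lines_HR: "lines RK HR = {line RK HR (vec x) | x. x \<in> carrier H \<and> x \<noteq> vz}"
  unfolding lines_def using vec_nz vec_zero by auto

lemma unit_in_line: assumes "l \<in> lines RK HR" shows "\<exists>u\<in>l. formR u u = 1"
proof -
  obtain x where x: "l = line RK HR (vec x)" "x \<in> carrier H" "x \<noteq> vz" using assms unfolding lines_HR by blast
  obtain c where c: "c \<in> carrier K" "c \<noteq> \<zero>" "form (c \<bullet> x) (c \<bullet> x) = \<one>" using normalize[OF x(2,3)] .
  have "vec (c \<bullet> x) \<in> l" unfolding x(1) line_HR[OF x(2)] using c by blast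
  moreover have "formR (vec (c \<bullet> x)) (vec (c \<bullet> x)) = 1" using c x eta_one by (simp add: formR_vec)
  ultimately show ?thesis by blast
qed

lemma lines_perp_HR:
  assumes x: "x \<in> carrier H" "x \<noteq> vz" and y: "y \<in> carrier H" "y \<noteq> vz"
  shows "lines_perp RK HR formR (line RK HR (vec x)) (line RK HR (vec y)) \<longleftrightarrow> pt x \<perp> pt y"
proof
  assume "lines_perp RK HR formR (line RK HR (vec x)) (line RK HR (vec y))"
  then obtain u v where uv: "u \<in> carrier HR - {\<zero>\<^bsub>HR\<^esub>}" "v \<in> carrier HR - {\<zero>\<^bsub>HR\<^esub>}"
    "line RK HR (vec x) = line RK HR u" "line RK HR (vec y) = line RK HR v" "formR u v = \<zero>\<^bsub>RK\<^esub>"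
    unfolding lines_perp_def by blast
  obtain x' y' where xy: "x' \<in> carrier H" "u = vec x'" "y' \<in> carrier H" "v = vec y'" using uv by auto
  have nz: "x' \<noteq> vz" "y' \<noteq> vz" using uv xy vec_zero by auto
  have "eta (form x' y') = 0" using uv(5) xy by (simp add: formR_vec)
  then have "form x' y' = \<zero>" using eta_eq_0 form_closed xy by blast
  then have "pt x' \<perp> pt y'" using pt_orth[OF xy(1,3) nz] by simp
  moreover have "pt x = pt x'" "pt y = pt y'"
    using line_eq_iff[OF x xy(1) nz(1)] line_eq_iff[OF y xy(3) nz(2)] uv xy by simp_all
  ultimately show "pt x \<perp> pt y" by simp
next
  assume "pt x \<perp> pt y"
  then have "formR (vec x) (vec y) = 0" using pt_orth[OF x(1) y(1) x(2) y(2)] x y eta_zero by (simp add: formR_vec)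
  then show "lines_perp RK HR formR (line RK HR (vec x)) (line RK HR (vec y))"
    unfolding lines_perp_def using x y vec_nz by (intro bexI[of _ "vec x"] bexI[of _ "vec y"]) auto
qed

lemma orthoset_iso_lines:
  assumes perp: "\<And>x y. \<lbrakk>x \<in> S; y \<in> S\<rbrakk> \<Longrightarrow> perp x y \<longleftrightarrow> x \<perp> y"
  shows "orthoset_iso S perp (lines RK HR) (lines_perp RK HR formR) (\<lambda>y. line RK HR (vec (rep y)))"
  unfolding orthoset_iso_def
proof (intro conjI ballI)
  show "bij_betw (\<lambda>y. line RK HR (vec (rep y))) S (lines RK HR)"
    unfolding bij_betw_def
  proof (intro conjI)
    show "inj_on (\<lambda>y. line RK HR (vec (rep y))) S"
      using line_eq_iff rep by (auto simp: inj_on_def)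
    show "(\<lambda>y. line RK HR (vec (rep y))) ` S = lines RK HR"
    proof
      show "(\<lambda>y. line RK HR (vec (rep y))) ` S \<subseteq> lines RK HR" unfolding lines_HR using rep by blast
      show "lines RK HR \<subseteq> (\<lambda>y. line RK HR (vec (rep y))) ` S"
      proof
        fix l assume "l \<in> lines RK HR"
        then obtain x where x: "l = line RK HR (vec x)" "x \<in> carrier H" "x \<noteq> vz" unfolding lines_HR by blast
        have S: "pt x \<in> S" using pt_in x by blast
        have "l = line RK HR (vec (rep (pt x)))" using line_eq_iff[OF x(2,3) rep(1,2)[OF S]] rep(3)[OF S] x by simp
        then show "l \<in> (\<lambda>y. line RK HR (vec (rep y))) ` S" using S by blast
      qed
    qed
  qed
  fix y z assume "y \<in> S" "z \<in> S"
  then show "perp y z \<longleftrightarrow> lines_perp RK HR formR (line RK HR (vec (rep y))) (line RK HR (vec (rep z)))"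
    using perp lines_perp_HR rep by simp
qed

end

section \<open>Divisibly transitive orthosets\<close>

lemma finite_ordLeq_iff:
  "\<lbrakk>finite A; finite B\<rbrakk> \<Longrightarrow> |A| \<le>o |B| \<longleftrightarrow> card A \<le> card B"
  using inj_on_iff_card_le[of A B] card_of_ordLeq[of A B] by blast

text \<open>If all orthogonal sets had at most three elements, the rank would be at most three. The
  comparison is with a cardinal on \<open>nat\<close>, hence the use of
  \<open>orthoset_rank_least\<close> for arbitrary types.\<close>

lemma orthoset_rank_ge_4:
  assumes "|{..<4::nat}| \<le>o orthoset_rank S perp"
  obtains a b c d where "mutually_orthogonal S perp {a, b, c, d}" "distinct [a, b, c, d]"
proof -
  have "\<exists>D. mutually_orthogonal S perp D \<and> \<not> |D| \<le>o |{..<3::nat}|"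
  proof (rule ccontr)
    assume "\<not> ?thesis"
    then have "orthoset_rank S perp \<le>o |{..<3::nat}|" by (intro orthoset_rank_least) (auto simp: card_of_Card_order)
    then have "|{..<4::nat}| \<le>o |{..<3::nat}|" using assms ordLeq_transitive by blast
    then show False using finite_ordLeq_iff[of "{..<4::nat}" "{..<3::nat}"] by simp
  qed
  then obtain D where D: "mutually_orthogonal S perp D" "\<not> |D| \<le>o |{..<3::nat}|" by blast
  have "\<exists>T. finite T \<and> card T = 4 \<and> T \<subseteq> D"
  proof (cases "finite D")
    case True
    then have "4 \<le> card D" using D finite_ordLeq_iff[OF True, of "{..<3::nat}"] by simp
    then show ?thesis using obtain_subset_with_card_n by metis
  next
    case False then show ?thesis using infinite_arbitrarily_large by blast
  qed
  then obtain T where T: "finite T" "card T = Suc (Suc (Suc (Suc 0)))" "T \<subseteq> D" by (auto simp: eval_nat_numeral)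
  then obtain a b c d where "T = {a, b, c, d}" "distinct [a, b, c, d]" by (auto simp: card_Suc_eq)
  moreover have "mutually_orthogonal S perp T" using D T unfolding mutually_orthogonal_def pairwise_def by blast
  ultimately show ?thesis using that by simp
qed

section \<open>The automorphism group and its rotations\<close>

lemma orthogroup_simps [simp]:
  "carrier (orthogroup S perp) = {\<phi> \<in> Bij S. orthoset_iso S perp S perp \<phi>}"
  "\<one>\<^bsub>orthogroup S perp\<^esub> = (\<lambda>x\<in>S. x)"
  by (auto simp: orthogroup_def BijGroup_def)

lemma orthogroup_mult:
  "\<lbrakk>\<phi> \<in> Bij S; \<psi> \<in> Bij S\<rbrakk> \<Longrightarrow> \<phi> \<otimes>\<^bsub>orthogroup S perp\<^esub> \<psi> = compose S \<phi> \<psi>"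
  by (simp add: orthogroup_def BijGroup_def)

lemma subgroup_orthogroup:
  "subgroup {\<phi> \<in> carrier (BijGroup S). orthoset_iso S perp S perp \<phi>} (BijGroup S)"
proof (rule group.subgroupI[OF group_BijGroup])
  let ?A = "{\<phi> \<in> carrier (BijGroup S). orthoset_iso S perp S perp \<phi>}"
  show "?A \<subseteq> carrier (BijGroup S)" by blast
  have "(\<lambda>x\<in>S. x) \<in> ?A" using id_Bij[of S] by (auto simp: BijGroup_def orthoset_iso_def Bij_def)
  then show "?A \<noteq> {}" by blast
  fix a assume a: "a \<in> ?A"
  then have aB: "a \<in> Bij S" and ap: "\<And>p q. \<lbrakk>p \<in> S; q \<in> S\<rbrakk> \<Longrightarrow> perp p q \<longleftrightarrow> perp (a p) (a q)"
    by (auto simp: BijGroup_def orthoset_iso_def)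
  have bij: "bij_betw a S S" using aB by (simp add: Bij_def)
  let ?i = "\<lambda>x\<in>S. inv_into S a x"
  have i: "?i \<in> Bij S" using restrict_inv_into_Bij[OF aB] .
  have "perp p q \<longleftrightarrow> perp (?i p) (?i q)" if "p \<in> S" "q \<in> S" for p q
    using ap[of "inv_into S a p" "inv_into S a q"] that bij_betw_inv_into_right[OF bij] bij_betwE[OF bij_betw_inv_into[OF bij]]
    by simp
  then have "orthoset_iso S perp S perp ?i" using i by (simp add: orthoset_iso_def Bij_def)
  then show "inv\<^bsub>BijGroup S\<^esub> a \<in> ?A" using i inv_BijGroup[OF aB] by (simp add: BijGroup_def)
  fix b assume b: "b \<in> ?A"
  then have bB: "b \<in> Bij S" and bp: "\<And>p q. \<lbrakk>p \<in> S; q \<in> S\<rbrakk> \<Longrightarrow> perp p q \<longleftrightarrow> perp (b p) (b q)"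
    by (auto simp: BijGroup_def orthoset_iso_def)
  have bS: "b p \<in> S" if "p \<in> S" for p using bB that by (auto simp: Bij_def bij_betw_def)
  have c: "compose S a b \<in> Bij S" using compose_Bij aB bB by blast
  have "perp p q \<longleftrightarrow> perp (compose S a b p) (compose S a b q)" if "p \<in> S" "q \<in> S" for p q
    using ap[OF bS bS] bp that by (simp add: compose_def)
  then have "orthoset_iso S perp S perp (compose S a b)" using c by (simp add: orthoset_iso_def Bij_def)
  then show "a \<otimes>\<^bsub>BijGroup S\<^esub> b \<in> ?A" using c aB bB by (simp add: BijGroup_def)
qed

lemma group_orthogroup: "group (orthogroup S perp)"
  unfolding orthogroup_def by (rule group.subgroup_imp_group[OF group_BijGroup subgroup_orthogroup])

locale divisible_orthoset =
  fixes S :: "'a set" and perp :: "'a \<Rightarrow> 'a \<Rightarrow> bool"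
  assumes os: "orthoset S perp" and dt: "divisibly_transitive S perp"
    and four: "\<exists>a b c d. mutually_orthogonal S perp {a, b, c, d} \<and> distinct [a, b, c, d]"
begin

abbreviation G where "G \<equiv> orthogroup S perp"
abbreviation Rt where "Rt \<equiv> rotations S perp"

definition orth (infix \<open>\<perp>\<close> 50) where "x \<perp> y \<longleftrightarrow> x \<in> S \<and> y \<in> S \<and> perp x y"

sublocale G: group G by (rule group_orthogroup)

lemma orth_sym: "x \<perp> y \<Longrightarrow> y \<perp> x"
  using os unfolding orth_def orthoset_def symp_on_def by blast

lemma orth_irrefl: "\<not> x \<perp> x"
  using os unfolding orth_def orthoset_def irreflp_on_def by blast

lemma G_in: "\<lbrakk>\<phi> \<in> carrier G; x \<in> S\<rbrakk> \<Longrightarrow> \<phi> x \<in> S"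
  by (auto simp: Bij_def bij_betw_def)

lemma G_orth: "\<lbrakk>\<phi> \<in> carrier G; x \<in> S; y \<in> S\<rbrakk> \<Longrightarrow> \<phi> x \<perp> \<phi> y \<longleftrightarrow> x \<perp> y"
  using G_in[of \<phi>] by (auto simp: orth_def orthoset_iso_def)

lemma G_mult: "\<lbrakk>\<phi> \<in> carrier G; \<psi> \<in> carrier G; x \<in> S\<rbrakk> \<Longrightarrow> (\<phi> \<otimes>\<^bsub>G\<^esub> \<psi>) x = \<phi> (\<psi> x)"
  using orthogroup_mult[of \<phi> S \<psi> perp] by (simp add: compose_def)

lemma G_inv: 
  assumes "\<phi> \<in> carrier G" "x \<in> S"
  shows "(inv\<^bsub>G\<^esub> \<phi>) (\<phi> x) = x" "\<phi> ((inv\<^bsub>G\<^esub> \<phi>) x) = x"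
  using G_mult[of "inv\<^bsub>G\<^esub> \<phi>" \<phi> x] G_mult[of \<phi> "inv\<^bsub>G\<^esub> \<phi>" x] G.l_inv[OF assms(1)] G.r_inv[OF assms(1)]
    G.inv_closed[OF assms(1)] assms orthogroup_simps(2)[of S perp] by (metis restrict_apply')+

lemma G_inj: "\<lbrakk>\<phi> \<in> carrier G; x \<in> S; y \<in> S; \<phi> x = \<phi> y\<rbrakk> \<Longrightarrow> x = y"
  using G_inv(1) by metis

lemma dtD:
  assumes "e \<in> S" "f \<in> S" "e \<noteq> f"
  shows "subgroup (Rt e f) G" "comm_group (G \<lparr>carrier := Rt e f\<rparr>)" "\<exists>\<phi>\<in>Rt e f. \<phi> e = f"
    "\<And>e' f'. \<lbrakk>e' \<in> S; f' \<in> S; e' \<noteq> f'\<rbrakk> \<Longrightarrow> \<exists>\<tau>\<in>carrier G. \<tau> e = e' \<and>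
       Rt e f = (\<lambda>\<rho>. inv\<^bsub>G\<^esub> \<tau> \<otimes>\<^bsub>G\<^esub> \<rho> \<otimes>\<^bsub>G\<^esub> \<tau>) ` Rt e' f'"
  using dt assms unfolding divisibly_transitive_def by blast+

lemma Rt_G: "\<lbrakk>e \<in> S; f \<in> S; e \<noteq> f; \<rho> \<in> Rt e f\<rbrakk> \<Longrightarrow> \<rho> \<in> carrier G"
  unfolding rotations_def pair_group_def by blast

lemma Rt_fix: "\<lbrakk>\<rho> \<in> Rt e f; z \<perp> e; z \<perp> f\<rbrakk> \<Longrightarrow> \<rho> z = z"
  unfolding rotations_def pair_group_def orth_def by blast

text \<open>With \<open>\<tau>\<close> from (DT2) let \<open>g\<close> be the preimage of
  \<open>f'\<close>. Conjugating a rotation that takes \<open>e'\<close> to \<open>f'\<close> gives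
  one in \<open>Rt e f\<close> taking \<open>e\<close> to \<open>g\<close>; it fixes whatever is
  orthogonal to \<open>e\<close> and \<open>f\<close>, which is therefore orthogonal to
  \<open>g\<close>. The converse uses a rotation taking \<open>e\<close> to \<open>f\<close> in the
  same way.\<close>

lemma transport_partner:
  assumes e: "e \<in> S" "f \<in> S" "e \<noteq> f" and e': "e' \<in> S" "f' \<in> S" "e' \<noteq> f'"
  shows "\<exists>g\<in>S. g \<noteq> e \<and> (g \<perp> e \<longleftrightarrow> f' \<perp> e') \<and> (\<forall>z. z \<perp> e \<and> z \<perp> f \<longleftrightarrow> z \<perp> e \<and> z \<perp> g)"
proof -
  obtain \<tau> where t: "\<tau> \<in> carrier G" "\<tau> e = e'"
    and R: "Rt e f = (\<lambda>\<rho>. inv\<^bsub>G\<^esub> \<tau> \<otimes>\<^bsub>G\<^esub> \<rho> \<otimes>\<^bsub>G\<^esub> \<tau>) ` Rt e' f'" using dtD(4)[OF e e'] by blast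
  have it: "inv\<^bsub>G\<^esub> \<tau> \<in> carrier G" using t(1) by (rule G.inv_closed)
  define g where "g = (inv\<^bsub>G\<^esub> \<tau>) f'"
  have g: "g \<in> S" "\<tau> g = f'" using G_in[OF it e'(2)] G_inv(2)[OF t(1) e'(2)] g_def by auto
  have conj: "(inv\<^bsub>G\<^esub> \<tau> \<otimes>\<^bsub>G\<^esub> \<rho> \<otimes>\<^bsub>G\<^esub> \<tau>) x = (inv\<^bsub>G\<^esub> \<tau>) (\<rho> (\<tau> x))" if "\<rho> \<in> Rt e' f'" "x \<in> S" for \<rho> x
  proof -
    have r: "\<rho> \<in> carrier G" using Rt_G e' that by blast
    show ?thesis using G_mult[OF G.m_closed[OF it r] t(1) that(2)] G_mult[OF it r G_in[OF t(1) that(2)]] by simp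
  qed
  obtain \<rho>' where r': "\<rho>' \<in> Rt e' f'" "\<rho>' e' = f'" using dtD(3)[OF e'] by blast
  define \<rho> where "\<rho> = inv\<^bsub>G\<^esub> \<tau> \<otimes>\<^bsub>G\<^esub> \<rho>' \<otimes>\<^bsub>G\<^esub> \<tau>"
  have r: "\<rho> \<in> Rt e f" "\<rho> e = g" using R r' conj[OF r'(1) e(1)] t unfolding \<rho>_def g_def by auto
  obtain \<rho>2 where r2: "\<rho>2 \<in> Rt e f" "\<rho>2 e = f" using dtD(3)[OF e] by blast
  then obtain \<rho>2' where r2': "\<rho>2' \<in> Rt e' f'" "\<rho>2 = inv\<^bsub>G\<^esub> \<tau> \<otimes>\<^bsub>G\<^esub> \<rho>2' \<otimes>\<^bsub>G\<^esub> \<tau>" using R by blast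
  have "z \<perp> g" if z: "z \<perp> e" "z \<perp> f" for z
    using G_orth[OF Rt_G[OF e r(1)], of z e] Rt_fix[OF r(1) z] r(2) z e unfolding orth_def by auto
  moreover have "z \<perp> f" if z: "z \<perp> e" "z \<perp> g" for z
  proof -
    have zS: "z \<in> S" using z unfolding orth_def by blast
    have "\<tau> z \<perp> e'" "\<tau> z \<perp> f'" using G_orth[OF t(1) zS e(1)] G_orth[OF t(1) zS g(1)] z t g by auto
    then have "\<rho>2' (\<tau> z) = \<tau> z" using Rt_fix[OF r2'(1)] by blast
    then have "\<rho>2 z = z" using conj[OF r2'(1) zS] r2' G_inv(1)[OF t(1) zS] by simp
    then show ?thesis using G_orth[OF Rt_G[OF e r2(1)] zS e(1)] r2 z by simp
  qed
  moreover have "g \<perp> e \<longleftrightarrow> f' \<perp> e'" using G_orth[OF t(1) g(1) e(1)] t g by simp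
  moreover have "g \<noteq> e" using t g e' by auto
  ultimately show ?thesis using g by blast
qed

lemma four_orth:
  obtains a b c d where "a \<perp> b" "a \<perp> c" "a \<perp> d" "b \<perp> c" "b \<perp> d" "c \<perp> d"
proof -
  obtain a b c d where h: "mutually_orthogonal S perp {a, b, c, d}" "distinct [a, b, c, d]" using four by blast
  have S: "{a, b, c, d} \<subseteq> S" and pw: "pairwise perp {a, b, c, d}" using h unfolding mutually_orthogonal_def by auto
  have "x \<perp> y" if "x \<in> {a, b, c, d}" "y \<in> {a, b, c, d}" "x \<noteq> y" for x y
    using that S pairwiseD[OF pw that] unfolding orth_def by blast
  then show ?thesis using that[of a b c d] h(2) by simp
qed

text \<open>Here divisibility enters, with exponent two. If distinct points were always orthogonal,
  every element of the pair group would permute \<open>e\<close> and \<open>f\<close>, because a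
  point sent elsewhere would land on a fixed point. Its square then fixes \<open>e\<close>; yet the
  rotation taking \<open>e\<close> to \<open>f\<close> is such a square.\<close>

lemma nonorth_ex: "\<exists>e\<in>S. \<exists>f\<in>S. e \<noteq> f \<and> \<not> f \<perp> e"
proof (rule ccontr)
  assume "\<not> ?thesis"
  then have "\<forall>e\<in>S. \<forall>f\<in>S. e = f \<or> f \<perp> e" by simp
  then have all: "x \<perp> y" if "x \<in> S" "y \<in> S" "x \<noteq> y" for x y using that by metis
  obtain e f where "e \<perp> f" using four_orth by metis
  then have e: "e \<in> S" "f \<in> S" "e \<noteq> f" using orth_irrefl unfolding orth_def by auto
  obtain \<phi> where p: "\<phi> \<in> Rt e f" "\<phi> e = f" using dtD(3)[OF e] by blast
  then obtain \<psi> where s: "\<psi> \<in> pair_group S perp e f" "\<phi> = \<psi> [^]\<^bsub>G\<^esub> (2::nat)"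
    unfolding rotations_def by (auto dest: spec[of _ 2])
  have sG: "\<psi> \<in> carrier G" using s unfolding pair_group_def by blast
  have "\<phi> = \<psi> \<otimes>\<^bsub>G\<^esub> \<psi>" using s(2) G.l_one[OF sG] by (simp add: numeral_2_eq_2)
  then have pe: "\<phi> e = \<psi> (\<psi> e)" using G_mult[OF sG sG e(1)] by simp
  have stay: "\<psi> x = e \<or> \<psi> x = f" if "x = e \<or> x = f" for x
  proof (rule ccontr)
    assume n: "\<not> ?thesis"
    have xS: "x \<in> S" "\<psi> x \<in> S" using that e G_in[OF sG] by auto
    then have "\<psi> x \<perp> e" "\<psi> x \<perp> f" using all e n by auto
    then have "\<psi> (\<psi> x) = \<psi> x" using s xS unfolding pair_group_def orth_def by blast
    then have "\<psi> x = x" using G_inj[OF sG] xS by blast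
    then show False using that n by auto
  qed
  show False
  proof (cases "\<psi> e = e")
    case True then show False using pe p e by simp
  next
    case False
    then have "\<psi> e = f" using stay by blast
    moreover then have "\<psi> f = e" using stay[of f] G_inj[OF sG e(1,2)] e(3) by auto
    ultimately show False using pe p e by simp
  qed
qed

text \<open>\<open>transport_partner\<close>, fed with an orthogonal and with a non-orthogonal pair,
  gives the two partner axioms; the automorphism of (DT2) carries four orthogonal points to a frame
  at any given point.\<close>

lemma projective: "projective_orthoset S orth"
proof
  show "x \<perp> y \<Longrightarrow> y \<perp> x" for x y by (rule orth_sym)
  show "\<not> x \<perp> x" for x by (rule orth_irrefl)
  show "x \<perp> y \<Longrightarrow> x \<in> S" for x y by (simp add: orth_def)
  fix e f assume e: "e \<in> S" "f \<in> S" "e \<noteq> f"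
  obtain a b where "a \<perp> b" using four_orth by metis
  then have ab: "b \<in> S" "a \<in> S" "b \<noteq> a" "a \<perp> b" using orth_irrefl unfolding orth_def by auto
  show "\<exists>g. g \<perp> e \<and> (\<forall>z. (z \<perp> e \<and> z \<perp> f) = (z \<perp> e \<and> z \<perp> g))"
    using transport_partner[OF e ab(1-3)] ab(4) by blast
  obtain a b where ab: "b \<in> S" "a \<in> S" "b \<noteq> a" "\<not> a \<perp> b" using nonorth_ex by blast
  show "\<exists>g\<in>S. g \<noteq> e \<and> \<not> g \<perp> e \<and> (\<forall>z. (z \<perp> e \<and> z \<perp> f) = (z \<perp> e \<and> z \<perp> g))"
    using transport_partner[OF e ab(1-3)] ab(4) by blast
next
  fix a assume a: "a \<in> S"
  obtain e f g h where o: "e \<perp> f" "e \<perp> g" "e \<perp> h" "f \<perp> g" "f \<perp> h" "g \<perp> h" using four_orth .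
  have S: "e \<in> S" "f \<in> S" "g \<in> S" "h \<in> S" "e \<noteq> f" using o orth_irrefl unfolding orth_def by auto
  obtain b where b: "b \<in> S" "b \<noteq> a" using S by metis
  obtain \<tau> where t: "\<tau> \<in> carrier G" "\<tau> e = a" using dtD(4)[OF S(1,2,5) a b(1)] b by blast
  have "\<tau> f \<perp> \<tau> e" "\<tau> g \<perp> \<tau> e" "\<tau> h \<perp> \<tau> e" "\<tau> f \<perp> \<tau> g" "\<tau> f \<perp> \<tau> h" "\<tau> g \<perp> \<tau> h"
    using G_orth[OF t(1)] S o orth_sym by auto
  then show "\<exists>b c d. b \<perp> a \<and> c \<perp> a \<and> d \<perp> a \<and> b \<perp> c \<and> b \<perp> d \<and> c \<perp> d" using t by blast
qed

lemma rotation: "rotation_orthoset S orth Rt"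
proof -
  interpret projective_orthoset S orth by (rule projective)
  show ?thesis
  proof
    fix e f assume e: "e \<in> S" "f \<in> S" "e \<noteq> f"
    show "aut \<rho>" if "\<rho> \<in> Rt e f" for \<rho>
      using Rt_G[OF e that] G_orth[OF Rt_G[OF e that]] unfolding aut_def by (auto simp: Bij_def)
    show "\<rho> z = z" if "\<rho> \<in> Rt e f" "z \<perp> e" "z \<perp> f" for \<rho> z using Rt_fix that by blast
    show "\<exists>\<rho>\<in>Rt e f. \<rho> e = f" using dtD(3)[OF e] .
    fix \<rho> \<sigma> assume r: "\<rho> \<in> Rt e f" "\<sigma> \<in> Rt e f"
    note rG = Rt_G[OF e r(1)] Rt_G[OF e r(2)]
    interpret c: comm_group "G \<lparr>carrier := Rt e f\<rparr>" by (rule dtD(2)[OF e])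
    have "\<rho> \<otimes>\<^bsub>G\<^esub> \<sigma> = \<sigma> \<otimes>\<^bsub>G\<^esub> \<rho>" using c.m_comm[of \<rho> \<sigma>] r by simp
    then show "\<rho> (\<sigma> x) = \<sigma> (\<rho> x)" if "x \<in> S" for x
      using G_mult[OF rG that] G_mult[OF rG(2,1) that] by simp
    have "\<rho> \<otimes>\<^bsub>G\<^esub> \<sigma> \<in> Rt e f" using subgroup.m_closed[OF dtD(1)[OF e] r] .
    then show "\<exists>\<tau>\<in>Rt e f. \<forall>x\<in>S. \<tau> x = \<rho> (\<sigma> x)" using G_mult[OF rG] by blast
  next
    fix e f e' f' assume S: "e \<in> S" "f \<in> S" "e' \<in> S" "f' \<in> S"
      and eq: "\<And>z. z \<perp> e \<and> z \<perp> f \<longleftrightarrow> z \<perp> e' \<and> z \<perp> f'"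
    have "perp z e \<and> perp z f \<longleftrightarrow> perp z e' \<and> perp z f'" if "z \<in> S" for z
      using eq[of z] S that unfolding orth_def by blast
    then have "pair_group S perp e f = pair_group S perp e' f'" unfolding pair_group_def by blast
    then show "Rt e f = Rt e' f'" unfolding rotations_def by simp
  qed
qed

lemma simple_rotations_G: "simple_rotations S perp \<subseteq> carrier G"
  unfolding simple_rotations_def using Rt_G by blast

lemma generate_G: "generate G (simple_rotations S perp) \<subseteq> carrier G"
  using G.generate_incl[OF simple_rotations_G] by blast

text \<open>The rotations moving every point to a near one form a normal subgroup of the rotation group.\<close>

lemma quasiprimitive_near:
  assumes qp: "quasiprimitive S perp"
    and sym: "\<And>x y. near x y \<Longrightarrow> near y x" and trans: "\<And>x y z. near x y \<Longrightarrow> near y z \<Longrightarrow> near x z"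
    and inv: "\<And>e f \<rho> x y. \<lbrakk>e \<in> S; f \<in> S; e \<noteq> f; \<rho> \<in> Rt e f; near x y\<rbrakk> \<Longrightarrow> near (\<rho> x) (\<rho> y)"
    and e: "e \<in> S" "f \<in> S" "e \<noteq> f" and t: "\<tau> \<in> Rt e f" "\<tau> e \<noteq> e" "\<And>x. x \<in> S \<Longrightarrow> near (\<tau> x) x"
    and x: "x \<in> S" and y: "y \<in> S"
  shows "near x y"
proof -
  let ?E = "generate G (simple_rotations S perp)"
  let ?R = "rotation_group S perp"
  have Rdef: "?R = G \<lparr>carrier := ?E\<rparr>" by (simp add: rotation_group_def)
  have sub: "subgroup ?E G" using G.generate_is_subgroup[OF simple_rotations_G] .
  have grp: "group ?R" unfolding Rdef using G.subgroup_imp_group[OF sub] .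
  \<comment> \<open>Reflexivity is obtained by going from \<open>z\<close> to
    \<open>\<tau> z\<close> and back.\<close>
  have refl: "near z z" if "z \<in> S" for z using trans[OF sym[OF t(3)[OF that]] t(3)[OF that]] .
  have pres: "\<forall>x\<in>S. \<forall>y\<in>S. near x y \<longrightarrow> near (g x) (g y)" if "g \<in> ?E" for g
    using that
  proof (induction rule: generate.induct)
    case one then show ?case by simp
  next
    case (incl h) then show ?case using inv unfolding simple_rotations_def by blast
  next
    \<comment> \<open>The inverse of a simple rotation is again in the same group
      \<open>Rt a b\<close>.\<close>
    case (inv h)
    then obtain a b where ab: "a \<in> S" "b \<in> S" "a \<noteq> b" "h \<in> Rt a b" unfolding simple_rotations_def by blast
    then have "inv\<^bsub>G\<^esub> h \<in> Rt a b" using subgroup.m_inv_closed[OF dtD(1)] by blast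
    then show ?case using assms(4) ab by blast
  next
    case (eng h1 h2)
    have h: "h1 \<in> carrier G" "h2 \<in> carrier G" using eng generate_G by auto
    show ?case using eng.IH G_mult[OF h] G_in[OF h(2)] by auto
  qed
  define N where "N = {g \<in> ?E. \<forall>x\<in>S. near (g x) x}"
  have NG: "g \<in> carrier G" "g \<in> ?E" if "g \<in> N" for g using that generate_G unfolding N_def by auto
  have "subgroup N ?R"
  proof (rule group.subgroupI[OF grp])
    show "N \<subseteq> carrier ?R" unfolding N_def Rdef by auto
    have "\<one>\<^bsub>G\<^esub> \<in> N" unfolding N_def using refl generate.one[of G "simple_rotations S perp"] by simp
    then show "N \<noteq> {}" by blast
    fix a assume a: "a \<in> N"
    have "near ((inv\<^bsub>G\<^esub> a) z) z" if z: "z \<in> S" for z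
    proof -
      have iS: "(inv\<^bsub>G\<^esub> a) z \<in> S" using G_in[OF G.inv_closed[OF NG(1)[OF a]] z] .
      then have "near (a ((inv\<^bsub>G\<^esub> a) z)) ((inv\<^bsub>G\<^esub> a) z)" using a unfolding N_def by blast
      then show ?thesis using G_inv(2)[OF NG(1)[OF a] z] sym by simp
    qed
    then show "inv\<^bsub>?R\<^esub> a \<in> N"
      unfolding Rdef using G.m_inv_consistent[OF sub NG(2)[OF a]] subgroup.m_inv_closed[OF sub NG(2)[OF a]] unfolding N_def by simp
    fix b assume b: "b \<in> N"
    have "near ((a \<otimes>\<^bsub>G\<^esub> b) z) z" if z: "z \<in> S" for z
      using G_mult[OF NG(1)[OF a] NG(1)[OF b] z] a b z G_in[OF NG(1)[OF b] z] trans unfolding N_def by fastforce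
    then show "a \<otimes>\<^bsub>?R\<^esub> b \<in> N" unfolding Rdef using subgroup.m_closed[OF sub NG(2)[OF a] NG(2)[OF b]] unfolding N_def by simp
  qed
  moreover have "g \<otimes>\<^bsub>?R\<^esub> h \<otimes>\<^bsub>?R\<^esub> inv\<^bsub>?R\<^esub> g \<in> N" if g: "g \<in> carrier ?R" and h: "h \<in> N" for g h
  proof -
    have gE: "g \<in> ?E" using g unfolding Rdef by simp
    have gG: "g \<in> carrier G" "inv\<^bsub>G\<^esub> g \<in> carrier G" "g \<otimes>\<^bsub>G\<^esub> h \<in> carrier G" 
      using subsetD[OF generate_G gE] G.inv_closed[OF subsetD[OF generate_G gE]] G.m_closed[OF subsetD[OF generate_G gE] NG(1)[OF h]] .
    have "near ((g \<otimes>\<^bsub>G\<^esub> h \<otimes>\<^bsub>G\<^esub> inv\<^bsub>G\<^esub> g) z) z" if z: "z \<in> S" for z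
    proof -
      let ?w = "(inv\<^bsub>G\<^esub> g) z"
      have w: "?w \<in> S" "h ?w \<in> S" using G_in[OF gG(2) z] G_in[OF NG(1)[OF h]] by auto
      have "near (h ?w) ?w" using h w unfolding N_def by blast
      then have "near (g (h ?w)) (g ?w)" using pres[OF gE] w by blast
      then show ?thesis using G_mult[OF gG(3,2) z] G_mult[OF gG(1) NG(1)[OF h] w(1)] G_inv(2)[OF gG(1) z] by simp
    qed
    moreover have "g \<otimes>\<^bsub>G\<^esub> h \<otimes>\<^bsub>G\<^esub> inv\<^bsub>G\<^esub> g \<in> ?E"
      using subgroup.m_closed[OF sub subgroup.m_closed[OF sub gE NG(2)[OF h]] subgroup.m_inv_closed[OF sub gE]] .
    ultimately show ?thesis unfolding Rdef using G.m_inv_consistent[OF sub gE] unfolding N_def by simp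
  qed
  ultimately have norm: "N \<lhd> ?R" using group.normal_inv_iff[OF grp] by blast
  have ts: "\<tau> \<in> simple_rotations S perp" unfolding simple_rotations_def using e t by blast
  have "\<tau> \<in> N" unfolding N_def using t ts by (auto intro: generate.incl)
  then have cl: "normal_closure ?R {\<tau>} \<subseteq> N" unfolding normal_closure_def using norm by blast
  have "\<tau> \<noteq> \<one>\<^bsub>G\<^esub>" using t e by auto
  then obtain \<phi> where "\<phi> \<in> normal_closure ?R {\<tau>}" "\<phi> y = x" using qp ts x y unfolding quasiprimitive_def by blast
  then show ?thesis using cl y unfolding N_def by blast
qed

end

theorem theorem7p7:
  fixes S :: "'a set" and perp :: "'a \<Rightarrow> 'a \<Rightarrow> bool"
  assumes "orthoset S perp"
    and "|{..<4::nat}| \<le>o orthoset_rank S perp"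
    and "divisibly_transitive S perp"
    and "quasiprimitive S perp"
  shows "\<exists>(F :: real set) (H :: (real, 'a \<Rightarrow> real) module) form.
           subfield F real_ring \<and>
           quadratic_space (real_ring\<lparr>carrier := F\<rparr>) H form \<and>
           positive_definite H form \<and>
           (\<forall>L\<in>lines (real_ring\<lparr>carrier := F\<rparr>) H. \<exists>u\<in>L. form u u = 1) \<and>
           (\<exists>f. orthoset_iso S perp
                  (lines (real_ring\<lparr>carrier := F\<rparr>) H)
                  (lines_perp (real_ring\<lparr>carrier := F\<rparr>) H form) f)"
proof -
  have "\<exists>a b c d. mutually_orthogonal S perp {a, b, c, d} \<and> distinct [a, b, c, d]"
    using orthoset_rank_ge_4[OF assms(2)] by metis
  then interpret D: divisible_orthoset S perp
    using assms(1,3) by unfold_locales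
  interpret r: rotation_orthoset S D.orth D.Rt by (rule D.rotation)
  obtain org where org: "org \<in> S" using assms(1) unfolding orthoset_def by blast
  interpret p: pointed_orthoset S D.orth org by unfold_locales (rule org)
  obtain i where i: "D.orth i org" using r.frame_at[OF org] by blast
  have ni: "org \<noteq> i" "i \<in> S" using i D.orth_irrefl unfolding D.orth_def by auto
  \<comment> \<open>Any affine point other than \<open>org\<close> can serve as unit scalar; a third
    point on a line joining \<open>org\<close> to a point at infinity is one.\<close>
  obtain uni where u: "uni \<in> r.pline org i" "uni \<noteq> org" "uni \<noteq> i" using r.third_point[OF org ni(2,1)] by blast
  have uA: "uni \<in> p.A" using p.inf_unique[OF p.org_A i u(1)] u r.pline_in unfolding p.A_def by blast
  interpret c: coordinatizable_orthoset S D.orth org uni D.Rt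
    by unfold_locales (use uA u(2) r.rot_quarter_turn in blast)+
  interpret k: coordinatized_orthoset S D.orth D.Rt c.KF c.HF c.ff c.pf by (rule c.coordinatized)
  obtain P where "ordered_record_field c.KF P" using k.ordering_ex by blast
  then interpret o: ordered_record_field c.KF P .
  interpret oc: ordered_coordinates S D.orth D.Rt c.KF c.HF c.ff c.pf P by unfold_locales
  have arch: "\<exists>n. o.nK n \<ominus>\<^bsub>c.KF\<^esub> a \<in> P" if a: "a \<in> carrier c.KF" for a
  proof (rule ccontr)
    assume "\<not> ?thesis"
    then obtain e f \<tau> where ef: "e \<in> S" "f \<in> S" "e \<noteq> f" "\<tau> \<in> D.Rt e f" "\<tau> e \<noteq> e" "\<And>x. x \<in> S \<Longrightarrow> oc.near (\<tau> x) x"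
      using oc.small_rotation_ex[OF a] by blast
    have "oc.near x y" if xy: "x \<in> S" "y \<in> S" for x y
    proof (rule D.quasiprimitive_near[where near = oc.near and e = e and f = f and \<tau> = \<tau>])
      show "oc.near b a" if "oc.near a b" for a b using that by (rule oc.near_sym)
      show "oc.near a c" if "oc.near a b" "oc.near b c" for a b c using that by (rule oc.near_trans)
      show "oc.near (\<rho> a) (\<rho> b)" if "g \<in> S" "h \<in> S" "g \<noteq> h" "\<rho> \<in> D.Rt g h" "oc.near a b" for g h \<rho> a b
        using that by (rule oc.near_rot)
    qed (use assms(4) ef xy in simp_all)
    then show False using oc.not_near_ex by blast
  qed
  interpret rc: real_coordinates S D.orth D.Rt c.KF c.HF c.ff c.pf P
    by unfold_locales (rule arch)
  have "orthoset_iso S perp (lines rc.RK rc.HR) (lines_perp rc.RK rc.HR rc.formR)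
      (\<lambda>y. line rc.RK rc.HR (rc.vec (rc.rep y)))"
    by (rule rc.orthoset_iso_lines) (simp add: D.orth_def)
  then show ?thesis
    using rc.subfield_RF rc.quadratic_space_HR rc.positive_definite_HR rc.unit_in_line by blast
qed

end
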